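(* Let $K$ be a perfect field, $\mathcal{A}$ a commutative domain of essentially finite type over $K$ with Jacobian ideal $\mathfrak{a}_r$, $\mathcal{D}(\mathcal{A})$ the algebra of differential operators on $\mathcal{A}$, and $R$ a subalgebra of $\mathcal{D}(\mathcal{A})$ containing $\mathcal{A}$ which is an essential (left) $\mathcal{A}$-submodule of $\mathcal{D}(\mathcal{A})$. Let $R_i=R\cap\mathcal{D}(\mathcal{A})_i$, and for $i\ge1$ let $\mathfrak{b}_i=\{a\in\mathcal{A}\mid a\mathcal{D}(\mathcal{A})_i\subseteq R_i\}$ and $\mathfrak{c}_i=\{a\in\mathcal{A}\mid\mathcal{D}(\mathcal{A})_ia\subseteq R_i\}$. The following are equivalent: (1) $R$ is simple. (2) $\mathcal{D}(\mathcal{A})$ is simple, and for every maximal ideal $\mathfrak{m}$ of $\mathcal{A}$ containing one of the ideals $\mathfrak{b}_i$ ($i\ge1$), the algebra $R_\mathfrak{m}$ is simple. (3) For every maximal ideal $\mathfrak{n}$ of $\mathcal{A}$ containing $\mathfrak{a}_r$ the algebra $\mathcal{D}(\mathcal{A})_\mathfrak{n}$ is simple, and for every maximal ideal $\mathfrak{m}$ of $\mathcal{A}$ containing one of the ideals $\mathfrak{b}_i$ ($i\geq1$), the algebra $R_\mathfrak{m}$ is simple. (4) $\mathcal{D}(\mathcal{A})$ is simple, and for every maximal ideal $\mathfrak{m}$ of $\mathcal{A}$ containing one of the ideals $\mathfrak{c}_i$ ($i\ge1$), the algebra $R_\mathfrak{m}$ is simple. (5) For every maximal ideal $\mathfrak{n}$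 of $\mathcal{A}$ containing $\mathfrak{a}_r$ the algebra $\mathcal{D}(\mathcal{A})_\mathfrak{n}$ is simple, and for every maximal ideal $\mathfrak{m}$ of $\mathcal{A}$ containing one of the ideals $\mathfrak{c}_i$ ($i\geq1$), the algebra $R_\mathfrak{m}$ is simple.
   Context: For a commutative $K$-algebra $R'$, $\mathcal{D}(R')=\bigcup_{i\ge0}\mathcal{D}(R')_i\subseteq\mathrm{End}_K(R')$ with $\mathcal{D}(R')_{-1}=0$, $\mathcal{D}(R')_i=\{u\mid ru-ur\in\mathcal{D}(R')_{i-1}\ \forall r\in R'\}$, and $R'=\mathcal{D}(R')_0$. Essentially finite type: a localization of a finitely generated commutative algebra. Write $\mathcal{A}=S^{-1}(P_n/I)$ with $P_n=K[x_1,\dots,x_n]$, $I=(f_1,\dots,f_m)$ prime; let $\overline{J}=(\overline{\partial f_i/\partial x_j})$ be the Jacobi matrix over $P_n/I$ and $r$ its rank over the fraction field; the Jacobian ideal $\mathfrak{a}_r$ is the ideal of $\mathcal{A}$ generated by all $r\times r$ minors of $\overline{J}$. For a maximal ideal $\mathfrak{m}$ of $\mathcal{A}$, $R_\mathfrak{m}$ and $\mathcal{D}(\mathcal{A})_\mathfrak{m}$ denote the localizations at the Ore set $\mathcal{A}\setminus\mathfrak{m}$. A submodule is essential if it meets every nonzero submodule nontrivially. *)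

theory Defs
  imports Main "HOL-Library.Poly_Mapping" "HOL-Combinatorics.Permutations"
    "HOL-Computational_Algebra.Fraction_Field"
begin

definition perfect_field :: "'k::field itself \<Rightarrow> bool" where
  "perfect_field _ \<longleftrightarrow> CHAR('k) = 0 \<or> (\<forall>y::'k. \<exists>z. z ^ CHAR('k) = y)"

definition kalg :: "('k::field \<Rightarrow> 'b::comm_ring_1) \<Rightarrow> bool" where
  "kalg h \<longleftrightarrow> h 1 = 1 \<and> (\<forall>a b. h (a + b) = h a + h b) \<and> (\<forall>a b. h (a * b) = h a * h b)"

definition is_ideal :: "'a::comm_ring_1 set \<Rightarrow> bool" where
  "is_ideal I \<longleftrightarrow> 0 \<in> I \<and> (\<forall>a\<in>I. \<forall>b\<in>I. a + b \<in> I) \<and> (\<forall>r. \<forall>a\<in>I. r * a \<in> I)"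

definition maximal_ideal :: "'a::comm_ring_1 set \<Rightarrow> bool" where
  "maximal_ideal M \<longleftrightarrow> is_ideal M \<and> M \<noteq> UNIV \<and>
     (\<forall>J. is_ideal J \<and> M \<subseteq> J \<longrightarrow> J = M \<or> J = UNIV)"

definition ideal_gen :: "'a::comm_ring_1 set \<Rightarrow> 'a set" where
  "ideal_gen G = \<Inter>{I. is_ideal I \<and> G \<subseteq> I}"

type_synonym 'k mpoly = "(nat \<Rightarrow>\<^sub>0 nat) \<Rightarrow>\<^sub>0 'k"

definition in_Pn :: "nat \<Rightarrow> ('k::zero) mpoly \<Rightarrow> bool" where
  "in_Pn n p \<longleftrightarrow> (\<forall>mon. mon \<in> Poly_Mapping.keys p \<longrightarrow> Poly_Mapping.keys mon \<subseteq> {..<n})"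

definition mpeval :: "('k::field \<Rightarrow> 'b::comm_ring_1) \<Rightarrow> (nat \<Rightarrow> 'b) \<Rightarrow> 'k mpoly \<Rightarrow> 'b" where
  "mpeval h x p = (\<Sum>mon\<in>Poly_Mapping.keys p. h (Poly_Mapping.lookup p mon) * (\<Prod>i\<in>Poly_Mapping.keys mon. x i ^ Poly_Mapping.lookup mon i))"

definition mpderiv :: "nat \<Rightarrow> ('k::field) mpoly \<Rightarrow> 'k mpoly" where
  "mpderiv j p = (\<Sum>mon\<in>Poly_Mapping.keys p.
      Poly_Mapping.single (mon - Poly_Mapping.single j 1) (of_nat (Poly_Mapping.lookup mon j) * Poly_Mapping.lookup p mon))"

text \<open>A is of essentially finite type, presented as S^{-1}(P_n/I) with
  I = (f_0,...,f_{m-1}): x gives the images of the variables, the kernel of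
  evaluation on P_n is I, and every element of A is a fraction b/s with
  b, s in the image of P_n and s invertible in A.\<close>
definition ess_fin_pres ::
  "('k::field \<Rightarrow> 'a::idom) \<Rightarrow> nat \<Rightarrow> (nat \<Rightarrow> 'a) \<Rightarrow> nat \<Rightarrow> (nat \<Rightarrow> 'k mpoly) \<Rightarrow> bool" where
  "ess_fin_pres h n x m f \<longleftrightarrow>
     (\<forall>i<m. in_Pn n (f i)) \<and>
     {p. in_Pn n p \<and> mpeval h x p = 0} = {(\<Sum>j<m. g j * f j) | g. \<forall>j<m. in_Pn n (g j)} \<and>
     (\<forall>a. \<exists>p s. in_Pn n p \<and> in_Pn n s \<and> mpeval h x s dvd 1 \<and> a * mpeval h x s = mpeval h x p)"

definition minor :: "(nat \<Rightarrow> nat \<Rightarrow> 'a::comm_ring_1) \<Rightarrow> nat \<Rightarrow> (nat \<Rightarrow> nat) \<Rightarrow> (nat \<Rightarrow> nat) \<Rightarrow> 'a" where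
  "minor M k rows cols =
     (\<Sum>p | p permutes {..<k}. of_int (sign p) * (\<Prod>l<k. M (rows l) (cols (p l))))"

definition minors :: "(nat \<Rightarrow> nat \<Rightarrow> 'a::comm_ring_1) \<Rightarrow> nat \<Rightarrow> nat \<Rightarrow> nat \<Rightarrow> 'a set" where
  "minors M m n k = {minor M k rows cols | rows cols.
      inj_on rows {..<k} \<and> rows ` {..<k} \<subseteq> {..<m} \<and>
      inj_on cols {..<k} \<and> cols ` {..<k} \<subseteq> {..<n}}"

text \<open>Rank over the fraction field of the domain = largest size of a nonzero minor.\<close>
definition mat_rank :: "(nat \<Rightarrow> nat \<Rightarrow> 'a::idom) \<Rightarrow> nat \<Rightarrow> nat \<Rightarrow> nat" where
  "mat_rank M m n = (GREATEST k. \<exists>d\<in>minors M m n k. d \<noteq> 0)"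

definition jacobi_matrix ::
  "('k::field \<Rightarrow> 'a::idom) \<Rightarrow> (nat \<Rightarrow> 'a) \<Rightarrow> (nat \<Rightarrow> 'k mpoly) \<Rightarrow> nat \<Rightarrow> nat \<Rightarrow> 'a" where
  "jacobi_matrix h x f i j = mpeval h x (mpderiv j (f i))"

definition jacobian_ideal ::
  "('k::field \<Rightarrow> 'a::idom) \<Rightarrow> nat \<Rightarrow> (nat \<Rightarrow> 'a) \<Rightarrow> nat \<Rightarrow> (nat \<Rightarrow> 'k mpoly) \<Rightarrow> 'a set" where
  "jacobian_ideal h n x m f =
     ideal_gen (minors (jacobi_matrix h x f) m n (mat_rank (jacobi_matrix h x f) m n))"

definition klin_on :: "'b::comm_ring_1 set \<Rightarrow> ('k::field \<Rightarrow> 'b) \<Rightarrow> ('b \<Rightarrow> 'b) \<Rightarrow> bool" where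
  "klin_on C h u \<longleftrightarrow> (\<forall>a\<in>C. u a \<in> C) \<and> (\<forall>a\<in>C. \<forall>b\<in>C. u (a + b) = u a + u b) \<and>
     (\<forall>c. \<forall>a\<in>C. u (h c * a) = h c * u a) \<and> (\<forall>a. a \<notin> C \<longrightarrow> u a = 0)"

definition commut_on :: "'b::comm_ring_1 set \<Rightarrow> 'b \<Rightarrow> ('b \<Rightarrow> 'b) \<Rightarrow> ('b \<Rightarrow> 'b)" where
  "commut_on C r u = (\<lambda>a. if a \<in> C then r * u a - u (r * a) else 0)"

fun Dop_on :: "'b::comm_ring_1 set \<Rightarrow> ('k::field \<Rightarrow> 'b) \<Rightarrow> nat \<Rightarrow> ('b \<Rightarrow> 'b) set" where
  "Dop_on C h 0 = {u. klin_on C h u \<and> (\<forall>r\<in>C. commut_on C r u = (\<lambda>_. 0))}"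
| "Dop_on C h (Suc i) = {u. klin_on C h u \<and> (\<forall>r\<in>C. commut_on C r u \<in> Dop_on C h i)}"

definition D_on :: "'b::comm_ring_1 set \<Rightarrow> ('k::field \<Rightarrow> 'b) \<Rightarrow> ('b \<Rightarrow> 'b) set" where
  "D_on C h = (\<Union>i. Dop_on C h i)"

abbreviation Dop :: "('k::field \<Rightarrow> 'a::comm_ring_1) \<Rightarrow> nat \<Rightarrow> ('a \<Rightarrow> 'a) set" where
  "Dop h i \<equiv> Dop_on UNIV h i"

abbreviation DA :: "('k::field \<Rightarrow> 'a::comm_ring_1) \<Rightarrow> ('a \<Rightarrow> 'a) set" where
  "DA h \<equiv> D_on UNIV h"

definition mult_op :: "'a::comm_ring_1 \<Rightarrow> 'a \<Rightarrow> 'a" where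
  "mult_op a = (\<lambda>y. a * y)"

definition subalg_containing_A :: "('k::field \<Rightarrow> 'a::comm_ring_1) \<Rightarrow> ('a \<Rightarrow> 'a) set \<Rightarrow> bool" where
  "subalg_containing_A h R \<longleftrightarrow> R \<subseteq> DA h \<and> (\<forall>a. mult_op a \<in> R) \<and>
     (\<forall>u\<in>R. \<forall>v\<in>R. (\<lambda>y. u y + v y) \<in> R \<and> u \<circ> v \<in> R)"

definition left_A_submodule :: "('a::comm_ring_1 \<Rightarrow> 'a) set \<Rightarrow> ('a \<Rightarrow> 'a) set \<Rightarrow> bool" where
  "left_A_submodule M N \<longleftrightarrow> N \<subseteq> M \<and> (\<lambda>_. 0) \<in> N \<and>
     (\<forall>u\<in>N. \<forall>v\<in>N. (\<lambda>y. u y + v y) \<in> N) \<and> (\<forall>a. \<forall>u\<in>N. mult_op a \<circ> u \<in> N)"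

definition essential_in :: "('a::comm_ring_1 \<Rightarrow> 'a) set \<Rightarrow> ('a \<Rightarrow> 'a) set \<Rightarrow> bool" where
  "essential_in M R \<longleftrightarrow> left_A_submodule M R \<and>
     (\<forall>N. left_A_submodule M N \<and> N \<noteq> {\<lambda>_. 0} \<longrightarrow> R \<inter> N \<noteq> {\<lambda>_. 0})"

definition op_ideal :: "('b::comm_ring_1 \<Rightarrow> 'b) set \<Rightarrow> ('b \<Rightarrow> 'b) set \<Rightarrow> bool" where
  "op_ideal R J \<longleftrightarrow> J \<subseteq> R \<and> (\<lambda>_. 0) \<in> J \<and> (\<forall>u\<in>J. \<forall>v\<in>J. (\<lambda>y. u y - v y) \<in> J) \<and>
     (\<forall>r\<in>R. \<forall>u\<in>J. r \<circ> u \<in> J \<and> u \<circ> r \<in> J)"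

definition simple_alg :: "('b::comm_ring_1 \<Rightarrow> 'b) set \<Rightarrow> bool" where
  "simple_alg R \<longleftrightarrow> (\<exists>u\<in>R. u \<noteq> (\<lambda>_. 0)) \<and> (\<forall>J. op_ideal R J \<longrightarrow> J = {\<lambda>_. 0} \<or> J = R)"

definition loc_ring :: "'a::idom set \<Rightarrow> 'a fract set" where
  "loc_ring M = {Fract a s | a s. s \<notin> M}"

text \<open>The Ore localization R_M = (A \ M)^{-1} R of a subalgebra R of D(A),
  realized as the algebra of operators s^{-1} u~ on A_M, where u~ is the
  (unique) extension of u in R to a differential operator on A_M.\<close>
definition loc_alg :: "('k::field \<Rightarrow> 'a::idom) \<Rightarrow> ('a \<Rightarrow> 'a) set \<Rightarrow> 'a set \<Rightarrow> ('a fract \<Rightarrow> 'a fract) set" where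
  "loc_alg h R M = {w. \<exists>s u ut. s \<notin> M \<and> u \<in> R \<and>
       ut \<in> D_on (loc_ring M) (\<lambda>c. Fract (h c) 1) \<and> (\<forall>a. ut (Fract a 1) = Fract (u a) 1) \<and>
       w = (\<lambda>y. if y \<in> loc_ring M then ut y / Fract s 1 else 0)}"

definition b_ideal :: "('k::field \<Rightarrow> 'a::comm_ring_1) \<Rightarrow> ('a \<Rightarrow> 'a) set \<Rightarrow> nat \<Rightarrow> 'a set" where
  "b_ideal h R i = {a. \<forall>u\<in>Dop h i. mult_op a \<circ> u \<in> R \<inter> Dop h i}"

definition c_ideal :: "('k::field \<Rightarrow> 'a::comm_ring_1) \<Rightarrow> ('a \<Rightarrow> 'a) set \<Rightarrow> nat \<Rightarrow> 'a set" where
  "c_ideal h R i = {a. \<forall>u\<in>Dop h i. u \<circ> mult_op a \<in> R \<inter> Dop h i}"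

end

theory Submission
  imports Defs "Jordan_Normal_Form.Determinant" "HOL-Computational_Algebra.Formal_Power_Series"
begin

text \<open>
  Commutators with functions lower the order of an operator, so every nonzero ideal of an algebra
  between \<open>A\<close> and \<open>D(A)\<close> contains a nonzero function. Hence \<open>R\<close> is simple iff at every maximal
  ideal \<open>M\<close> each nonzero ideal of \<open>R\<close> contains a function outside \<open>M\<close>, and by the Ore condition
  this local condition is the simplicity of \<open>R\<^sub>M\<close>. Where no \<open>b\<^sub>i\<close> (equivalently, no \<open>c\<^sub>i\<close>) lies in
  \<open>M\<close>, the localizations of \<open>R\<close> and \<open>D(A)\<close> agree.

  It remains to show that a nonzero ideal of \<open>D(A)\<close> contains a power of every nonzero minor \<open>\<Delta>\<close> of
  maximal size \<open>r\<close> of the Jacobi matrix. Let \<open>T\<close> be the set of variables outside the columns of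
  \<open>\<Delta>\<close>. Since \<open>r\<close> is the rank and \<open>K\<close> is perfect, these variables are algebraically independent in
  \<open>A\<close>, and \<open>A\<close> is algebraic over \<open>K[x\<^sub>T]\<close>; so the ideal contains a nonzero polynomial in \<open>x\<^sub>T\<close>. By
  a Hensel argument in Tougeron's form, for \<open>j \<in> T\<close> the substitution \<open>x\<^sub>j \<mapsto> x\<^sub>j + \<Delta>\<^sup>2 \<epsilon>\<close> extends to a
  homomorphism \<open>A \<rightarrow> A[[\<epsilon>]]\<close>; its coefficients are differential operators of \<open>A\<close> that work in every
  characteristic. They preserve the functions in the ideal and eliminate the variables one by one.
\<close>

section \<open>Evaluation and differentiation of polynomials\<close>

text \<open>Derivations alone cannot eliminate a variable in characteristic p, since they kill p-th
  powers. Operators of all orders are therefore produced together, as the coefficients of one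
  homomorphism into \<open>A[[\<epsilon>]]\<close>.

  The step is a multiple of \<Delta>^2 because \<Delta> need not be a unit. The Newton step uses the
  adjugate of the Jacobi block in place of its inverse, which costs one factor \<Delta>, and an
  increment divisible by \<Delta> has a second order Taylor remainder divisible by \<Delta>^2. Thus
  the coefficients act on A itself, not only on the localization at \<Delta>.

  Only the r equations of the chart can be solved in this way. The remaining relations are preserved
  for another reason: algebraicity over the variables in T holds over \<open>A[[\<epsilon>]]\<close>
  as well, where a relation with nonzero value would have a nonzero multiple in these variables
  alone, against their independence. For this second use algebraicity is proved over an arbitrary
  field, from the r equations only. Perfectness enters through independence: a relation whose
  derivatives all vanish has a p-th root that is again a relation.\<close>

abbreviation lkp where "lkp \<equiv> Poly_Mapping.lookup"
abbreviation sing where "sing \<equiv> Poly_Mapping.single"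
abbreviation kys where "kys \<equiv> Poly_Mapping.keys"

definition vars_in :: "nat set \<Rightarrow> 'k::zero mpoly \<Rightarrow> bool" where
  "vars_in V p \<longleftrightarrow> (\<forall>mn\<in>kys p. kys mn \<subseteq> V)"

lemma in_Pn_iff_vars_in: "in_Pn n p \<longleftrightarrow> vars_in {..<n} p"
  by (auto simp: in_Pn_def vars_in_def)

definition mvar :: "nat \<Rightarrow> 'k::{zero,one} mpoly" where
  "mvar i = sing (sing i 1) 1"

lemma poly_mapping_as_sum:
  fixes p :: "'m \<Rightarrow>\<^sub>0 'c::comm_monoid_add"
  shows "p = (\<Sum>k\<in>kys p. sing k (lkp p k))"
proof (rule poly_mapping_eqI)
  fix k
  have "lkp (\<Sum>k\<in>kys p. sing k (lkp p k)) k = (\<Sum>l\<in>kys p. if l = k then lkp p l else 0)"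
    by (auto simp: lookup_sum lookup_single when_def intro!: sum.cong)
  also have "\<dots> = lkp p k"
    by (simp add: in_keys_iff)
  finally show "lkp p k = lkp (\<Sum>k\<in>kys p. sing k (lkp p k)) k" ..
qed

text \<open>Keeping \<open>k \<in> kys p\<close> in the single case lets facts about the monomials
  of the whole polynomial be used there, as the next induction rule does with
  \<open>vars_in\<close>.\<close>

lemma single_induct [case_names zero single add]:
  fixes p :: "'m \<Rightarrow>\<^sub>0 'c::comm_monoid_add"
  assumes "P 0" "\<And>k c. k \<in> kys p \<Longrightarrow> P (sing k c)" "\<And>a b. P a \<Longrightarrow> P b \<Longrightarrow> P (a + b)"
  shows "P p"
proof -
  have "P (\<Sum>k\<in>A. sing k (lkp p k))" if "finite A" "A \<subseteq> kys p" for A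
    using that by (induction A) (auto intro: assms)
  from this[of "kys p"] show ?thesis
    by (simp flip: poly_mapping_as_sum)
qed

text \<open>With this rule identities for evaluation, difference quotients, contractions and Taylor
  expansions are checked on ring generators, without any sums over monomials.\<close>

lemma vars_in_induct [consumes 1, case_names const var add mult]:
  fixes p :: "'k::comm_ring_1 mpoly"
  assumes "vars_in V p"
    and "\<And>c. P (sing 0 c)"
    and "\<And>i. i \<in> V \<Longrightarrow> P (mvar i)"
    and "\<And>a b. P a \<Longrightarrow> P b \<Longrightarrow> P (a + b)"
    and "\<And>a b. P a \<Longrightarrow> P b \<Longrightarrow> P (a * b)"
  shows "P p"
proof (induction p rule: single_induct)
  case zero
  show ?case using assms(2)[of 0] by simp
next
  case (single mn c)
  have pow: "P (sing (sing i e) 1)" if "i \<in> V" for i e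
  proof (induction e)
    case 0
    show ?case using assms(2)[of 1] by simp
  next
    case (Suc e)
    have "sing (sing i (Suc e)) (1::'k) = sing (sing i e) 1 * mvar i"
      by (simp add: mvar_def mult_single single_add[symmetric])
    then show ?case using Suc assms(3)[OF that] assms(5) by metis
  qed
  have "P (sing mn 1)" if "kys mn \<subseteq> V" for mn
    using that
  proof (induction mn rule: single_induct)
    case zero
    show ?case using assms(2)[of 1] by simp
  next
    case (single i e)
    then show ?case using pow[of i e] assms(2)[of 1] by (cases "e = 0") auto
  next
    case (add a b)
    have "kys (a + b) = kys a \<union> kys b"
      by (auto simp: in_keys_iff lookup_add)
    then have "P (sing a 1 * sing b 1)"
      using add assms(5) by auto
    then show ?case by (simp add: mult_single)
  qed
  with single assms(1) have "P (sing mn 1)" by (auto simp: vars_in_def)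
  then have "P (sing 0 c * sing mn 1)" using assms(2,5) by blast
  then show ?case by (simp add: mult_single)
next
  case (add a b)
  then show ?case using assms(4) by blast
qed

lemma vars_in_add: "vars_in V p \<Longrightarrow> vars_in V q \<Longrightarrow> vars_in V (p + q)"
  using Poly_Mapping.keys_add[of p q] by (auto simp: vars_in_def)

lemma vars_in_0 [simp]: "vars_in V 0"
  by (simp add: vars_in_def)

lemma vars_in_const [simp]: "vars_in V (sing 0 c)"
  by (simp add: vars_in_def)

lemma vars_in_mvar: "i \<in> V \<Longrightarrow> vars_in V (mvar i)"
  by (auto simp: vars_in_def mvar_def)

lemma vars_in_mult:
  assumes "vars_in V p" "vars_in V q"
  shows "vars_in V (p * q)"
proof -
  have "kys mn \<subseteq> V" if "mn \<in> kys (p * q)" for mn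
  proof -
    obtain a b where "mn = a + b" "a \<in> kys p" "b \<in> kys q"
      using \<open>mn \<in> _\<close> keys_mult[of p q] by blast
    then show ?thesis
      using assms Poly_Mapping.keys_add[of a b] by (fastforce simp: vars_in_def)
  qed
  then show ?thesis by (auto simp: vars_in_def)
qed

lemma vars_in_uminus:
  fixes p :: "'k::ab_group_add mpoly"
  shows "vars_in V p \<Longrightarrow> vars_in V (- p)"
  by (auto simp: vars_in_def in_keys_iff)

lemma vars_in_diff:
  fixes p :: "'k::ab_group_add mpoly"
  shows "vars_in V p \<Longrightarrow> vars_in V q \<Longrightarrow> vars_in V (p - q)"
  using vars_in_add[of V p "- q"] vars_in_uminus[of V q] by simp

lemma vars_in_mono: "vars_in V p \<Longrightarrow> V \<subseteq> W \<Longrightarrow> vars_in W p"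
  by (auto simp: vars_in_def)

lemma kalg_simps:
  assumes "kalg h"
  shows "h 1 = 1" "h (a + b) = h a + h b" "h (a * b) = h a * h b" "h 0 = 0" "h (- a) = - h a"
    "h (a - b) = h a - h b"
proof -
  show *: "h 1 = 1" "h (a + b) = h a + h b" "h (a * b) = h a * h b" for a b
    using assms by (auto simp: kalg_def)
  show 0: "h 0 = 0" using *(2)[of 0 0] by simp
  show 1: "h (- a) = - h a" for a using *(2)[of a "- a"] 0 by (simp add: eq_neg_iff_add_eq_0 add.commute)
  show "h (a - b) = h a - h b" using *(2)[of a "- b"] 1 by simp
qed

lemma kalg_of_nat: "kalg h \<Longrightarrow> h (of_nat n) = of_nat n"
  by (induction n) (auto simp: kalg_simps)

lemma kalg_power: "kalg h \<Longrightarrow> h (a ^ n) = h a ^ n"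
  by (induction n) (auto simp: kalg_simps)

lemma kalg_eq_0_iff: "kalg h \<Longrightarrow> h a = 0 \<longleftrightarrow> a = 0"
proof
  assume h: "kalg h" "h a = 0"
  show "a = 0"
  proof (rule ccontr)
    assume "a \<noteq> 0"
    then have "h 1 = h a * h (inverse a)" using kalg_simps(3)[OF h(1), of a "inverse a"] by simp
    then show False using h kalg_simps[OF h(1)] by simp
  qed
qed (simp add: kalg_simps)

definition mon_eval :: "(nat \<Rightarrow> 'b::comm_ring_1) \<Rightarrow> (nat \<Rightarrow>\<^sub>0 nat) \<Rightarrow> 'b" where
  "mon_eval x mn = (\<Prod>i\<in>kys mn. x i ^ lkp mn i)"

lemma mon_eval_superset:
  "finite S \<Longrightarrow> kys mn \<subseteq> S \<Longrightarrow> mon_eval x mn = (\<Prod>i\<in>S. x i ^ lkp mn i)"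
  unfolding mon_eval_def by (rule prod.mono_neutral_left) (auto simp: in_keys_iff)

lemma mon_eval_add: "mon_eval x (a + b) = mon_eval x a * mon_eval x b"
proof -
  let ?S = "kys a \<union> kys b"
  have "mon_eval x (a + b) = (\<Prod>i\<in>?S. x i ^ lkp (a + b) i)"
    by (rule mon_eval_superset) (auto simp: in_keys_iff lookup_add)
  also have "\<dots> = (\<Prod>i\<in>?S. x i ^ lkp a i) * (\<Prod>i\<in>?S. x i ^ lkp b i)"
    by (simp add: lookup_add power_add prod.distrib)
  also have "\<dots> = mon_eval x a * mon_eval x b"
    by (simp add: mon_eval_superset[of ?S])
  finally show ?thesis .
qed

lemma mon_eval_0 [simp]: "mon_eval x 0 = 1"
  by (simp add: mon_eval_def)

lemma mon_eval_single [simp]: "mon_eval x (sing i (Suc 0)) = x i"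
  by (simp add: mon_eval_def)

lemma mpeval_mon_eval: "mpeval h x p = (\<Sum>mn\<in>kys p. h (lkp p mn) * mon_eval x mn)"
  by (simp add: mpeval_def mon_eval_def)

lemma mpeval_superset:
  "kalg h \<Longrightarrow> finite S \<Longrightarrow> kys p \<subseteq> S \<Longrightarrow> mpeval h x p = (\<Sum>mn\<in>S. h (lkp p mn) * mon_eval x mn)"
  unfolding mpeval_mon_eval by (rule sum.mono_neutral_left) (auto simp: in_keys_iff kalg_simps)

lemma mpeval_single: "kalg h \<Longrightarrow> mpeval h x (sing mn c) = h c * mon_eval x mn"
  by (cases "c = 0") (auto simp: mpeval_mon_eval kalg_simps)

lemma mpeval_0 [simp]: "mpeval h x 0 = 0"
  by (simp add: mpeval_def)

lemma mpeval_add: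
  assumes "kalg h"
  shows "mpeval h x (p + q) = mpeval h x p + mpeval h x q"
proof -
  let ?S = "kys p \<union> kys q"
  have "mpeval h x (p + q) = (\<Sum>mn\<in>?S. h (lkp (p + q) mn) * mon_eval x mn)"
    by (rule mpeval_superset[OF assms]) (use Poly_Mapping.keys_add[of p q] in auto)
  also have "\<dots> = (\<Sum>mn\<in>?S. h (lkp p mn) * mon_eval x mn) + (\<Sum>mn\<in>?S. h (lkp q mn) * mon_eval x mn)"
    by (simp add: lookup_add kalg_simps[OF assms] algebra_simps sum.distrib)
  finally show ?thesis
    by (simp add: mpeval_superset[OF assms, of ?S])
qed

lemma mpeval_mult:
  assumes "kalg h"
  shows "mpeval h x (p * q) = mpeval h x p * mpeval h x q"
proof (induction p rule: single_induct)
  case (single k c)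
  show ?case
  proof (induction q rule: single_induct)
    case (single l d)
    then show ?case
      by (simp add: mult_single mpeval_single[OF assms] mon_eval_add kalg_simps[OF assms] algebra_simps)
  qed (auto simp: algebra_simps mpeval_add[OF assms])
qed (auto simp: algebra_simps mpeval_add[OF assms])

lemma mpeval_const: "kalg h \<Longrightarrow> mpeval h x (sing 0 c) = h c"
  by (simp add: mpeval_single)

lemma mpeval_1: "kalg h \<Longrightarrow> mpeval h x 1 = 1"
  using mpeval_const[of h x 1] by (simp add: kalg_simps)

lemma mpeval_mvar: "kalg h \<Longrightarrow> mpeval h x (mvar i) = x i"
  by (simp add: mvar_def mpeval_single kalg_simps)

lemma mpeval_uminus: "kalg h \<Longrightarrow> mpeval h x (- p) = - mpeval h x p"
  using mpeval_add[of h x p "- p"] by (simp add: eq_neg_iff_add_eq_0 add.commute)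

lemma mpeval_diff: "kalg h \<Longrightarrow> mpeval h x (p - q) = mpeval h x p - mpeval h x q"
  using mpeval_add[of h x p "- q"] by (simp add: mpeval_uminus)

lemma mpeval_sum: "kalg h \<Longrightarrow> mpeval h x (\<Sum>i\<in>S. p i) = (\<Sum>i\<in>S. mpeval h x (p i))"
  by (induction S rule: infinite_finite_induct) (auto simp: mpeval_add)

lemmas mpeval_simps = mpeval_add mpeval_mult mpeval_const mpeval_1 mpeval_mvar mpeval_uminus
  mpeval_diff mpeval_sum

lemma mpeval_cong:
  assumes "kalg h" "vars_in V p" "\<And>i. i \<in> V \<Longrightarrow> x i = y i"
  shows "mpeval h x p = mpeval h y p"
  using assms(2) by (induction p rule: vars_in_induct) (auto simp: mpeval_simps[OF assms(1)] assms(3))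

text \<open>Serves to pass to the fraction field, to take constant coefficients of power series, and
  to compute a higher derivation on polynomial values.\<close>

lemma mpeval_hom:
  assumes "kalg h" "kalg h'" "\<And>a b. g (a + b) = g a + g b" "\<And>a b. g (a * b) = g a * g b"
    "\<And>c. g (h c) = h' c"
  shows "g (mpeval h x p) = mpeval h' (\<lambda>i. g (x i)) p"
proof -
  have "vars_in UNIV p" by (simp add: vars_in_def)
  then show ?thesis
    by (induction p rule: vars_in_induct)
      (simp_all add: mpeval_simps[OF assms(1)] mpeval_simps[OF assms(2)] assms)
qed

lemma mpderiv_superset:
  "finite S \<Longrightarrow> kys p \<subseteq> S \<Longrightarrow>
    mpderiv j p = (\<Sum>mn\<in>S. sing (mn - sing j 1) (of_nat (lkp mn j) * lkp p mn))"
  unfolding mpderiv_def by (rule sum.mono_neutral_left) (auto simp: in_keys_iff)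

lemma mpderiv_add: "mpderiv j (p + q) = mpderiv j p + mpderiv j q"
proof -
  let ?S = "kys p \<union> kys q"
  have "mpderiv j (p + q) = (\<Sum>mn\<in>?S. sing (mn - sing j 1) (of_nat (lkp mn j) * lkp (p + q) mn))"
    by (rule mpderiv_superset) (use Poly_Mapping.keys_add[of p q] in auto)
  then show ?thesis
    by (simp add: mpderiv_superset[of ?S] lookup_add algebra_simps sum.distrib single_add)
qed

lemma mpderiv_0 [simp]: "mpderiv j 0 = 0"
  by (simp add: mpderiv_def)

lemma mpderiv_single: "mpderiv j (sing mn c) = sing (mn - sing j 1) (of_nat (lkp mn j) * c)"
  by (cases "c = 0") (auto simp: mpderiv_def)

lemma mpderiv_mult: "mpderiv j (p * q) = mpderiv j p * q + p * mpderiv j q"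
proof (induction p rule: single_induct)
  case (single a c)
  show ?case
  proof (induction q rule: single_induct)
    case (single b d)
    \<comment> \<open>Subtraction of exponents truncates at 0. The two identities can fail only
      where the exponent of the variable \<open>j\<close> is 0, and there the coefficient of the
      derivative vanishes.\<close>
    have *: "a + b - sing j 1 = a - sing j 1 + b" if "lkp a j \<noteq> 0"
      by (rule poly_mapping_eqI) (use that in \<open>auto simp: lookup_add lookup_minus lookup_single when_def\<close>)
    have **: "a + b - sing j 1 = a + (b - sing j 1)" if "lkp b j \<noteq> 0"
      by (rule poly_mapping_eqI) (use that in \<open>auto simp: lookup_add lookup_minus lookup_single when_def\<close>)
    show ?case
      by (cases "lkp a j = 0"; cases "lkp b j = 0")
        (use * ** in \<open>auto simp: mpderiv_single mult_single lookup_add single_add[symmetric] algebra_simps\<close>)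
  qed (auto simp: algebra_simps mpderiv_add)
qed (auto simp: algebra_simps mpderiv_add)

lemma mpderiv_const [simp]: "mpderiv j (sing 0 c) = 0"
  by (simp add: mpderiv_single)

lemma mpderiv_mvar: "mpderiv j (mvar i) = (if i = j then 1 else 0)"
  by (auto simp: mvar_def mpderiv_single lookup_single when_def)

lemma vars_in_mpderiv:
  assumes "vars_in V p" shows "vars_in V (mpderiv j p)"
proof -
  have "vars_in V p \<and> vars_in V (mpderiv j p)"
    using assms
  proof (induction p rule: vars_in_induct)
    case (var i)
    have "vars_in V (1::'a mpoly)" by (simp add: vars_in_def)
    with var show ?case by (auto simp: mpderiv_mvar vars_in_mvar)
  qed (auto simp: mpderiv_add mpderiv_mult vars_in_add vars_in_mult)
  then show ?thesis by blast
qed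

lemma mpderiv_eq_0_of_vars_in:
  assumes "vars_in V p" "j \<notin> V" shows "mpderiv j p = 0"
  using assms(1) by (induction p rule: vars_in_induct)
    (use assms(2) in \<open>auto simp: mpderiv_mvar mpderiv_add mpderiv_mult\<close>)


section \<open>Determinants of doubly indexed families\<close>

definition ndet :: "nat \<Rightarrow> (nat \<Rightarrow> nat \<Rightarrow> 'a::comm_ring_1) \<Rightarrow> 'a" where
  "ndet r A = det (mat r r (\<lambda>(i, j). A i j))"

lemma minor_eq_ndet: "minor M k ri ci = ndet k (\<lambda>i j. M (ri i) (ci j))"
proof -
  have "ndet k (\<lambda>i j. M (ri i) (ci j)) = (\<Sum>p\<in>{p. p permutes {0..<k}}.
     signof p * (\<Prod>i = 0..<k. mat k k (\<lambda>(i, j). M (ri i) (ci j)) $$ (i, p i)))"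
    unfolding ndet_def by (rule det_def'[of _ k]) auto
  also have "\<dots> = (\<Sum>p\<in>{p. p permutes {0..<k}}. signof p * (\<Prod>l = 0..<k. M (ri l) (ci (p l))))"
    by (intro sum.cong refl arg_cong2[where f = "(*)"] prod.cong) (auto dest: permutes_in_image)
  finally show ?thesis
    by (simp add: minor_def atLeast0LessThan)
qed

text \<open>Replaces the inverse matrix in places where the determinant is not a unit: for matrices
  of difference quotients and for the Newton step over A.\<close>

lemma adjugate_exists:
  fixes A :: "nat \<Rightarrow> nat \<Rightarrow> 'a::comm_ring_1"
  obtains B where
    "\<And>i j. i < r \<Longrightarrow> j < r \<Longrightarrow> (\<Sum>k<r. A i k * B k j) = (if i = j then ndet r A else 0)"
    "\<And>i j. i < r \<Longrightarrow> j < r \<Longrightarrow> (\<Sum>k<r. B i k * A k j) = (if i = j then ndet r A else 0)"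
proof -
  let ?A = "mat r r (\<lambda>(i, j). A i j)"
  have A: "?A \<in> carrier_mat r r" by simp
  note adj = adj_mat[OF A]
  have 1: "(\<Sum>k<r. A i k * (adj_mat ?A $$ (k, j))) = (if i = j then ndet r A else 0)" if "i < r" "j < r" for i j
  proof -
    have "(\<Sum>k<r. A i k * (adj_mat ?A $$ (k, j))) = (?A * adj_mat ?A) $$ (i, j)"
      using that adj(1) by (auto simp: scalar_prod_def atLeast0LessThan intro!: sum.cong)
    then show ?thesis using that by (simp add: adj(2) ndet_def)
  qed
  have 2: "(\<Sum>k<r. (adj_mat ?A $$ (i, k)) * A k j) = (if i = j then ndet r A else 0)" if "i < r" "j < r" for i j
  proof -
    have "(\<Sum>k<r. (adj_mat ?A $$ (i, k)) * A k j) = (adj_mat ?A * ?A) $$ (i, j)"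
      using that adj(1) by (auto simp: scalar_prod_def atLeast0LessThan intro!: sum.cong)
    then show ?thesis using that by (simp add: adj(3) ndet_def)
  qed
  from 1 2 show thesis by (rule that)
qed

lemma ndet_hom:
  fixes g :: "'a::comm_ring_1 \<Rightarrow> 'b::comm_ring_1"
  assumes "g 1 = 1" "\<And>a b. g (a + b) = g a + g b" "\<And>a b. g (a * b) = g a * g b"
  shows "g (ndet r A) = ndet r (\<lambda>i j. g (A i j))"
proof -
  have "g 0 = 0" using assms(2)[of 0 0] by simp
  then interpret comm_ring_hom g by unfold_locales (simp_all add: assms)
  have "g (ndet r A) = det (map_mat g (mat r r (\<lambda>(i, j). A i j)))"
    by (simp add: ndet_def)
  also have "map_mat g (mat r r (\<lambda>(i, j). A i j)) = mat r r (\<lambda>(i, j). g (A i j))"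
    by (rule eq_matI) auto
  finally show ?thesis by (simp add: ndet_def)
qed

section \<open>Linear algebra over a subfield\<close>

text \<open>One application of Zorn's lemma for two purposes: subspaces avoiding a vector, which
  give functionals, and ideals avoiding 1, which give maximal ideals.\<close>

lemma maximal_set_avoiding:
  assumes "P S" "b \<notin> S"
    and union: "\<And>\<C>. \<C> \<noteq> {} \<Longrightarrow> (\<And>U. U \<in> \<C> \<Longrightarrow> P U) \<Longrightarrow>
      (\<And>U V. U \<in> \<C> \<Longrightarrow> V \<in> \<C> \<Longrightarrow> U \<subseteq> V \<or> V \<subseteq> U) \<Longrightarrow> P (\<Union>\<C>)"
  obtains M where "P M" "S \<subseteq> M" "b \<notin> M" "\<And>U. P U \<Longrightarrow> M \<subseteq> U \<Longrightarrow> b \<notin> U \<Longrightarrow> U = M"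
proof -
  define \<A> where "\<A> = {U. P U \<and> S \<subseteq> U \<and> b \<notin> U}"
  have "\<exists>M\<in>\<A>. \<forall>X\<in>\<A>. M \<subseteq> X \<longrightarrow> X = M"
  proof (rule subset_Zorn_nonempty)
    show "\<A> \<noteq> {}" using assms(1,2) by (auto simp: \<A>_def)
    fix \<C> assume \<C>: "\<C> \<noteq> {}" "subset.chain \<A> \<C>"
    have sub: "P U" "S \<subseteq> U" "b \<notin> U" if "U \<in> \<C>" for U
      using \<C>(2) that by (auto simp: subset_chain_def \<A>_def)
    have "P (\<Union>\<C>)"
      using \<C> sub(1) by (intro union) (auto simp: subset_chain_def)
    moreover have "S \<subseteq> \<Union>\<C>" using \<C>(1) sub(2) by blast
    moreover have "b \<notin> \<Union>\<C>" using sub(3) by blast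
    ultimately show "\<Union>\<C> \<in> \<A>" by (auto simp: \<A>_def)
  qed
  then obtain M where M: "M \<in> \<A>" "\<And>X. X \<in> \<A> \<Longrightarrow> M \<subseteq> X \<Longrightarrow> X = M" by blast
  then have "P M" "S \<subseteq> M" "b \<notin> M" by (auto simp: \<A>_def)
  moreover from this M(2) have "U = M" if "P U" "M \<subseteq> U" "b \<notin> U" for U
    using that by (auto simp: \<A>_def)
  ultimately show thesis using that by blast
qed

text \<open>The subfield is a set because the one needed, the fractions of polynomials in chosen
  coordinates, depends on the data of a proof. Vector spaces over it are subsets of the large
  field.\<close>

locale subfield_set =
  fixes F :: "'q::field set"
  assumes one: "1 \<in> F" and add: "\<And>a b. a \<in> F \<Longrightarrow> b \<in> F \<Longrightarrow> a + b \<in> F"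
    and mult: "\<And>a b. a \<in> F \<Longrightarrow> b \<in> F \<Longrightarrow> a * b \<in> F"
    and uminus: "\<And>a. a \<in> F \<Longrightarrow> - a \<in> F" and inverse: "\<And>a. a \<in> F \<Longrightarrow> inverse a \<in> F"
begin

lemma zero: "0 \<in> F"
  using add[OF one uminus[OF one]] by simp

lemma diff: "a \<in> F \<Longrightarrow> b \<in> F \<Longrightarrow> a - b \<in> F"
  using add[of a "- b"] uminus[of b] by simp

lemma divide: "a \<in> F \<Longrightarrow> b \<in> F \<Longrightarrow> a / b \<in> F"
  using mult[of a "inverse b"] inverse[of b] by (simp add: divide_inverse)

lemma sum: "(\<And>i. i \<in> S \<Longrightarrow> g i \<in> F) \<Longrightarrow> sum g S \<in> F"
  by (induction S rule: infinite_finite_induct) (auto simp: zero add)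

definition subspace_set :: "'q set \<Rightarrow> bool" where
  "subspace_set W \<longleftrightarrow> 0 \<in> W \<and> (\<forall>v\<in>W. \<forall>w\<in>W. v + w \<in> W) \<and> (\<forall>c\<in>F. \<forall>v\<in>W. c * v \<in> W)"

definition functional :: "('q \<Rightarrow> 'q) \<Rightarrow> bool" where
  "functional \<phi> \<longleftrightarrow> (\<forall>v w. \<phi> (v + w) = \<phi> v + \<phi> w) \<and> (\<forall>c\<in>F. \<forall>v. \<phi> (c * v) = c * \<phi> v) \<and> (\<forall>v. \<phi> v \<in> F)"

lemma functional_sum:
  assumes "functional \<phi>" "\<And>i. i \<in> S \<Longrightarrow> c i \<in> F"
  shows "\<phi> (\<Sum>i\<in>S. c i * v i) = (\<Sum>i\<in>S. c i * \<phi> (v i))"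
  using assms(2)
proof (induction S rule: infinite_finite_induct)
  case (infinite A)
  have "\<phi> (0 * 0) = 0 * \<phi> 0" using assms(1) zero unfolding functional_def by blast
  then show ?case using infinite by simp
next
  case empty
  have "\<phi> (0 * 0) = 0 * \<phi> 0" using assms(1) zero unfolding functional_def by blast
  then show ?case by simp
next
  case (insert x F)
  then show ?case using assms(1) by (auto simp: functional_def)
qed

text \<open>A subspace \<open>M\<close> that contains \<open>W\<close> and is maximal among those
  avoiding \<open>b\<close> is a complement of the line through \<open>b\<close>; the functional is
  the coordinate along \<open>b\<close>.\<close>

lemma functional_exists:
  assumes W: "subspace_set W" and b: "b \<notin> W"
  obtains \<phi> where "functional \<phi>" "\<phi> b = 1" "\<And>w. w \<in> W \<Longrightarrow> \<phi> w = 0"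
proof -
  obtain M where M: "subspace_set M" "W \<subseteq> M" "b \<notin> M"
    and max: "\<And>U. subspace_set U \<Longrightarrow> M \<subseteq> U \<Longrightarrow> b \<notin> U \<Longrightarrow> U = M"
  proof (rule maximal_set_avoiding[of subspace_set, OF W b])
    fix \<C> assume \<C>: "\<C> \<noteq> {}" "\<And>U. U \<in> \<C> \<Longrightarrow> subspace_set U"
      "\<And>U V. U \<in> \<C> \<Longrightarrow> V \<in> \<C> \<Longrightarrow> U \<subseteq> V \<or> V \<subseteq> U"
    show "subspace_set (\<Union>\<C>)"
      unfolding subspace_set_def
    proof (intro conjI ballI)
      show "0 \<in> \<Union>\<C>" using \<C>(1,2) by (fastforce simp: subspace_set_def)
      fix v w assume "v \<in> \<Union>\<C>" "w \<in> \<Union>\<C>"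
      then obtain U U' where U: "v \<in> U" "w \<in> U'" "U \<in> \<C>" "U' \<in> \<C>" by blast
      then have "v + w \<in> U \<or> v + w \<in> U'"
        using \<C>(2,3) by (metis subspace_set_def subsetD)
      then show "v + w \<in> \<Union>\<C>" using U by blast
    next
      fix c v assume "c \<in> F" "v \<in> \<Union>\<C>"
      then show "c * v \<in> \<Union>\<C>" using \<C>(2) by (fastforce simp: subspace_set_def)
    qed
  qed blast
  have M': "0 \<in> M" "\<And>v w. v \<in> M \<Longrightarrow> w \<in> M \<Longrightarrow> v + w \<in> M" "\<And>c v. c \<in> F \<Longrightarrow> v \<in> M \<Longrightarrow> c * v \<in> M"
    using M(1) by (auto simp: subspace_set_def)
  have M_uminus: "- v \<in> M" if "v \<in> M" for v
    using M'(3)[OF uminus[OF one] that] by simp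
  have M_diff: "v - w \<in> M" if "v \<in> M" "w \<in> M" for v w
    using M'(2)[OF that(1) M_uminus[OF that(2)]] by simp
  \<comment> \<open>For \<open>v\<close> outside \<open>M\<close>, maximality puts \<open>b\<close>
    into the sum of \<open>M\<close> and the line through \<open>v\<close>; the resulting equation
    is solved for \<open>v\<close>.\<close>
  have ex: "\<exists>c\<in>F. v - c * b \<in> M" for v
  proof (cases "v \<in> M")
    case True
    then show ?thesis using zero by (intro bexI[of _ 0]) auto
  next
    case False
    let ?U = "{m + c * v | m c. m \<in> M \<and> c \<in> F}"
    have "subspace_set ?U"
      unfolding subspace_set_def
    proof (intro conjI ballI)
      show "0 \<in> ?U" using M'(1) zero by force
    next
      fix x y assume "x \<in> ?U" "y \<in> ?U"
      then obtain m c m' c' where "x = m + c * v" "y = m' + c' * v" "m \<in> M" "m' \<in> M" "c \<in> F" "c' \<in> F"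
        by blast
      then have "x + y = (m + m') + (c + c') * v" "m + m' \<in> M" "c + c' \<in> F"
        using M'(2) add by (auto simp: algebra_simps)
      then show "x + y \<in> ?U" by blast
    next
      fix d x assume "d \<in> F" "x \<in> ?U"
      then obtain m c where "x = m + c * v" "m \<in> M" "c \<in> F" by blast
      then have "d * x = d * m + (d * c) * v" "d * m \<in> M" "d * c \<in> F"
        using M'(3) mult \<open>d \<in> F\<close> by (auto simp: algebra_simps)
      then show "d * x \<in> ?U" by blast
    qed
    moreover have "M \<subseteq> ?U" using zero by force
    moreover have "v \<in> ?U" using M'(1) one by force
    ultimately have "b \<in> ?U" using max False by blast
    then obtain m c where mc: "b = m + c * v" "m \<in> M" "c \<in> F" by blast
    have "c \<noteq> 0" using mc M(3) by auto
    then have "v - inverse c * b = - (inverse c * m)"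
      using mc(1) by (simp add: field_simps)
    then show ?thesis using mc M'(3) M_uminus inverse by metis
  qed
  have uniq: "c = c'" if "c \<in> F" "c' \<in> F" "v - c * b \<in> M" "v - c' * b \<in> M" for c c' v
  proof (rule ccontr)
    assume "c \<noteq> c'"
    have "(c' - c) * b \<in> M"
      using M_diff[OF that(3,4)] by (simp add: algebra_simps)
    then have "inverse (c' - c) * ((c' - c) * b) \<in> M"
      using M'(3) inverse diff that by blast
    then show False using \<open>c \<noteq> c'\<close> M(3) by (simp add: mult.assoc[symmetric])
  qed
  define \<phi> where "\<phi> v = (SOME c. c \<in> F \<and> v - c * b \<in> M)" for v
  have \<phi>: "\<phi> v \<in> F" "v - \<phi> v * b \<in> M" for v
    using someI_ex[of "\<lambda>c. c \<in> F \<and> v - c * b \<in> M"] ex[of v] by (auto simp: \<phi>_def)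
  have \<phi>_eq: "\<phi> v = c" if "c \<in> F" "v - c * b \<in> M" for v c
    using uniq \<phi> that by blast
  show thesis
  proof
    show "\<phi> b = 1" using M'(1) one by (intro \<phi>_eq) auto
    show "\<phi> w = 0" if "w \<in> W" for w using that M(2) zero by (intro \<phi>_eq) auto
    show "functional \<phi>"
      unfolding functional_def
    proof (intro conjI allI ballI)
      fix v w
      show "\<phi> (v + w) = \<phi> v + \<phi> w"
        using M'(2)[OF \<phi>(2)[of v] \<phi>(2)[of w]] \<phi>(1) add by (intro \<phi>_eq) (auto simp: algebra_simps)
    next
      fix c v assume "c \<in> F"
      then show "\<phi> (c * v) = c * \<phi> v"
        using M'(3)[OF _ \<phi>(2)[of v], of c] \<phi>(1) mult by (intro \<phi>_eq) (auto simp: algebra_simps)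
    qed (rule \<phi>)
  qed
qed

text \<open>The sum of the \<open>a k\<close> tensor \<open>d k\<close> over \<open>F\<close> has
  nonzero image under multiplication, so it is nonzero and some functional on the second factor
  detects it. Without tensors: if \<open>d k\<close> depends on the other vectors, its coefficient
  is distributed among them; otherwise, when \<open>a k\<close> is nonzero, a functional that is 1
  at \<open>d k\<close> and 0 at the others does it.\<close>

lemma functional_nonvanishing:
  assumes "finite S" "(\<Sum>k\<in>S. a k * d k) \<noteq> 0"
  obtains \<phi> where "functional \<phi>" "(\<Sum>k\<in>S. a k * \<phi> (d k)) \<noteq> 0"
proof -
  have "\<exists>\<phi>. functional \<phi> \<and> (\<Sum>k\<in>S. a k * \<phi> (d k)) \<noteq> 0"
    using assms
  proof (induction S arbitrary: a)
    case (insert k S)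
    let ?W = "{\<Sum>i\<in>S. c i * d i | c. \<forall>i\<in>S. c i \<in> F}"
    have W: "subspace_set ?W"
      unfolding subspace_set_def
    proof (intro conjI ballI)
      show "0 \<in> ?W" using zero by (auto intro!: exI[of _ "\<lambda>_. 0"])
    next
      fix v w assume "v \<in> ?W" "w \<in> ?W"
      then obtain c c' where "v = (\<Sum>i\<in>S. c i * d i)" "w = (\<Sum>i\<in>S. c' i * d i)"
        "\<forall>i\<in>S. c i \<in> F" "\<forall>i\<in>S. c' i \<in> F" by blast
      then show "v + w \<in> ?W"
        using add by (auto intro!: exI[of _ "\<lambda>i. c i + c' i"] simp: algebra_simps sum.distrib)
    next
      fix e v assume "e \<in> F" "v \<in> ?W"
      then obtain c where "v = (\<Sum>i\<in>S. c i * d i)" "\<forall>i\<in>S. c i \<in> F" by blast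
      then show "e * v \<in> ?W"
        using mult \<open>e \<in> F\<close> by (auto intro!: exI[of _ "\<lambda>i. e * c i"] simp: algebra_simps sum_distrib_left)
    qed
    show ?case
    proof (cases "d k \<in> ?W")
      case True
      then obtain c where c: "d k = (\<Sum>i\<in>S. c i * d i)" "\<forall>i\<in>S. c i \<in> F" by blast
      have eq: "(\<Sum>i\<in>S. (a i + a k * c i) * e i) = (\<Sum>i\<in>S. a i * e i) + a k * (\<Sum>i\<in>S. c i * e i)" for e
        by (simp add: algebra_simps sum.distrib sum_distrib_left)
      have "(\<Sum>i\<in>S. (a i + a k * c i) * d i) \<noteq> 0"
        using insert c(1) unfolding eq by (simp add: add.commute)
      then obtain \<phi> where \<phi>: "functional \<phi>" "(\<Sum>i\<in>S. (a i + a k * c i) * \<phi> (d i)) \<noteq> 0"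
        using insert.IH[of "\<lambda>i. a i + a k * c i"] by blast
      have "\<phi> (d k) = (\<Sum>i\<in>S. c i * \<phi> (d i))"
        unfolding c(1) using c(2) by (intro functional_sum \<phi>(1)) auto
      then show ?thesis
        using \<phi> insert unfolding eq by (auto intro!: exI[of _ \<phi>] simp: add.commute)
    next
      case False
      show ?thesis
      proof (cases "a k = 0")
        case True
        then show ?thesis using insert by simp
      next
        case False
        obtain \<phi> where \<phi>: "functional \<phi>" "\<phi> (d k) = 1" "\<And>w. w \<in> ?W \<Longrightarrow> \<phi> w = 0"
          using functional_exists[OF W \<open>d k \<notin> ?W\<close>] by blast
        have "\<phi> (d i) = 0" if "i \<in> S" for i
        proof (rule \<phi>(3))
          have "d i = (\<Sum>j\<in>S. (if j = i then 1 else 0) * d j)"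
          proof -
            have "(\<Sum>j\<in>S. (if j = i then 1 else 0) * d j) = (\<Sum>j\<in>S. if j = i then d j else 0)"
              by (intro sum.cong) auto
            then show ?thesis using that insert by simp
          qed
          then show "d i \<in> ?W" using zero one by (force intro!: exI[of _ "\<lambda>j. if j = i then 1 else 0"])
        qed
        then show ?thesis using \<phi> False insert by (auto intro!: exI[of _ \<phi>])
      qed
    qed
  qed simp
  then show thesis using that by blast
qed

lemma dependency:
  assumes "finite J" "finite I" "card J < card I" "\<And>i j. i \<in> I \<Longrightarrow> j \<in> J \<Longrightarrow> c i j \<in> F"
  obtains \<gamma> where "\<And>i. i \<in> I \<Longrightarrow> \<gamma> i \<in> F" "\<exists>i\<in>I. \<gamma> i \<noteq> 0" "\<And>j. j \<in> J \<Longrightarrow> (\<Sum>i\<in>I. \<gamma> i * c i j) = 0"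
proof -
  have "\<exists>\<gamma>. (\<forall>i\<in>I. \<gamma> i \<in> F) \<and> (\<exists>i\<in>I. \<gamma> i \<noteq> 0) \<and> (\<forall>j\<in>J. (\<Sum>i\<in>I. \<gamma> i * c i j) = 0)"
    using assms
  proof (induction J arbitrary: I c)
    case empty
    then show ?case using one by (auto intro!: exI[of _ "\<lambda>_. 1"] simp: card_gt_0_iff)
  next
    case (insert j J)
    show ?case
    proof (cases "\<forall>i\<in>I. c i j = 0")
      case True
      have "\<exists>\<gamma>. (\<forall>i\<in>I. \<gamma> i \<in> F) \<and> (\<exists>i\<in>I. \<gamma> i \<noteq> 0) \<and> (\<forall>j\<in>J. (\<Sum>i\<in>I. \<gamma> i * c i j) = 0)"
        using insert by (intro insert.IH) auto
      then show ?thesis using True by auto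
    next
      case False
      then obtain i0 where i0: "i0 \<in> I" "c i0 j \<noteq> 0" by blast
      let ?I = "I - {i0}"
      have "\<exists>\<gamma>. (\<forall>i\<in>?I. \<gamma> i \<in> F) \<and> (\<exists>i\<in>?I. \<gamma> i \<noteq> 0) \<and>
          (\<forall>l\<in>J. (\<Sum>i\<in>?I. \<gamma> i * (c i l - c i j / c i0 j * c i0 l)) = 0)"
      proof (rule insert.IH)
        show "card J < card ?I" using insert i0 by simp
      qed (use insert i0 in \<open>auto intro!: diff mult divide\<close>)
      then obtain \<gamma> where \<gamma>: "\<forall>i\<in>?I. \<gamma> i \<in> F" "\<exists>i\<in>?I. \<gamma> i \<noteq> 0"
        "\<forall>l\<in>J. (\<Sum>i\<in>?I. \<gamma> i * (c i l - c i j / c i0 j * c i0 l)) = 0" by blast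
      \<comment> \<open>The coefficient of the pivot row \<open>i0\<close>, chosen so that column
        \<open>j\<close> cancels; on the other columns it produces exactly the eliminated matrix of
        the induction hypothesis.\<close>
      define e where "e = - (\<Sum>i\<in>?I. \<gamma> i * (c i j / c i0 j))"
      define \<gamma>' where "\<gamma>' = \<gamma>(i0 := e)"
      have e: "e \<in> F"
        unfolding e_def using \<gamma>(1) insert.prems(3) i0 by (intro uminus sum mult divide) auto
      have split: "(\<Sum>i\<in>I. \<gamma>' i * c i l) = (\<Sum>i\<in>?I. \<gamma> i * (c i l - c i j / c i0 j * c i0 l))" for l
      proof -
        have "(\<Sum>i\<in>I. \<gamma>' i * c i l) = e * c i0 l + (\<Sum>i\<in>?I. \<gamma> i * c i l)"
          using insert.prems(1) i0(1) by (simp add: \<gamma>'_def sum.remove)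
        also have "\<dots> = (\<Sum>i\<in>?I. \<gamma> i * (c i l - c i j / c i0 j * c i0 l))"
          by (simp add: e_def algebra_simps sum_subtractf sum_distrib_left sum_distrib_right)
        finally show ?thesis .
      qed
      have "\<forall>l\<in>insert j J. (\<Sum>i\<in>I. \<gamma>' i * c i l) = 0"
        unfolding split using \<gamma>(3) i0(2) by auto
      moreover have "\<forall>i\<in>I. \<gamma>' i \<in> F" "\<exists>i\<in>I. \<gamma>' i \<noteq> 0"
        using \<gamma>(1,2) e by (auto simp: \<gamma>'_def)
      ultimately show ?thesis by blast
    qed
  qed
  then show thesis using that by blast
qed

text \<open>Cancel powers of \<open>g\<close> until the relation has a nonzero constant term; that
  term is then a multiple of \<open>g\<close>.\<close>

lemma relation_multiple:
  assumes "\<And>i. i \<le> N \<Longrightarrow> \<gamma> i \<in> F" "\<exists>i\<le>N. \<gamma> i \<noteq> 0" "(\<Sum>i\<le>N. \<gamma> i * g ^ i) = 0" "g \<noteq> 0"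
  obtains e e' where "e \<in> F" "e \<noteq> 0" "\<And>i. i < N \<Longrightarrow> e' i \<in> F" "e = g * (\<Sum>i<N. e' i * g ^ i)"
proof -
  have "\<exists>e e'. e \<in> F \<and> e \<noteq> 0 \<and> (\<forall>i<N. e' i \<in> F) \<and> e = g * (\<Sum>i<N. e' i * g ^ i)"
    using assms(1-3)
  proof (induction N arbitrary: \<gamma>)
    case 0
    then show ?case by simp
  next
    case (Suc N)
    have eq: "(\<Sum>i\<le>Suc N. \<gamma> i * g ^ i) = \<gamma> 0 + g * (\<Sum>i<Suc N. \<gamma> (Suc i) * g ^ i)"
      by (simp only: sum.atMost_Suc_shift lessThan_Suc_atMost) (simp add: sum_distrib_left algebra_simps)
    show ?case
    proof (cases "\<gamma> 0 = 0")
      case False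
      have "\<gamma> 0 = g * (\<Sum>i<Suc N. (- \<gamma> (Suc i)) * g ^ i)"
        using Suc.prems(3) unfolding eq by (simp only: mult_minus_left sum_negf mult_minus_right) (simp add: eq_neg_iff_add_eq_0)
      moreover have "\<gamma> 0 \<in> F" "\<forall>i<Suc N. - \<gamma> (Suc i) \<in> F"
        using Suc.prems(1) uminus by auto
      ultimately show ?thesis
        using False by (intro exI[of _ "\<gamma> 0"] exI[of _ "\<lambda>i. - \<gamma> (Suc i)"] conjI) assumption+
    next
      case True
      have "(\<Sum>i\<le>N. \<gamma> (Suc i) * g ^ i) = 0"
        using Suc.prems(3) True \<open>g \<noteq> 0\<close> unfolding eq by (simp add: lessThan_Suc_atMost)
      moreover have "\<exists>i\<le>N. \<gamma> (Suc i) \<noteq> 0"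
        using Suc.prems(2) True by (metis Suc_le_mono not0_implies_Suc)
      ultimately obtain e e' where e: "e \<in> F" "e \<noteq> 0" "\<forall>i<N. e' i \<in> F" "e = g * (\<Sum>i<N. e' i * g ^ i)"
        using Suc.IH[of "\<lambda>i. \<gamma> (Suc i)"] Suc.prems(1) by auto
      then show ?thesis
        using zero by (intro exI[of _ e] exI[of _ "\<lambda>i. if i < N then e' i else 0"]) (auto intro!: sum.cong)
    qed
  qed
  then show thesis using that by blast
qed

end

section \<open>Algebraicity from a nonzero Jacobian determinant\<close>

text \<open>Polynomials over \<open>'q\<close> model the tensor product of \<open>'q\<close> with
  the polynomial ring over K: constants form the first factor and variables the second. In this
  reading \<open>mlift h f\<close> is 1 tensor \<open>f\<close>.\<close>

definition mlift :: "('k::field \<Rightarrow> 'q::field) \<Rightarrow> 'k mpoly \<Rightarrow> 'q mpoly" where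
  "mlift h f = mpeval (\<lambda>c. sing 0 (h c)) mvar f"

lemma kalg_id: "kalg (\<lambda>c. c)"
  by (simp add: kalg_def)

lemma kalg_sing: "kalg h \<Longrightarrow> kalg (\<lambda>c. sing 0 (h c))"
  by (simp add: kalg_def single_add mult_single)

lemma mpeval_mlift: "kalg h \<Longrightarrow> mpeval (\<lambda>c. c) z (mlift h f) = mpeval h z f"
  unfolding mlift_def
  by (subst mpeval_hom[where h' = h])
    (auto simp: kalg_sing mpeval_simps[OF kalg_id])

text \<open>Products are handled by writing f(X) g(X) - f(z) g(z) as g(X) (f(X) - f(z)) + f(z) (g(X)
  - g(z)). The quotients thus obey a twisted product rule, which at X = z becomes the product rule
  of the partial derivatives.\<close>

lemma difference_quotient:
  fixes h :: "'k::field \<Rightarrow> 'q::field"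
  assumes h: "kalg h" and f: "vars_in {..<n} f"
  obtains M where "mlift h f - sing 0 (mpeval h z f) = (\<Sum>l<n. M l * (mvar l - sing 0 (z l)))"
    "\<And>l. mpeval (\<lambda>c. c) z (M l) = mpeval h z (mpderiv l f)"
proof -
  note simps = mpeval_simps[OF h] mpeval_simps[OF kalg_sing[OF h]] mpeval_simps[OF kalg_id]
  have "\<exists>M. mlift h f - sing 0 (mpeval h z f) = (\<Sum>l<n. M l * (mvar l - sing 0 (z l))) \<and>
    (\<forall>l. mpeval (\<lambda>c. c) z (M l) = mpeval h z (mpderiv l f))"
    using f
  proof (induction f rule: vars_in_induct)
    case (const c)
    show ?case by (auto simp: mlift_def simps intro!: exI[of _ "\<lambda>_. 0"])
  next
    case (var i)
    have "(\<Sum>l<n. (if l = i then 1 else 0) * (mvar l - sing 0 (z l))) =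
        (\<Sum>l<n. if l = i then (mvar l - sing 0 (z l)) else 0)"
      by (intro sum.cong) auto
    with var show ?case
      by (auto simp: mlift_def simps mpderiv_mvar intro!: exI[of _ "\<lambda>l. if l = i then 1 else 0"])
  next
    case (add a b)
    then obtain A B where AB:
      "mlift h a - sing 0 (mpeval h z a) = (\<Sum>l<n. A l * (mvar l - sing 0 (z l)))"
      "mlift h b - sing 0 (mpeval h z b) = (\<Sum>l<n. B l * (mvar l - sing 0 (z l)))"
      "\<forall>l. mpeval (\<lambda>c. c) z (A l) = mpeval h z (mpderiv l a)"
      "\<forall>l. mpeval (\<lambda>c. c) z (B l) = mpeval h z (mpderiv l b)" by blast
    have "mlift h (a + b) - sing 0 (mpeval h z (a + b)) =
        (mlift h a - sing 0 (mpeval h z a)) + (mlift h b - sing 0 (mpeval h z b))"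
      by (simp add: mlift_def simps algebra_simps single_add)
    also have "\<dots> = (\<Sum>l<n. (A l + B l) * (mvar l - sing 0 (z l)))"
      unfolding AB(1,2) by (simp add: sum.distrib[symmetric] algebra_simps)
    finally show ?case
      using AB(3,4) by (intro exI[of _ "\<lambda>l. A l + B l"]) (simp add: simps mpderiv_add)
  next
    case (mult a b)
    then obtain A B where AB:
      "mlift h a - sing 0 (mpeval h z a) = (\<Sum>l<n. A l * (mvar l - sing 0 (z l)))"
      "mlift h b - sing 0 (mpeval h z b) = (\<Sum>l<n. B l * (mvar l - sing 0 (z l)))"
      "\<forall>l. mpeval (\<lambda>c. c) z (A l) = mpeval h z (mpderiv l a)"
      "\<forall>l. mpeval (\<lambda>c. c) z (B l) = mpeval h z (mpderiv l b)" by blast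
    let ?M = "\<lambda>l. mlift h b * A l + sing 0 (mpeval h z a) * B l"
    have "mlift h (a * b) - sing 0 (mpeval h z (a * b)) =
        mlift h b * (mlift h a - sing 0 (mpeval h z a)) + sing 0 (mpeval h z a) * (mlift h b - sing 0 (mpeval h z b))"
      by (simp add: mlift_def simps algebra_simps mult_single)
    also have "\<dots> = (\<Sum>l<n. ?M l * (mvar l - sing 0 (z l)))"
      unfolding AB(1,2) by (simp add: sum_distrib_left sum.distrib[symmetric] algebra_simps)
    finally have 1: "mlift h (a * b) - sing 0 (mpeval h z (a * b)) = (\<Sum>l<n. ?M l * (mvar l - sing 0 (z l)))" .
    have 2: "\<forall>l. mpeval (\<lambda>c. c) z (?M l) = mpeval h z (mpderiv l (a * b))"
      using AB(3,4) by (simp add: simps mpeval_mlift[OF h] mpderiv_mult algebra_simps)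
    show ?case using 1 2 by (intro exI[of _ ?M]) blast
  qed
  then show thesis using that by blast
qed

text \<open>The functional \<phi> acts on the second tensor factor, evaluated at \<open>z\<close>
  and multiplied by \<open>y\<close>. Constants of the polynomial come out in front, while a factor
  \<open>mvar i\<close> moves into the argument as \<open>z i\<close>; the difference of the two is
  what the diagonal ideal measures.\<close>

definition contract :: "(nat \<Rightarrow> 'q::field) \<Rightarrow> ('q \<Rightarrow> 'q) \<Rightarrow> 'q mpoly \<Rightarrow> 'q \<Rightarrow> 'q" where
  "contract z \<phi> p y = (\<Sum>\<beta>\<in>kys p. lkp p \<beta> * \<phi> (mon_eval z \<beta> * y))"

lemma contract_superset:
  "finite S \<Longrightarrow> kys p \<subseteq> S \<Longrightarrow> contract z \<phi> p y = (\<Sum>\<beta>\<in>S. lkp p \<beta> * \<phi> (mon_eval z \<beta> * y))"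
  unfolding contract_def by (rule sum.mono_neutral_left) (auto simp: in_keys_iff)

lemma contract_add: "contract z \<phi> (p + q) y = contract z \<phi> p y + contract z \<phi> q y"
proof -
  let ?S = "kys p \<union> kys q"
  have "contract z \<phi> (p + q) y = (\<Sum>\<beta>\<in>?S. lkp (p + q) \<beta> * \<phi> (mon_eval z \<beta> * y))"
    by (rule contract_superset) (use Poly_Mapping.keys_add[of p q] in auto)
  then show ?thesis
    by (simp add: contract_superset[of ?S] lookup_add algebra_simps sum.distrib)
qed

lemma contract_0 [simp]: "contract z \<phi> 0 y = 0"
  by (simp add: contract_def)

lemma contract_uminus: "contract z \<phi> (- p) y = - contract z \<phi> p y"
  using contract_add[of z \<phi> p "- p" y] by (simp add: eq_neg_iff_add_eq_0 add.commute)

lemma contract_diff: "contract z \<phi> (p - q) y = contract z \<phi> p y - contract z \<phi> q y"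
  using contract_add[of z \<phi> p "- q" y] by (simp add: contract_uminus)

lemma contract_sum: "contract z \<phi> (\<Sum>i\<in>S. p i) y = (\<Sum>i\<in>S. contract z \<phi> (p i) y)"
  by (induction S rule: infinite_finite_induct) (auto simp: contract_add)

lemma contract_single: "contract z \<phi> (sing \<beta> q) y = q * \<phi> (mon_eval z \<beta> * y)"
  by (cases "q = 0") (auto simp: contract_def)

lemma contract_const: "contract z \<phi> (sing 0 q * p) y = q * contract z \<phi> p y"
  by (induction p rule: single_induct)
    (auto simp: contract_add algebra_simps mult_single contract_single)

lemma contract_mvar: "contract z \<phi> (mvar i * p) y = contract z \<phi> p (z i * y)"
  by (induction p rule: single_induct)
    (auto simp: contract_add algebra_simps mvar_def mult_single contract_single mon_eval_add)

context subfield_set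
begin

lemma contract_scale:
  assumes "functional \<phi>" "c \<in> F"
  shows "contract z \<phi> p (c * y) = c * contract z \<phi> p y"
proof -
  have "\<phi> (mon_eval z \<beta> * (c * y)) = c * \<phi> (mon_eval z \<beta> * y)" for \<beta>
    using assms by (metis functional_def mult.left_commute)
  then show ?thesis
    by (simp add: contract_def sum_distrib_left algebra_simps)
qed

lemma contract_arg_add:
  assumes "functional \<phi>"
  shows "contract z \<phi> p (y + y') = contract z \<phi> p y + contract z \<phi> p y'"
  using assms by (simp add: contract_def functional_def sum.distrib algebra_simps)

lemma contract_mlift:
  assumes h: "kalg h" "range h \<subseteq> F" and \<phi>: "functional \<phi>"
  shows "contract z \<phi> (mlift h f * p) y = contract z \<phi> p (mpeval h z f * y)"
proof -
  note simps = mpeval_simps[OF h(1)] mpeval_simps[OF kalg_sing[OF h(1)]]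
  have "vars_in UNIV f" by (simp add: vars_in_def)
  then show ?thesis
  proof (induction f arbitrary: p y rule: vars_in_induct)
    case (const c)
    have "h c \<in> F" using h(2) by blast
    then show ?case by (simp add: mlift_def simps contract_const contract_scale[OF \<phi>])
  next
    case (var i)
    then show ?case by (simp add: mlift_def simps contract_mvar)
  next
    case (add a b)
    have "mlift h (a + b) = mlift h a + mlift h b" by (simp add: mlift_def simps)
    then show ?case using add by (simp add: simps distrib_right contract_add contract_arg_add[OF \<phi>])
  next
    case (mult a b)
    have "mlift h (a * b) = mlift h a * mlift h b" by (simp add: mlift_def simps)
    then have "contract z \<phi> (mlift h (a * b) * p) y = contract z \<phi> (mlift h a * (mlift h b * p)) y"
      by (simp add: mult.assoc)
    also have "\<dots> = contract z \<phi> p (mpeval h z (a * b) * y)"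
      by (simp only: mult) (simp add: simps algebra_simps)
    finally show ?case .
  qed
qed

end

section \<open>Subalgebras generated by coordinates and their fractions\<close>

definition poly_values :: "('k::field \<Rightarrow> 'b::comm_ring_1) \<Rightarrow> (nat \<Rightarrow> 'b) \<Rightarrow> nat set \<Rightarrow> 'b set" where
  "poly_values h z V = {mpeval h z p | p. vars_in V p}"

lemma poly_values_closed:
  assumes "kalg h"
  shows "a \<in> poly_values h z V \<Longrightarrow> b \<in> poly_values h z V \<Longrightarrow> a + b \<in> poly_values h z V"
    "a \<in> poly_values h z V \<Longrightarrow> b \<in> poly_values h z V \<Longrightarrow> a * b \<in> poly_values h z V"
    "a \<in> poly_values h z V \<Longrightarrow> - a \<in> poly_values h z V"
    "h c \<in> poly_values h z V" "0 \<in> poly_values h z V" "1 \<in> poly_values h z V"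
    "i \<in> V \<Longrightarrow> z i \<in> poly_values h z V"
proof -
  note simps = mpeval_simps[OF assms]
  show "a + b \<in> poly_values h z V" if ab: "a \<in> poly_values h z V" "b \<in> poly_values h z V"
  proof -
    obtain p q where "a = mpeval h z p" "b = mpeval h z q" "vars_in V p" "vars_in V q"
      using ab unfolding poly_values_def by blast
    then have "a + b = mpeval h z (p + q)" "vars_in V (p + q)" by (auto simp: simps vars_in_add)
    then show ?thesis by (auto simp: poly_values_def)
  qed
  show "a * b \<in> poly_values h z V" if ab: "a \<in> poly_values h z V" "b \<in> poly_values h z V"
  proof -
    obtain p q where "a = mpeval h z p" "b = mpeval h z q" "vars_in V p" "vars_in V q"
      using ab unfolding poly_values_def by blast
    then have "a * b = mpeval h z (p * q)" "vars_in V (p * q)" by (auto simp: simps vars_in_mult)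
    then show ?thesis by (auto simp: poly_values_def)
  qed
  show "- a \<in> poly_values h z V" if a: "a \<in> poly_values h z V"
  proof -
    obtain p where "a = mpeval h z p" "vars_in V p"
      using a unfolding poly_values_def by blast
    then have "- a = mpeval h z (- p)" "vars_in V (- p)" by (auto simp: simps vars_in_uminus)
    then show ?thesis by (auto simp: poly_values_def)
  qed
  show *: "h c \<in> poly_values h z V" for c
    unfolding poly_values_def by (auto simp: simps intro!: exI[of _ "sing 0 c"])
  show "0 \<in> poly_values h z V" "1 \<in> poly_values h z V"
    using *[of 0] *[of 1] by (auto simp: kalg_simps[OF assms])
  show "i \<in> V \<Longrightarrow> z i \<in> poly_values h z V"
    unfolding poly_values_def by (auto simp: simps vars_in_mvar intro!: exI[of _ "mvar i"])
qed

lemma poly_values_mono: "V \<subseteq> W \<Longrightarrow> poly_values h z V \<subseteq> poly_values h z W"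
  by (auto simp: poly_values_def intro: vars_in_mono)

lemma poly_values_power:
  assumes "kalg h" shows "a \<in> poly_values h z V \<Longrightarrow> a ^ k \<in> poly_values h z V"
  by (induction k) (auto simp: poly_values_closed[OF assms])

lemma poly_values_sum:
  assumes "kalg h"
  shows "(\<And>i. i \<in> S \<Longrightarrow> g i \<in> poly_values h z V) \<Longrightarrow> sum g S \<in> poly_values h z V"
  by (induction S rule: infinite_finite_induct) (auto simp: poly_values_closed[OF assms])

definition fractions :: "'q::field set \<Rightarrow> 'q set" where
  "fractions E = {a / b | a b. a \<in> E \<and> b \<in> E \<and> b \<noteq> 0}"

lemma subfield_fractions:
  fixes h :: "'k::field \<Rightarrow> 'q::field"
  assumes h: "kalg h"
  shows "subfield_set (fractions (poly_values h z V))"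
proof -
  let ?E = "poly_values h z V"
  note closed = poly_values_closed[OF h]
  show ?thesis
  proof
    show "1 \<in> fractions ?E" using closed(6) unfolding fractions_def by (intro CollectI exI[of _ 1]) auto
  next
    fix x y assume "x \<in> fractions ?E" "y \<in> fractions ?E"
    then obtain a b c d where *: "x = a / b" "y = c / d" "a \<in> ?E" "b \<in> ?E" "c \<in> ?E" "d \<in> ?E" "b \<noteq> 0" "d \<noteq> 0"
      by (auto simp: fractions_def)
    then have "x + y = (a * d + c * b) / (b * d)" by (simp add: field_simps)
    then show "x + y \<in> fractions ?E" using * closed unfolding fractions_def
      by (intro CollectI exI[of _ "a * d + c * b"] exI[of _ "b * d"]) auto
    have "x * y = (a * c) / (b * d)" using * by (simp add: field_simps)
    then show "x * y \<in> fractions ?E" using * closed unfolding fractions_def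
      by (intro CollectI exI[of _ "a * c"] exI[of _ "b * d"]) auto
  next
    fix x assume "x \<in> fractions ?E"
    then obtain a b where *: "x = a / b" "a \<in> ?E" "b \<in> ?E" "b \<noteq> 0" by (auto simp: fractions_def)
    then have "- x = (- a) / b" by simp
    then show "- x \<in> fractions ?E" using * closed unfolding fractions_def by blast
    show "inverse x \<in> fractions ?E"
    proof (cases "a = 0")
      case True
      then have "inverse x = 0 / 1" using * by simp
      then show ?thesis using closed unfolding fractions_def by fastforce
    next
      case False
      then have "inverse x = b / a" using * by simp
      then show ?thesis using * False unfolding fractions_def by blast
    qed
  qed
qed

lemma common_denominator:
  fixes h :: "'k::field \<Rightarrow> 'q::field"
  assumes h: "kalg h" and "finite I" "\<And>i. i \<in> I \<Longrightarrow> g i \<in> fractions (poly_values h z V)"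
  obtains d where "d \<in> poly_values h z V" "d \<noteq> 0" "\<And>i. i \<in> I \<Longrightarrow> d * g i \<in> poly_values h z V"
proof -
  let ?E = "poly_values h z V"
  note closed = poly_values_closed[OF h]
  have "\<exists>d. d \<in> ?E \<and> d \<noteq> 0 \<and> (\<forall>i\<in>I. d * g i \<in> ?E)"
    using assms(2,3)
  proof (induction I)
    case empty
    then show ?case using closed(6) by (auto intro: exI[of _ 1])
  next
    case (insert j I)
    then obtain d where d: "d \<in> ?E" "d \<noteq> 0" "\<forall>i\<in>I. d * g i \<in> ?E" by auto
    have "g j \<in> fractions ?E" using insert by auto
    then obtain a b where ab: "g j = a / b" "a \<in> ?E" "b \<in> ?E" "b \<noteq> 0" by (auto simp: fractions_def)
    have "(d * b) * g i \<in> ?E" if "i \<in> insert j I" for i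
    proof (cases "i = j")
      case True
      then show ?thesis using ab d closed by simp
    next
      case False
      then have "d * g i \<in> ?E" using d that by auto
      then have "b * (d * g i) \<in> ?E" using closed ab by blast
      then show ?thesis by (simp add: algebra_simps)
    qed
    then show ?case using d ab closed by (intro exI[of _ "d * b"]) auto
  qed
  then show thesis using that by blast
qed

text \<open>A tensor-free form of the statement that an unramified algebra over a field is
  finite-dimensional: the Jacobian determinant lifts to an element of the tensor square
  that is killed by the diagonal ideal. Contracting its second factor with a functional
  of \<open>F\<close> gives a map \<open>u\<close> that is linear over the whole algebra and whose values lie in a
  finite-dimensional \<open>F\<close>-space.\<close>

proposition jacobian_algebraic:
  fixes h :: "'k::field \<Rightarrow> 'q::field"
  assumes h: "kalg h"
    and f: "\<And>i. i < r \<Longrightarrow> vars_in {..<n} (f i)" "\<And>i. i < r \<Longrightarrow> mpeval h z (f i) = 0"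
    and ci: "inj_on ci {..<r}" "ci ` {..<r} \<subseteq> {..<n}"
    and det: "ndet r (\<lambda>i j. mpeval h z (mpderiv (ci j) (f i))) \<noteq> 0"
    and g: "g \<in> poly_values h z {..<n}" "g \<noteq> 0"
  obtains w where "w \<in> poly_values h z {..<n}" "g * w \<in> poly_values h z ({..<n} - ci ` {..<r})" "g * w \<noteq> 0"
proof -
  define T where "T = {..<n} - ci ` {..<r}"
  let ?E = "poly_values h z T"
  let ?C = "poly_values h z {..<n}"
  define F where "F = fractions ?E"
  interpret subfield_set F unfolding F_def by (rule subfield_fractions[OF h])
  note closed = poly_values_closed[OF h]
  have EF: "a \<in> F" if "a \<in> ?E" for a
    unfolding F_def fractions_def using that closed(6) by (intro CollectI exI[of _ a] exI[of _ 1]) auto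
  have hF: "range h \<subseteq> F" using EF closed(4) by blast
  have "\<exists>Mi. i < r \<longrightarrow> mlift h (f i) - sing 0 (mpeval h z (f i)) = (\<Sum>l<n. Mi l * (mvar l - sing 0 (z l))) \<and>
      (\<forall>l. mpeval (\<lambda>c. c) z (Mi l) = mpeval h z (mpderiv l (f i)))" for i
  proof (cases "i < r")
    case True
    show ?thesis by (rule difference_quotient[OF h f(1)[OF True], of z]) blast
  qed auto
  then have "\<exists>M. \<forall>i. i < r \<longrightarrow> mlift h (f i) - sing 0 (mpeval h z (f i)) = (\<Sum>l<n. M i l * (mvar l - sing 0 (z l))) \<and>
      (\<forall>l. mpeval (\<lambda>c. c) z (M i l) = mpeval h z (mpderiv l (f i)))"
    by (intro choice allI)
  then obtain M where
    M: "\<And>i. i < r \<Longrightarrow> mlift h (f i) = (\<Sum>l<n. M i l * (mvar l - sing 0 (z l)))"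
    and Mz: "\<And>i l. i < r \<Longrightarrow> mpeval (\<lambda>c. c) z (M i l) = mpeval h z (mpderiv l (f i))"
    using f(2) by auto
  \<comment> \<open>At the point \<open>z\<close> the difference quotients become partial
    derivatives, so the value of \<delta> there is the Jacobian determinant. As this is nonzero, a
    functional \<phi> with \<open>u 1 \<noteq> 0\<close> can be found.\<close>
  define \<delta> where "\<delta> = ndet r (\<lambda>i j. M i (ci j))"
  have "mpeval (\<lambda>c. c) z \<delta> = ndet r (\<lambda>i j. mpeval (\<lambda>c. c) z (M i (ci j)))"
    unfolding \<delta>_def by (intro ndet_hom) (simp_all add: mpeval_simps[OF kalg_id])
  also have "\<dots> = ndet r (\<lambda>i j. mpeval h z (mpderiv (ci j) (f i)))"
    unfolding ndet_def by (intro arg_cong[where f = det] eq_matI) (auto simp: Mz)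
  finally have "(\<Sum>\<beta>\<in>kys \<delta>. lkp \<delta> \<beta> * mon_eval z \<beta>) \<noteq> 0"
    using det by (simp add: mpeval_mon_eval)
  then obtain \<phi> where \<phi>: "functional \<phi>" "(\<Sum>\<beta>\<in>kys \<delta>. lkp \<delta> \<beta> * \<phi> (mon_eval z \<beta>)) \<noteq> 0"
    by (rule functional_nonvanishing[rotated]) auto
  define u where "u = contract z \<phi> \<delta>"
  have u1: "u 1 \<noteq> 0" using \<phi>(2) by (simp add: u_def contract_def)
  have uF: "u (c * y) = c * u y" if "c \<in> F" for c y
    unfolding u_def by (rule contract_scale[OF \<phi>(1) that])
  obtain B where B: "\<And>i j. i < r \<Longrightarrow> j < r \<Longrightarrow> (\<Sum>k<r. B i k * M k (ci j)) = (if i = j then \<delta> else 0)"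
    by (rule adjugate_exists[of r "\<lambda>i j. M i (ci j)"]) (unfold \<delta>_def, blast)
  \<comment> \<open>The adjugate expresses (X - z) \<delta>, for the chosen column, by the lifted
    equations and by the differences X - z of variables in \<open>T\<close>. Contraction kills the
    former because the equations vanish at \<open>z\<close>, and the latter because these
    coordinates lie in \<open>F\<close>.\<close>
  have uz: "u (z (ci c) * y) = z (ci c) * u y" if c: "c < r" for c y
  proof -
    let ?d = "\<lambda>l. mvar l - sing 0 (z l)"
    have split: "mlift h (f k) = (\<Sum>j<r. M k (ci j) * ?d (ci j)) + (\<Sum>l\<in>T. M k l * ?d l)" if "k < r" for k
    proof -
      have "{..<n} = ci ` {..<r} \<union> T" using ci by (auto simp: T_def)
      then have "mlift h (f k) = (\<Sum>l\<in>ci ` {..<r} \<union> T. M k l * ?d l)" using M that by simp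
      also have "\<dots> = (\<Sum>l\<in>ci ` {..<r}. M k l * ?d l) + (\<Sum>l\<in>T. M k l * ?d l)"
        by (rule sum.union_disjoint) (auto simp: T_def)
      also have "(\<Sum>l\<in>ci ` {..<r}. M k l * ?d l) = (\<Sum>j<r. M k (ci j) * ?d (ci j))"
        by (simp add: sum.reindex[OF ci(1)])
      finally show ?thesis .
    qed
    have "(\<Sum>k<r. B c k * (\<Sum>j<r. M k (ci j) * ?d (ci j))) = (\<Sum>j<r. (\<Sum>k<r. B c k * M k (ci j)) * ?d (ci j))"
      by (simp add: sum_distrib_left sum_distrib_right mult.assoc) (rule sum.swap)
    also have "\<dots> = (\<Sum>j<r. if c = j then \<delta> * ?d (ci j) else 0)"
      using c by (intro sum.cong) (auto simp: B)
    also have "\<dots> = \<delta> * ?d (ci c)" using c by simp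
    finally have "\<delta> * ?d (ci c) = (\<Sum>k<r. B c k * (mlift h (f k) - (\<Sum>l\<in>T. M k l * ?d l)))"
      by (simp add: split)
    also have "\<dots> = (\<Sum>k<r. mlift h (f k) * B c k) - (\<Sum>k<r. \<Sum>l\<in>T. ?d l * (B c k * M k l))"
      by (simp add: right_diff_distrib sum_subtractf sum_distrib_left mult_ac)
    finally have eq: "?d (ci c) * \<delta> = (\<Sum>k<r. mlift h (f k) * B c k) - (\<Sum>k<r. \<Sum>l\<in>T. ?d l * (B c k * M k l))"
      by (simp add: mult.commute)
    have zero: "contract z \<phi> p 0 = 0" for p
      using contract_scale[OF \<phi>(1) zero, of z p 0] by simp
    have "contract z \<phi> (mlift h (f k) * B c k) y = 0" if "k < r" for k
      using f(2) that zero by (simp add: contract_mlift[OF h hF \<phi>(1)])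
    moreover have "contract z \<phi> (?d l * p) y = 0" if "l \<in> T" for l p
      using that EF[OF closed(7)[of l T]]
      by (simp add: left_diff_distrib contract_diff contract_mvar contract_const
          contract_scale[OF \<phi>(1)])
    ultimately have "contract z \<phi> (?d (ci c) * \<delta>) y = 0"
      unfolding eq by (simp add: contract_diff contract_sum)
    then show ?thesis
      by (simp add: left_diff_distrib contract_diff contract_mvar contract_const u_def)
  qed
  have uz': "u (z l * y) = z l * u y" if "l < n" for l y
  proof (cases "l \<in> T")
    case True
    then show ?thesis using uF EF closed(7) by blast
  next
    case False
    then show ?thesis using that uz by (auto simp: T_def)
  qed
  have uC: "u (a * y) = a * u y" if a: "a \<in> ?C" for a y
  proof -
    obtain p where p: "a = mpeval h z p" "vars_in {..<n} p"
      using a unfolding poly_values_def by blast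
    have "\<forall>y. u (mpeval h z p * y) = mpeval h z p * u y"
      using p(2)
    proof (induction p rule: vars_in_induct)
      case (add a b)
      then show ?case
        by (simp add: mpeval_simps[OF h] distrib_right)
          (simp add: u_def contract_arg_add[OF \<phi>(1)])
    next
      case (mult a b)
      then show ?case by (simp add: mpeval_simps[OF h] mult.assoc)
    next
      case (const c)
      have "h c \<in> F" using hF by blast
      then show ?case using uF by (simp add: mpeval_simps[OF h])
    qed (use uz' in \<open>auto simp: mpeval_simps[OF h]\<close>)
    then show ?thesis using p by simp
  qed
  \<comment> \<open>Each \<open>g ^ i * u 1\<close> is an \<open>F\<close>-combination of the
    \<open>N\<close> coefficients of \<delta>. Hence the \<open>N + 1\<close> powers with
    \<open>i \<le> N\<close> satisfy a linear relation over \<open>F\<close>.\<close>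
  define N where "N = card (kys \<delta>)"
  define c where "c i \<beta> = \<phi> (mon_eval z \<beta> * g ^ i)" for i :: nat and \<beta>
  have pow: "g ^ i * u 1 = (\<Sum>\<beta>\<in>kys \<delta>. lkp \<delta> \<beta> * c i \<beta>)" for i
  proof -
    have "g ^ i * u 1 = u (g ^ i * 1)"
      using uC[OF poly_values_power[OF h g(1)], of i 1] by (rule sym)
    then show ?thesis by (simp add: u_def contract_def c_def)
  qed
  obtain \<gamma> where \<gamma>: "\<And>i. i \<in> {..N} \<Longrightarrow> \<gamma> i \<in> F" "\<exists>i\<in>{..N}. \<gamma> i \<noteq> 0"
    "\<And>\<beta>. \<beta> \<in> kys \<delta> \<Longrightarrow> (\<Sum>i\<in>{..N}. \<gamma> i * c i \<beta>) = 0"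
    by (rule dependency[of "kys \<delta>" "{..N}" c])
      (use \<phi>(1) in \<open>auto simp: N_def c_def functional_def\<close>)
  have "(\<Sum>i\<le>N. \<gamma> i * g ^ i) * u 1 = (\<Sum>i\<le>N. \<gamma> i * (\<Sum>\<beta>\<in>kys \<delta>. lkp \<delta> \<beta> * c i \<beta>))"
    by (simp add: sum_distrib_right mult.assoc pow)
  also have "\<dots> = (\<Sum>\<beta>\<in>kys \<delta>. lkp \<delta> \<beta> * (\<Sum>i\<le>N. \<gamma> i * c i \<beta>))"
    by (simp add: sum_distrib_left mult_ac) (rule sum.swap)
  also have "\<dots> = 0" using \<gamma>(3) by simp
  finally have rel: "(\<Sum>i\<le>N. \<gamma> i * g ^ i) = 0" using u1 by simp
  obtain e e' where e: "e \<in> F" "e \<noteq> 0" "\<And>i. i < N \<Longrightarrow> e' i \<in> F" "e = g * (\<Sum>i<N. e' i * g ^ i)"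
    by (rule relation_multiple[of N \<gamma> g]) (use \<gamma> rel g(2) in auto)
  \<comment> \<open>Index \<open>N\<close> stands for \<open>e\<close> itself, so that one
    denominator clears \<open>e\<close> together with all coefficients of the cofactor.\<close>
  define E where "E i = (if i < N then e' i else e)" for i
  obtain d where d: "d \<in> ?E" "d \<noteq> 0" "\<And>i. i \<in> {..N} \<Longrightarrow> d * E i \<in> ?E"
    by (rule common_denominator[OF h, of "{..N}" E z T]) (use e in \<open>auto simp: E_def F_def\<close>)
  have EC: "?E \<subseteq> ?C" by (rule poly_values_mono) (auto simp: T_def)
  show thesis
  proof
    show "(\<Sum>i<N. (d * E i) * g ^ i) \<in> ?C"
      using d(3) EC by (intro poly_values_sum[OF h] closed(2)[OF _ poly_values_power[OF h g(1)]]) auto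
    have eq: "g * (\<Sum>i<N. (d * E i) * g ^ i) = d * e"
      by (simp add: e(4) E_def sum_distrib_left mult_ac)
    show "g * (\<Sum>i<N. (d * E i) * g ^ i) \<in> poly_values h z ({..<n} - ci ` {..<r})"
      unfolding eq using d(3)[of N] by (simp add: E_def T_def)
    show "g * (\<Sum>i<N. (d * E i) * g ^ i) \<noteq> 0"
      unfolding eq using d e by simp
  qed
qed

section \<open>Coordinates at a nonzero Jacobian minor\<close>

lemma mpderiv_sum: "mpderiv j (\<Sum>i\<in>S. p i) = (\<Sum>i\<in>S. mpderiv j (p i))"
  by (induction S rule: infinite_finite_induct) (auto simp: mpderiv_add)

lemma lookup_mpderiv: "lkp (mpderiv j p) mn = of_nat (Suc (lkp mn j)) * lkp p (mn + sing j 1)"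
proof (induction p rule: single_induct)
  case (single k c)
  show ?case
  proof (cases "lkp k j = 0")
    case True
    then have "k \<noteq> mn + sing j 1" by (auto simp: lookup_add)
    then show ?thesis using True by (simp add: mpderiv_single lookup_single)
  next
    case False
    have "k - sing j 1 = mn \<longleftrightarrow> k = mn + sing j 1"
    proof
      assume "k - sing j 1 = mn"
      then have "lkp mn i = lkp k i - (if i = j then 1 else 0)" for i
        by (auto simp: lookup_minus lookup_single when_def)
      then show "k = mn + sing j 1"
        using False by (intro poly_mapping_eqI) (auto simp: lookup_add lookup_single when_def)
    qed simp
    then show ?thesis
      by (auto simp: mpderiv_single lookup_single when_def lookup_add)
  qed
qed (auto simp: mpderiv_add lookup_add algebra_simps)

lemma inj_on_extend:
  fixes g :: "nat \<Rightarrow> 'b"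
  assumes "inj_on g {..<r}" "y \<notin> g ` {..<r}"
  shows "inj_on (g(r := y)) {..<Suc r}"
proof (rule inj_onI)
  fix a b assume ab: "a \<in> {..<Suc r}" "b \<in> {..<Suc r}" "(g(r := y)) a = (g(r := y)) b"
  show "a = b"
  proof (cases "a = r \<or> b = r")
    case True
    with ab assms(2) show ?thesis by (force simp: less_Suc_eq split: if_splits)
  next
    case False
    with ab assms(1) show ?thesis by (auto simp: inj_on_def less_Suc_eq)
  qed
qed

definition mon_deg :: "(nat \<Rightarrow>\<^sub>0 nat) \<Rightarrow> nat" where
  "mon_deg mn = (\<Sum>i\<in>kys mn. lkp mn i)"

lemma mon_deg_superset: "finite S \<Longrightarrow> kys mn \<subseteq> S \<Longrightarrow> mon_deg mn = (\<Sum>i\<in>S. lkp mn i)"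
  unfolding mon_deg_def by (rule sum.mono_neutral_left) (auto simp: in_keys_iff)

lemma mon_deg_add: "mon_deg (a + b) = mon_deg a + mon_deg b"
proof -
  let ?S = "kys a \<union> kys b"
  have "mon_deg (a + b) = (\<Sum>i\<in>?S. lkp (a + b) i)"
    by (rule mon_deg_superset) (use Poly_Mapping.keys_add[of a b] in auto)
  then show ?thesis
    by (simp add: mon_deg_superset[of ?S] lookup_add sum.distrib)
qed

lemma mon_deg_single [simp]: "mon_deg (sing i e) = e"
  by (simp add: mon_deg_def)

lemma mon_deg_eq_0: "mon_deg mn = 0 \<Longrightarrow> mn = 0"
  by (rule poly_mapping_eqI) (auto simp: mon_deg_def in_keys_iff)

lemma CHAR_kalg:
  fixes h :: "'k::field \<Rightarrow> 'a::comm_ring_1"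
  assumes "kalg h"
  shows "CHAR('a) = CHAR('k)"
proof -
  have "of_nat c = (0::'a) \<longleftrightarrow> of_nat c = (0::'k)" for c
    using kalg_eq_0_iff[OF assms, of "of_nat c"] by (simp add: kalg_of_nat[OF assms])
  then show ?thesis
    by (intro CHAR_eqI) (simp_all add: of_nat_eq_0_iff_char_dvd)
qed

section \<open>The presentation, a chart given by a nonzero minor, and independence\<close>

locale presentation =
  fixes h :: "'k::field \<Rightarrow> 'a::idom" and n :: nat and x :: "nat \<Rightarrow> 'a" and m :: nat
    and f :: "nat \<Rightarrow> 'k mpoly"
  assumes alg: "kalg h" and pres: "ess_fin_pres h n x m f"
begin

lemmas ev_simps = mpeval_simps[OF alg]
lemmas alg_simps = kalg_simps[OF alg]

lemma f_vars: "i < m \<Longrightarrow> vars_in {..<n} (f i)"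
  using pres by (simp add: ess_fin_pres_def in_Pn_iff_vars_in)

lemma kernel_eq:
  "{p. vars_in {..<n} p \<and> mpeval h x p = 0} = {(\<Sum>j<m. g j * f j) | g. \<forall>j<m. vars_in {..<n} (g j)}"
  using pres by (simp add: ess_fin_pres_def in_Pn_iff_vars_in)

lemma kernelE:
  assumes "vars_in {..<n} p" "mpeval h x p = 0"
  obtains g where "p = (\<Sum>j<m. g j * f j)"
  using kernel_eq assms by blast

lemma f_zero:
  assumes "i < m" shows "mpeval h x (f i) = 0"
proof -
  have "(\<Sum>j<m. (if j = i then 1 else 0) * f j) = (\<Sum>j<m. if j = i then f j else 0)"
    by (intro sum.cong) auto
  also have "\<dots> = f i" using assms by simp
  finally have "f i = (\<Sum>j<m. (if j = i then 1 else 0) * f j)" ..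
  moreover have "\<forall>j<m. vars_in {..<n} ((if j = i then 1 else 0) :: 'k mpoly)"
    by (auto simp: vars_in_def)
  ultimately have "f i \<in> {(\<Sum>j<m. g j * f j) | g. \<forall>j<m. vars_in {..<n} (g j)}"
    by (intro CollectI exI[of _ "\<lambda>j. if j = i then 1 else 0"] conjI)
  then show ?thesis using kernel_eq by blast
qed

lemma fraction_form:
  obtains p s where "vars_in {..<n} p" "vars_in {..<n} s" "mpeval h x s dvd 1"
    "a * mpeval h x s = mpeval h x p"
  using pres unfolding ess_fin_pres_def in_Pn_iff_vars_in by blast

abbreviation J where "J i l \<equiv> mpeval h x (mpderiv l (f i))"

lemma jacobi_matrix_eq: "jacobi_matrix h x f = (\<lambda>i l. J i l)"
  by (intro ext) (simp add: jacobi_matrix_def)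

end

locale jacobi_chart = presentation h n x m f
  for h :: "'k::field \<Rightarrow> 'a::idom" and n x m f +
  fixes r :: nat and ri ci :: "nat \<Rightarrow> nat"
  assumes r: "r = mat_rank (jacobi_matrix h x f) m n"
    and ri: "inj_on ri {..<r}" "ri ` {..<r} \<subseteq> {..<m}"
    and ci: "inj_on ci {..<r}" "ci ` {..<r} \<subseteq> {..<n}"
    and chart_nonzero: "ndet r (\<lambda>i j. mpeval h x (mpderiv (ci j) (f (ri i)))) \<noteq> 0"
begin

definition \<Delta> where "\<Delta> = ndet r (\<lambda>i j. J (ri i) (ci j))"

definition T where "T = {..<n} - ci ` {..<r}"

lemma \<Delta>_nonzero: "\<Delta> \<noteq> 0"
  using chart_nonzero by (simp add: \<Delta>_def)

lemma larger_minor_zero: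
  assumes "d \<in> minors (jacobi_matrix h x f) m n (Suc r)" shows "d = 0"
proof (rule ccontr)
  assume "d \<noteq> 0"
  let ?P = "\<lambda>k. \<exists>d\<in>minors (jacobi_matrix h x f) m n k. d \<noteq> 0"
  have "?P (Suc r)" using assms \<open>d \<noteq> 0\<close> by blast
  \<comment> \<open>\<open>GREATEST\<close> needs a bound: a minor of size \<open>k\<close> uses
    \<open>k\<close> distinct columns out of \<open>n\<close>.\<close>
  moreover have "k \<le> n" if k: "?P k" for k
  proof -
    obtain c where c: "inj_on c {..<k}" "c ` {..<k} \<subseteq> {..<n}"
      using k unfolding minors_def by auto
    then show ?thesis using card_inj_on_le[OF c] by simp
  qed
  ultimately have "Suc r \<le> mat_rank (jacobi_matrix h x f) m n"
    unfolding mat_rank_def by (rule Greatest_le_nat)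
  then show False using r by simp
qed

text \<open>Border the minor by column \<open>j\<close> and by an arbitrary row \<open>i\<close>.
  The bordered determinant vanishes, since either a row is repeated or the size exceeds the rank.
  Its cofactors along the last row do not depend on \<open>i\<close>, so they form a vector in the
  kernel of the whole Jacobi matrix; the cofactor at column \<open>j\<close> is \<Delta>.\<close>

lemma tangent_vector:
  assumes j: "j \<in> T"
  obtains v where "v j = \<Delta>" "\<And>l. l \<in> T \<Longrightarrow> l \<noteq> j \<Longrightarrow> v l = 0" "\<And>i. i < m \<Longrightarrow> (\<Sum>l<n. v l * J i l) = 0"
proof -
  have jn: "j < n" "j \<notin> ci ` {..<r}" using j by (auto simp: T_def)
  define c' where "c' = ci(r := j)"
  define cof where "cof b = (-1) ^ (r + b) *
    det (mat r r (\<lambda>(a, c). J (ri a) (c' (if c < b then c else Suc c))))" for b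
  have cof_r: "cof r = \<Delta>"
  proof -
    have "mat r r (\<lambda>(a, c). J (ri a) (c' (if c < r then c else Suc c))) = mat r r (\<lambda>(a, c). J (ri a) (ci c))"
      by (rule eq_matI) (auto simp: c'_def)
    then show ?thesis by (simp add: cof_def \<Delta>_def ndet_def)
  qed
  have rel: "(\<Sum>b<Suc r. J i (c' b) * cof b) = 0" if i: "i < m" for i
  proof -
    define r' where "r' = ri(r := i)"
    define B where "B = mat (Suc r) (Suc r) (\<lambda>(a, b). J (r' a) (c' b))"
    have B: "B \<in> carrier_mat (Suc r) (Suc r)" by (simp add: B_def)
    have "det B = 0"
    proof (cases "i \<in> ri ` {..<r}")
      case True
      then obtain a where a: "a < r" "ri a = i" by auto
      show ?thesis
      proof (rule det_identical_rows[OF B, of a r])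
        show "row B a = row B r"
          using a by (intro eq_vecI) (auto simp: B_def r'_def)
      qed (use a in auto)
    next
      case False
      have "minor (jacobi_matrix h x f) (Suc r) r' c' \<in> minors (jacobi_matrix h x f) m n (Suc r)"
        unfolding minors_def
      proof (intro CollectI exI conjI)
        show "inj_on r' {..<Suc r}" "inj_on c' {..<Suc r}"
          unfolding r'_def c'_def using ri(1) ci(1) False jn(2) by (auto intro: inj_on_extend)
        show "r' ` {..<Suc r} \<subseteq> {..<m}" "c' ` {..<Suc r} \<subseteq> {..<n}"
          using ri(2) ci(2) i jn(1) by (auto simp: r'_def c'_def less_Suc_eq image_subset_iff)
      qed simp
      then have "minor (jacobi_matrix h x f) (Suc r) r' c' = 0" by (rule larger_minor_zero)
      then show ?thesis by (simp add: minor_eq_ndet jacobi_matrix_eq ndet_def B_def)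
    qed
    moreover have "det B = (\<Sum>b<Suc r. B $$ (r, b) * cofactor B r b)"
      by (rule laplace_expansion_row[OF B]) simp
    moreover have "cofactor B r b = cof b" if "b < Suc r" for b
    proof -
      have "mat_delete B r b = mat r r (\<lambda>(a, c). J (ri a) (c' (if c < b then c else Suc c)))"
        using that by (intro eq_matI) (auto simp: mat_delete_def B_def r'_def)
      then show ?thesis by (simp add: cofactor_def cof_def)
    qed
    moreover have "B $$ (r, b) = J i (c' b)" if "b < Suc r" for b
      using that by (simp add: B_def r'_def)
    ultimately show ?thesis by simp
  qed
  define v where "v l = (if l = j then \<Delta> else if l \<in> ci ` {..<r} then cof (the_inv_into {..<r} ci l) else 0)" for l
  show thesis
  proof
    show "v j = \<Delta>" by (simp add: v_def)
    show "v l = 0" if "l \<in> T" "l \<noteq> j" for l using that by (auto simp: v_def T_def)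
    show "(\<Sum>l<n. v l * J i l) = 0" if "i < m" for i
    proof -
      have "(\<Sum>l<n. v l * J i l) = (\<Sum>l\<in>insert j (ci ` {..<r}). v l * J i l)"
        by (rule sum.mono_neutral_right) (use ci(2) jn in \<open>auto simp: v_def\<close>)
      also have "\<dots> = v j * J i j + (\<Sum>b<r. v (ci b) * J i (ci b))"
        using jn by (simp add: sum.reindex[OF ci(1)])
      also have "\<dots> = cof r * J i j + (\<Sum>b<r. cof b * J i (ci b))"
        using jn by (intro arg_cong2[where f = "(+)"] sum.cong) (auto simp: v_def cof_r the_inv_into_f_f[OF ci(1)])
      also have "\<dots> = (\<Sum>b<Suc r. J i (c' b) * cof b)"
        by (simp add: c'_def mult.commute add.commute)
      finally show ?thesis using rel[OF that] by simp
    qed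
  qed
qed

text \<open>The gradient of a relation is a combination of rows of the Jacobi matrix, hence
  orthogonal to the tangent vector. That vector meets \<open>T\<close> only in \<open>j\<close>,
  with entry \<Delta>, and \<open>p\<close> has no derivatives outside \<open>T\<close>; what
  remains is \<Delta> times the derivative in question.\<close>

lemma relation_derivative_zero:
  assumes p: "vars_in T p" "mpeval h x p = 0" and j: "j \<in> T"
  shows "mpeval h x (mpderiv j p) = 0"
proof -
  have "vars_in {..<n} p" using p(1) by (rule vars_in_mono) (auto simp: T_def)
  then obtain g where g: "p = (\<Sum>k<m. g k * f k)" using kernelE p(2) by blast
  have d: "mpeval h x (mpderiv l p) = (\<Sum>k<m. mpeval h x (g k) * J k l)" for l
    unfolding g by (simp add: mpderiv_sum mpderiv_mult ev_simps f_zero)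
  obtain v where v: "v j = \<Delta>" "\<And>l. l \<in> T \<Longrightarrow> l \<noteq> j \<Longrightarrow> v l = 0" "\<And>i. i < m \<Longrightarrow> (\<Sum>l<n. v l * J i l) = 0"
    using tangent_vector[OF j] by blast
  have "(\<Sum>l<n. v l * mpeval h x (mpderiv l p)) = (\<Sum>l\<in>{j}. v l * mpeval h x (mpderiv l p))"
  proof (rule sum.mono_neutral_right)
    show "\<forall>l\<in>{..<n} - {j}. v l * mpeval h x (mpderiv l p) = 0"
    proof
      fix l assume "l \<in> {..<n} - {j}"
      then show "v l * mpeval h x (mpderiv l p) = 0"
        using v(2)[of l] mpderiv_eq_0_of_vars_in[OF p(1), of l] by (cases "l \<in> T") auto
    qed
  qed (use j in \<open>auto simp: T_def\<close>)
  moreover have "(\<Sum>l<n. v l * mpeval h x (mpderiv l p)) = (\<Sum>k<m. mpeval h x (g k) * (\<Sum>l<n. v l * J k l))"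
    unfolding d by (simp add: sum_distrib_left mult_ac) (rule sum.swap)
  ultimately have "\<Delta> * mpeval h x (mpderiv j p) = 0"
    using v by simp
  then show ?thesis using \<Delta>_nonzero by simp
qed

text \<open>The derivatives of a relation are relations of smaller degree, hence zero, so the
  characteristic divides every exponent. In characteristic 0 only a constant is left. In
  characteristic q, perfectness of K provides q-th roots of the coefficients; dividing the exponents
  by q gives a polynomial whose value has q-th power 0, hence, A being a domain, again a relation of
  smaller degree.\<close>

lemma independent_of_degree:
  assumes perfect: "perfect_field TYPE('k)"
  shows "vars_in T p \<Longrightarrow> mpeval h x p = 0 \<Longrightarrow> (\<And>mn. mn \<in> kys p \<Longrightarrow> mon_deg mn \<le> d) \<Longrightarrow> p = 0"
proof (induction d arbitrary: p rule: less_induct)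
  case (less d)
  show ?case
  proof (cases "kys p \<subseteq> {0}")
    case True
    then have "p = sing 0 (lkp p 0)"
      by (intro poly_mapping_eqI) (auto simp: lookup_single when_def in_keys_iff)
    moreover from this have "h (lkp p 0) = 0" using less.prems(2) ev_simps(3) by metis
    ultimately show ?thesis using kalg_eq_0_iff[OF alg] by auto
  next
    case False
    then obtain mn0 where mn0: "mn0 \<in> kys p" "mn0 \<noteq> 0" by auto
    then have d0: "d > 0" using less.prems(3)[of mn0] mon_deg_eq_0[of mn0] by force
    have deriv0: "mpderiv j p = 0" if "j \<in> T" for j
    proof (rule less.IH[of "d - 1"])
      show "mpeval h x (mpderiv j p) = 0"
        using relation_derivative_zero[OF less.prems(1,2) that] .
      fix mn assume "mn \<in> kys (mpderiv j p)"
      then have "mn + sing j 1 \<in> kys p" by (auto simp: in_keys_iff lookup_mpderiv)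
      from less.prems(3)[OF this] show "mon_deg mn \<le> d - 1" by (simp add: mon_deg_add)
    qed (use d0 less.prems(1) in \<open>auto intro: vars_in_mpderiv\<close>)
    have exps: "of_nat (lkp mn j) = (0::'k)" if "mn \<in> kys p" for mn j
    proof (cases "lkp mn j = 0")
      case pos: False
      then have "j \<in> kys mn" by (simp add: in_keys_iff)
      then have "j \<in> T" using less.prems(1) that unfolding vars_in_def by blast
      define mn' where "mn' = mn - sing j 1"
      have mn: "mn = mn' + sing j 1"
        using pos by (intro poly_mapping_eqI) (auto simp: mn'_def lookup_add lookup_minus lookup_single when_def)
      have "lkp (mpderiv j p) mn' = 0" using deriv0[OF \<open>j \<in> T\<close>] by simp
      then have "of_nat (lkp mn j) * lkp p mn = 0"
        unfolding lookup_mpderiv by (simp add: mn lookup_add)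
      then show ?thesis using that by (auto simp: in_keys_iff)
    qed simp
    define q where "q = CHAR('k)"
    \<comment> \<open>This covers characteristic 0 as well: divisibility by 0 means that the
      exponent is 0.\<close>
    have dvd: "q dvd lkp mn j" if "mn \<in> kys p" for mn j
      using exps[OF that] by (simp add: q_def of_nat_eq_0_iff_char_dvd)
    have "q \<noteq> 0"
    proof
      assume "q = 0"
      then have "mn0 = 0" using dvd[OF mn0(1)] by (intro poly_mapping_eqI) auto
      then show False using mn0 by simp
    qed
    then have "prime q" unfolding q_def by (intro prime_CHAR_semidom) auto
    then have q1: "q > 1" by (rule prime_gt_1_nat)
    have qa: "q = CHAR('a)" using CHAR_kalg[OF alg] by (simp add: q_def)
    have "\<exists>rt. \<forall>c::'k. rt c ^ q = c"
      using perfect \<open>q \<noteq> 0\<close> by (intro choice) (auto simp: perfect_field_def q_def)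
    then obtain rt :: "'k \<Rightarrow> 'k" where rt: "\<And>c. rt c ^ q = c" by blast
    define dv where "dv mn = Poly_Mapping.map (\<lambda>e. e div q) mn" for mn :: "nat \<Rightarrow>\<^sub>0 nat"
    have lk_dv: "lkp (dv mn) i = lkp mn i div q" for mn i
      by (simp add: dv_def Poly_Mapping.map.rep_eq when_def)
    have kys_dv: "kys (dv mn) \<subseteq> kys mn" for mn
      by (intro subsetI) (metis in_keys_iff lk_dv div_0)
    \<comment> \<open>Only the evaluated identity, that the q-th power of H(x) is p(x), is used
      below; it takes place in A, where the Frobenius map is additive.\<close>
    define H where "H = (\<Sum>mn\<in>kys p. sing (dv mn) (rt (lkp p mn)))"
    have mon_pow: "mon_eval x (dv mn) ^ q = mon_eval x mn" if "mn \<in> kys p" for mn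
    proof -
      have "mon_eval x (dv mn) ^ q = (\<Prod>i\<in>kys mn. x i ^ lkp (dv mn) i) ^ q"
        using kys_dv[of mn] by (simp add: mon_eval_superset[of "kys mn"])
      also have "\<dots> = (\<Prod>i\<in>kys mn. x i ^ (lkp (dv mn) i * q))"
        by (simp add: prod_power_distrib power_mult)
      also have "\<dots> = mon_eval x mn"
        unfolding mon_eval_def using dvd[OF that] by (intro prod.cong) (auto simp: lk_dv)
      finally show ?thesis .
    qed
    have "mpeval h x H ^ q = (\<Sum>mn\<in>kys p. h (rt (lkp p mn)) * mon_eval x (dv mn)) ^ q"
      by (simp add: H_def mpeval_sum[OF alg] mpeval_single[OF alg])
    also have "\<dots> = (\<Sum>mn\<in>kys p. (h (rt (lkp p mn)) * mon_eval x (dv mn)) ^ q)"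
      using \<open>prime q\<close> qa by (intro freshmans_dream_sum) auto
    also have "\<dots> = (\<Sum>mn\<in>kys p. h (lkp p mn) * mon_eval x mn)"
      by (intro sum.cong) (auto simp: power_mult_distrib mon_pow rt simp flip: kalg_power[OF alg])
    also have "\<dots> = 0" using less.prems(2) by (simp add: mpeval_mon_eval)
    finally have "mpeval h x H = 0" by simp
    moreover have keysH: "\<exists>mn\<in>kys p. mn' = dv mn" if "mn' \<in> kys H" for mn'
    proof -
      have "mn' \<in> (\<Union>mn\<in>kys p. kys (sing (dv mn) (rt (lkp p mn))))"
        using that Poly_Mapping.keys_sum[of "\<lambda>mn. sing (dv mn) (rt (lkp p mn))" "kys p"]
        unfolding H_def by blast
      then show ?thesis by (auto split: if_splits)
    qed
    moreover have "vars_in T H"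
      unfolding vars_in_def
    proof
      fix mn' assume "mn' \<in> kys H"
      then obtain mn where "mn \<in> kys p" "mn' = dv mn" using keysH by blast
      then show "kys mn' \<subseteq> T" using less.prems(1) kys_dv[of mn] by (auto simp: vars_in_def)
    qed
    moreover have "mon_deg mn' \<le> d div q" if mn': "mn' \<in> kys H" for mn'
    proof -
      obtain mn where mn: "mn \<in> kys p" "mn' = dv mn" using keysH mn' by blast
      have "q * mon_deg (dv mn) = (\<Sum>i\<in>kys mn. q * lkp (dv mn) i)"
        using kys_dv[of mn] by (simp add: mon_deg_superset[of "kys mn"] sum_distrib_left)
      also have "\<dots> = mon_deg mn"
        unfolding mon_deg_def using dvd[OF mn(1)] by (intro sum.cong) (auto simp: lk_dv)
      finally have "q * mon_deg mn' \<le> d" using less.prems(3)[OF mn(1)] mn(2) by simp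
      then show ?thesis using q1 by (simp add: less_eq_div_iff_mult_less_eq mult.commute)
    qed
    moreover have "d div q < d" using d0 q1 by simp
    ultimately have "H = 0" using less.IH[of "d div q" H] by blast
    have "lkp p mn0 = 0"
    proof -
      \<comment> \<open>On exponents divisible by \<open>q\<close> the division loses nothing, so no
        terms of \<open>H\<close> merge and each coefficient of \<open>p\<close> can be read off
        from \<open>H\<close>.\<close>
      have inj: "dv mn = dv mn0 \<longleftrightarrow> mn = mn0" if "mn \<in> kys p" for mn
      proof
        assume eq: "dv mn = dv mn0"
        have "lkp mn i = lkp mn0 i" for i
        proof -
          have "lkp mn i div q = lkp mn0 i div q" using eq lk_dv by metis
          then show ?thesis using dvd[OF that, of i] dvd[OF mn0(1), of i] q1 by (metis dvd_div_mult_self)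
        qed
        then show "mn = mn0" by (rule poly_mapping_eqI)
      qed simp
      have "0 = lkp H (dv mn0)" using \<open>H = 0\<close> by simp
      also have "\<dots> = (\<Sum>mn\<in>kys p. if mn = mn0 then rt (lkp p mn) else 0)"
        unfolding H_def lookup_sum by (intro sum.cong) (auto simp: lookup_single when_def inj)
      also have "\<dots> = rt (lkp p mn0)" using mn0(1) by simp
      finally show ?thesis using rt[of "lkp p mn0"] q1 by (simp add: zero_power)
    qed
    then show ?thesis using mn0 by (simp add: in_keys_iff)
  qed
qed

lemma independent:
  assumes "perfect_field TYPE('k)" "vars_in T p" "mpeval h x p = 0"
  shows "p = 0"
  by (rule independent_of_degree[OF assms, of "Max (mon_deg ` kys p)"]) simp

end

section \<open>Higher derivations\<close>

text \<open>Congruence modulo the k-th power of the variable; it replaces the metric of the power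
  series ring.\<close>

definition agree :: "nat \<Rightarrow> 'a::comm_ring_1 fps \<Rightarrow> 'a fps \<Rightarrow> bool" where
  "agree k a b \<longleftrightarrow> (\<forall>i<k. fps_nth a i = fps_nth b i)"

lemma agree_refl [simp]: "agree k a a"
  by (simp add: agree_def)

lemma agree_mono: "agree k a b \<Longrightarrow> l \<le> k \<Longrightarrow> agree l a b"
  by (auto simp: agree_def)

lemma agree_trans: "agree k a b \<Longrightarrow> agree k b c \<Longrightarrow> agree k a c"
  by (auto simp: agree_def)

lemma agree_sym: "agree k a b \<Longrightarrow> agree k b a"
  by (auto simp: agree_def)

lemma agree_add: "agree k a b \<Longrightarrow> agree k c d \<Longrightarrow> agree k (a + c) (b + d)"
  by (auto simp: agree_def)

lemma agree_uminus: "agree k a b \<Longrightarrow> agree k (- a) (- b)"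
  by (auto simp: agree_def)

lemma agree_mult: "agree k a b \<Longrightarrow> agree k c d \<Longrightarrow> agree k (a * c) (b * d)"
  by (auto simp: agree_def fps_mult_nth intro!: sum.cong)

lemma agree_sum: "(\<And>i. i \<in> S \<Longrightarrow> agree k (a i) (b i)) \<Longrightarrow> agree k (sum a S) (sum b S)"
  by (induction S rule: infinite_finite_induct) (auto intro: agree_add)

text \<open>In a coefficient of index at most \<open>k\<close> the two outer terms of the
  convolution vanish, and all others involve only coefficients of index below \<open>k\<close>. This
  gain of one order makes quadratic remainders contracting.\<close>

lemma agree_mult_small:
  assumes "agree k a b" "agree k c d" "fps_nth a 0 = 0" "fps_nth b 0 = 0" "fps_nth c 0 = 0" "fps_nth d 0 = 0"
  shows "agree (Suc k) (a * c) (b * d)"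
  unfolding agree_def
proof (intro allI impI)
  fix i assume i: "i < Suc k"
  have "fps_nth a t * fps_nth c (i - t) = fps_nth b t * fps_nth d (i - t)" if "t \<le> i" for t
  proof (cases "t = 0 \<or> t = i")
    case False
    then show ?thesis using assms(1,2) that i by (auto simp: agree_def)
  qed (use assms in auto)
  then show "fps_nth (a * c) i = fps_nth (b * d) i"
    by (auto simp: fps_mult_nth intro!: sum.cong)
qed

lemma agree_all_imp_eq: "(\<And>k. agree k a b) \<Longrightarrow> a = b"
  by (rule fps_ext) (auto simp: agree_def)

text \<open>Iterate from 0: the \<open>k\<close>-th iterate is already correct modulo the
  \<open>k\<close>-th power of the variable. All components of the family are improved
  simultaneously.\<close>

lemma contraction_fixpoint:
  fixes G :: "('i \<Rightarrow> 'a::comm_ring_1 fps) \<Rightarrow> 'i \<Rightarrow> 'a fps"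
  assumes small: "\<And>e c. (\<And>c. fps_nth (e c) 0 = 0) \<Longrightarrow> fps_nth (G e c) 0 = 0"
    and contr: "\<And>e e' k c. (\<And>c. fps_nth (e c) 0 = 0) \<Longrightarrow> (\<And>c. fps_nth (e' c) 0 = 0) \<Longrightarrow>
      (\<And>c. agree k (e c) (e' c)) \<Longrightarrow> agree (Suc k) (G e c) (G e' c)"
  obtains e where "G e = e" "\<And>c. fps_nth (e c) 0 = 0"
proof -
  define S where "S k = (G ^^ k) (\<lambda>_. 0)" for k
  have S_Suc: "S (Suc k) = G (S k)" for k by (simp add: S_def)
  have S_small: "fps_nth (S k c) 0 = 0" for k c
    by (induction k arbitrary: c) (simp add: S_def, simp add: S_Suc small)
  have step: "agree k (S k c) (S (Suc k) c)" for k c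
  proof (induction k arbitrary: c)
    case (Suc k)
    have "agree (Suc k) (G (S k) c) (G (S (Suc k)) c)"
      by (rule contr[OF S_small S_small Suc])
    then show ?case by (simp only: S_Suc)
  qed (simp add: agree_def)
  have S_agree: "agree k (S k c) (S (k + l) c)" for k l c
  proof (induction l)
    case (Suc l)
    then show ?case using agree_mono[OF step[of "k + l" c], of k] by (auto intro: agree_trans)
  qed simp
  \<comment> \<open>Iterate \<open>k\<close> is reliable only strictly below index \<open>k\<close>,
    so coefficient \<open>i\<close> is taken from iterate \<open>Suc i\<close>.\<close>
  define e where "e c = Abs_fps (\<lambda>i. fps_nth (S (Suc i) c) i)" for c
  have e_S: "agree k (S k c) (e c)" for k c
    unfolding agree_def
  proof (intro allI impI)
    fix i assume "i < k"
    then show "fps_nth (S k c) i = fps_nth (e c) i"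
      using S_agree[of "Suc i" c "k - Suc i"] by (simp add: e_def agree_def)
  qed
  have e_small: "fps_nth (e c) 0 = 0" for c
    using S_small[of 1 c] by (simp add: e_def)
  have "agree k (G e c) (e c)" for k c
  proof -
    have "agree (Suc k) (G (S k) c) (G e c)"
      by (intro contr S_small e_small e_S)
    then have "agree (Suc k) (G e c) (S (Suc k) c)"
      unfolding S_Suc by (rule agree_sym)
    then show ?thesis using e_S[of "Suc k" c] agree_trans agree_mono by (metis le_SucI order_refl)
  qed
  then have "G e = e" by (intro ext agree_all_imp_eq)
  then show thesis using e_small that by blast
qed

lemma kalg_fps_const: "kalg h \<Longrightarrow> kalg (\<lambda>c. fps_const (h c))"
  by (simp add: kalg_def)

text \<open>\<open>Q\<close> is the part of second and higher order of the Taylor expansion at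
  \<open>x\<close> with increment \<open>D * \<eta>\<close>, divided by the square of
  \<open>D\<close>. It is kept as a function on series with just the two properties that the fixed
  point argument asks for.\<close>

definition taylor_remainder ::
  "('k::field \<Rightarrow> 'a::comm_ring_1) \<Rightarrow> nat \<Rightarrow> (nat \<Rightarrow> 'a) \<Rightarrow> 'a \<Rightarrow> 'k mpoly \<Rightarrow> ((nat \<Rightarrow> 'a fps) \<Rightarrow> 'a fps) \<Rightarrow> bool" where
  "taylor_remainder h n x D p Q \<longleftrightarrow>
    (\<forall>\<eta>. mpeval (\<lambda>c. fps_const (h c)) (\<lambda>l. fps_const (x l) + fps_const D * \<eta> l) p =
      fps_const (mpeval h x p) + fps_const D * (\<Sum>l<n. fps_const (mpeval h x (mpderiv l p)) * \<eta> l)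
      + fps_const (D\<^sup>2) * Q \<eta>) \<and>
    (\<forall>\<eta>. (\<forall>l. fps_nth (\<eta> l) 0 = 0) \<longrightarrow> fps_nth (Q \<eta>) 0 = 0) \<and>
    (\<forall>\<eta> \<eta>' k. (\<forall>l. fps_nth (\<eta> l) 0 = 0) \<longrightarrow> (\<forall>l. fps_nth (\<eta>' l) 0 = 0) \<longrightarrow>
      (\<forall>l. agree k (\<eta> l) (\<eta>' l)) \<longrightarrow> agree (Suc k) (Q \<eta>) (Q \<eta>'))"

lemma taylor_remainder_exists:
  fixes h :: "'k::field \<Rightarrow> 'a::comm_ring_1"
  assumes h: "kalg h" and p: "vars_in {..<n} p"
  shows "\<exists>Q. taylor_remainder h n x D p Q"
proof -
  let ?hc = "\<lambda>c. fps_const (h c)"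
  let ?\<xi> = "\<lambda>\<eta> l. fps_const (x l) + fps_const D * \<eta> l"
  define L where "L p \<eta> = (\<Sum>l<n. fps_const (mpeval h x (mpderiv l p)) * \<eta> l)" for p and \<eta> :: "nat \<Rightarrow> 'a fps"
  note simps = mpeval_simps[OF h] mpeval_simps[OF kalg_fps_const[OF h]]
  have L0: "fps_nth (L p \<eta>) 0 = 0" if "\<And>l. fps_nth (\<eta> l) 0 = 0" for p \<eta>
    by (simp add: L_def fps_sum_nth that)
  have L_agree: "agree k (L p \<eta>) (L p \<eta>')" if "\<And>l. agree k (\<eta> l) (\<eta>' l)" for p \<eta> \<eta>' k
    unfolding L_def by (intro agree_sum agree_mult that agree_refl)
  let ?P = "\<lambda>p Q. (\<forall>\<eta>. mpeval ?hc (?\<xi> \<eta>) p = fps_const (mpeval h x p) + fps_const D * L p \<eta> + fps_const (D\<^sup>2) * Q \<eta>) \<and>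
    (\<forall>\<eta>. (\<forall>l. fps_nth (\<eta> l) 0 = 0) \<longrightarrow> fps_nth (Q \<eta>) 0 = 0) \<and>
    (\<forall>\<eta> \<eta>' k. (\<forall>l. fps_nth (\<eta> l) 0 = 0) \<longrightarrow> (\<forall>l. fps_nth (\<eta>' l) 0 = 0) \<longrightarrow>
      (\<forall>l. agree k (\<eta> l) (\<eta>' l)) \<longrightarrow> agree (Suc k) (Q \<eta>) (Q \<eta>'))"
  have "\<exists>Q. ?P p Q"
    using p
  proof (induction p rule: vars_in_induct)
    case (const c)
    have "?P (sing 0 c) (\<lambda>_. 0)" by (simp add: simps L_def)
    then show ?case by (rule exI[of "?P (sing 0 c)"])
  next
    case (var i)
    have "L (mvar i) \<eta> = \<eta> i" for \<eta>
    proof -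
      have "L (mvar i) \<eta> = (\<Sum>l<n. if l = i then \<eta> l else 0)"
        unfolding L_def by (intro sum.cong) (auto simp: mpderiv_mvar simps)
      then show ?thesis using var by simp
    qed
    then have "?P (mvar i) (\<lambda>_. 0)" by (simp add: simps)
    then show ?case by (rule exI[of "?P (mvar i)"])
  next
    case (add a b)
    then obtain A B where "?P a A" "?P b B" by blast
    moreover have "L (a + b) \<eta> = L a \<eta> + L b \<eta>" for \<eta>
      by (simp add: L_def mpderiv_add simps distrib_right sum.distrib flip: fps_const_add)
    ultimately have "?P (a + b) (\<lambda>\<eta>. A \<eta> + B \<eta>)"
      by (auto simp: simps algebra_simps intro!: agree_add simp flip: fps_const_add)
    then show ?case by (rule exI[of "?P (a + b)"])
  next
    case (mult a b)
    then obtain A B where A: "?P a A" and B: "?P b B" by blast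
    let ?a = "fps_const (mpeval h x a)" and ?b = "fps_const (mpeval h x b)"
    have L: "L (a * b) \<eta> = ?a * L b \<eta> + ?b * L a \<eta>" for \<eta>
      by (simp add: L_def mpderiv_mult simps distrib_right distrib_left sum.distrib sum_distrib_left mult_ac
          flip: fps_const_add fps_const_mult)
    \<comment> \<open>All terms of the product of the two expansions that contain at least two
      factors \<open>D\<close>, with two of them removed.\<close>
    let ?Q = "\<lambda>\<eta>. L a \<eta> * L b \<eta> + ?a * B \<eta> + ?b * A \<eta> +
      fps_const D * (L a \<eta> * B \<eta> + L b \<eta> * A \<eta>) + fps_const (D\<^sup>2) * (A \<eta> * B \<eta>)"
    have "?P (a * b) ?Q"
    proof (intro conjI allI impI)
      fix \<eta>
      have 1: "mpeval ?hc (?\<xi> \<eta>) a = ?a + fps_const D * L a \<eta> + fps_const (D\<^sup>2) * A \<eta>"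
        "mpeval ?hc (?\<xi> \<eta>) b = ?b + fps_const D * L b \<eta> + fps_const (D\<^sup>2) * B \<eta>"
        using A B by blast+
      have "fps_const (D\<^sup>2) = fps_const D * fps_const D" by (simp add: power2_eq_square)
      then show "mpeval ?hc (?\<xi> \<eta>) (a * b) =
          fps_const (mpeval h x (a * b)) + fps_const D * L (a * b) \<eta> + fps_const (D\<^sup>2) * ?Q \<eta>"
        by (simp add: simps 1 L algebra_simps flip: fps_const_mult)
    next
      fix \<eta> :: "nat \<Rightarrow> 'a fps" assume "\<forall>l. fps_nth (\<eta> l) 0 = 0"
      then show "fps_nth (?Q \<eta>) 0 = 0" using A B L0 by simp
    next
      fix \<eta> \<eta>' :: "nat \<Rightarrow> 'a fps" and k
      assume *: "\<forall>l. fps_nth (\<eta> l) 0 = 0" "\<forall>l. fps_nth (\<eta>' l) 0 = 0" "\<forall>l. agree k (\<eta> l) (\<eta>' l)"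
      then have Q: "agree (Suc k) (A \<eta>) (A \<eta>')" "agree (Suc k) (B \<eta>) (B \<eta>')"
        and z: "fps_nth (A \<eta>) 0 = 0" "fps_nth (A \<eta>') 0 = 0" "fps_nth (B \<eta>) 0 = 0" "fps_nth (B \<eta>') 0 = 0"
        using A B by blast+
      have Q': "agree k (A \<eta>) (A \<eta>')" "agree k (B \<eta>) (B \<eta>')" using Q agree_mono by (metis le_SucI order_refl)+
      show "agree (Suc k) (?Q \<eta>) (?Q \<eta>')"
        by (intro agree_add agree_mult[of "Suc k" "fps_const _"] agree_mult_small L_agree agree_refl Q Q' z L0)
          (use * in auto)
    qed
    then show ?case by (rule exI[of "?P (a * b)"])
  qed
  then show ?thesis unfolding L_def taylor_remainder_def .
qed

lemma fps_const_sum: "fps_const (sum g S) = (\<Sum>i\<in>S. fps_const (g i))"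
  by (induction S rule: infinite_finite_induct) (auto simp flip: fps_const_add)

lemma fps_dvd_1I:
  fixes a :: "'a::comm_ring_1 fps"
  assumes "fps_nth a 0 dvd 1" shows "a dvd 1"
proof -
  obtain y where "1 = fps_nth a 0 * y" using assms by (elim dvdE)
  then have "y * fps_nth a 0 = 1" by (simp add: mult.commute)
  then have "fps_left_inverse a y * a = 1" by (rule fps_left_inverse)
  then show ?thesis by (metis dvd_triv_right)
qed

context jacobi_chart
begin

abbreviation hc where "hc \<equiv> \<lambda>c. fps_const (h c)"

text \<open>With increment \<open>\<Delta> * \<eta>\<close> the equations become \<Delta> J \<eta> +
  \<Delta>^2 Q(\<eta>) = 0. Prescribing \<Delta> X for \<eta> at \<open>j\<close> and 0 on the rest
  of \<open>T\<close> leaves, after division by \<Delta>, the Jacobi block applied to the unknowns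
  on one side and a multiple of \<Delta> on the other. The adjugate turns this into a fixed point
  equation without denominators, contracting because \<open>Q\<close> is.\<close>

lemma tougeron_lift:
  assumes j: "j \<in> T"
  obtains \<xi> where "\<And>i. i < r \<Longrightarrow> mpeval hc \<xi> (f (ri i)) = 0" "\<And>l. fps_nth (\<xi> l) 0 = x l"
    "\<xi> j = fps_const (x j) + fps_const (\<Delta>\<^sup>2) * fps_X" "\<And>l. l \<in> T \<Longrightarrow> l \<noteq> j \<Longrightarrow> \<xi> l = fps_const (x l)"
proof -
  have jn: "j < n" "j \<notin> ci ` {..<r}" using j by (auto simp: T_def)
  have "\<exists>Q. i < r \<longrightarrow> taylor_remainder h n x \<Delta> (f (ri i)) Q" for i
  proof (cases "i < r")
    case True
    then have "vars_in {..<n} (f (ri i))" using ri(2) by (auto intro: f_vars)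
    from taylor_remainder_exists[OF alg this, of x \<Delta>] show ?thesis by blast
  qed auto
  then have "\<exists>Q. \<forall>i. i < r \<longrightarrow> taylor_remainder h n x \<Delta> (f (ri i)) (Q i)" by (intro choice allI)
  then obtain Q where "\<And>i. i < r \<Longrightarrow> taylor_remainder h n x \<Delta> (f (ri i)) (Q i)" by blast
  note Q = this[unfolded taylor_remainder_def]
  obtain B where B: "\<And>i k. i < r \<Longrightarrow> k < r \<Longrightarrow> (\<Sum>c<r. J (ri i) (ci c) * B c k) = (if i = k then \<Delta> else 0)"
    by (rule adjugate_exists[of r "\<lambda>i c. J (ri i) (ci c)"]) (unfold \<Delta>_def, blast)
  \<comment> \<open>The increment in units of \<Delta>: prescribed on \<open>T\<close>, and equal to
    the unknown series \<open>e\<close> on the columns of the chart.\<close>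
  define as where "as e l = (if l = j then fps_const \<Delta> * fps_X
    else if l \<in> ci ` {..<r} then e (the_inv_into {..<r} ci l) else 0)" for e :: "nat \<Rightarrow> 'a fps" and l
  have as_j: "as e j = fps_const \<Delta> * fps_X" for e by (simp add: as_def)
  have as_ci: "as e (ci c) = e c" if "c < r" for e c
    using that jn by (auto simp: as_def the_inv_into_f_f[OF ci(1)])
  have as_T: "as e l = 0" if "l \<in> T" "l \<noteq> j" for e l
    using that by (auto simp: as_def T_def)
  \<comment> \<open>\<open>w\<close> is the right-hand side with its factor \<Delta> removed. For
    \<open>e = G e\<close>, applying the Jacobi block to \<open>e\<close> restores this factor
    through the adjugate identity.\<close>
  define w where "w e i = fps_const (J (ri i) j) * fps_X + Q i (as e)" for e i
  define G where "G e c = - (\<Sum>k<r. fps_const (B c k) * w e k)" for e c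
  have as_small: "fps_nth (as e l) 0 = 0" if "\<And>c. fps_nth (e c) 0 = 0" for e l
    using that by (auto simp: as_def)
  obtain e where e: "G e = e" "\<And>c. fps_nth (e c) 0 = 0"
  proof (rule contraction_fixpoint[of G])
    fix e :: "nat \<Rightarrow> 'a fps" and c
    assume "\<And>c. fps_nth (e c) 0 = 0"
    then have "\<forall>l. fps_nth (as e l) 0 = 0" using as_small by blast
    then have "fps_nth (w e k) 0 = 0" if "k < r" for k
      using Q[OF that] by (auto simp: w_def)
    then show "fps_nth (G e c) 0 = 0"
      by (simp add: G_def fps_sum_nth)
  next
    fix e e' :: "nat \<Rightarrow> 'a fps" and k c
    assume *: "\<And>c. fps_nth (e c) 0 = 0" "\<And>c. fps_nth (e' c) 0 = 0" "\<And>c. agree k (e c) (e' c)"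
    have "agree k (as e l) (as e' l)" for l using *(3) by (auto simp: as_def)
    moreover have "\<forall>l. fps_nth (as e l) 0 = 0" "\<forall>l. fps_nth (as e' l) 0 = 0" using as_small *(1,2) by blast+
    ultimately have "agree (Suc k) (Q i (as e)) (Q i (as e'))" if "i < r" for i
      using Q[OF that] by blast
    then show "agree (Suc k) (G e c) (G e' c)"
      unfolding G_def w_def by (intro agree_uminus agree_sum agree_mult agree_add agree_refl) auto
  qed blast
  define \<xi> where "\<xi> l = fps_const (x l) + fps_const \<Delta> * as e l" for l
  show thesis
  proof
    show "fps_nth (\<xi> l) 0 = x l" for l using as_small[OF e(2)] by (simp add: \<xi>_def)
    show "\<xi> j = fps_const (x j) + fps_const (\<Delta>\<^sup>2) * fps_X"
      by (simp add: \<xi>_def as_j power2_eq_square mult.assoc flip: fps_const_mult)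
    show "\<xi> l = fps_const (x l)" if "l \<in> T" "l \<noteq> j" for l using as_T[OF that] by (simp add: \<xi>_def)
    show "mpeval hc \<xi> (f (ri i)) = 0" if i: "i < r" for i
    proof -
      have "(\<Sum>l<n. fps_const (J (ri i) l) * as e l) = (\<Sum>l\<in>insert j (ci ` {..<r}). fps_const (J (ri i) l) * as e l)"
        by (rule sum.mono_neutral_right) (use ci(2) jn in \<open>auto simp: as_def\<close>)
      also have "\<dots> = fps_const (J (ri i) j) * as e j + (\<Sum>c<r. fps_const (J (ri i) (ci c)) * as e (ci c))"
        using jn by (simp add: sum.reindex[OF ci(1)])
      also have "(\<Sum>c<r. fps_const (J (ri i) (ci c)) * as e (ci c)) = (\<Sum>c<r. fps_const (J (ri i) (ci c)) * G e c)"
        by (intro sum.cong) (auto simp: as_ci e(1))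
      also have "\<dots> = - (\<Sum>c<r. \<Sum>k<r. fps_const (J (ri i) (ci c) * B c k) * w e k)"
        by (simp add: G_def sum_distrib_left sum_negf mult.assoc flip: fps_const_mult)
      also have "(\<Sum>c<r. \<Sum>k<r. fps_const (J (ri i) (ci c) * B c k) * w e k) =
          (\<Sum>k<r. \<Sum>c<r. fps_const (J (ri i) (ci c) * B c k) * w e k)"
        by (rule sum.swap)
      also have "\<dots> = (\<Sum>k<r. fps_const (\<Sum>c<r. J (ri i) (ci c) * B c k) * w e k)"
        by (simp add: sum_distrib_right fps_const_sum)
      also have "\<dots> = (\<Sum>k<r. if i = k then fps_const \<Delta> * w e k else 0)"
        using i by (intro sum.cong) (auto simp: B)
      also have "\<dots> = fps_const \<Delta> * w e i" using i by simp
      finally have lin: "(\<Sum>l<n. fps_const (J (ri i) l) * as e l) = - (fps_const \<Delta> * Q i (as e))"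
        by (simp add: as_j w_def algebra_simps)
      have "mpeval hc \<xi> (f (ri i)) = fps_const (mpeval h x (f (ri i)))
          + fps_const \<Delta> * (\<Sum>l<n. fps_const (J (ri i) l) * as e l) + fps_const (\<Delta>\<^sup>2) * Q i (as e)"
        unfolding \<xi>_def using Q[OF i] by blast
      then show ?thesis
        unfolding lin using f_zero[of "ri i"] i ri(2)
        by (simp add: power2_eq_square mult.assoc image_subset_iff flip: fps_const_mult)
    qed
  qed
qed

text \<open>The target domain \<open>'b\<close> is arbitrary because the lemma is needed for A and
  for the power series over A. The argument over a field applies in its fraction field, and the
  resulting equation descends since it involves only values of polynomials.\<close>

lemma chart_algebraic:
  fixes H :: "'k \<Rightarrow> 'b::idom"
  assumes H: "kalg H"
    and f0: "\<And>i. i < r \<Longrightarrow> mpeval H z (f (ri i)) = 0"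
    and det: "ndet r (\<lambda>i j. mpeval H z (mpderiv (ci j) (f (ri i)))) \<noteq> 0"
    and p: "vars_in {..<n} p" "mpeval H z p \<noteq> 0"
  obtains w s where "vars_in {..<n} w" "vars_in T s" "mpeval H z p * mpeval H z w = mpeval H z s" "mpeval H z s \<noteq> 0"
proof -
  let ?g = "\<lambda>a. Fraction_Field.Fract a 1 :: 'b fract"
  let ?H = "\<lambda>c. ?g (H c)"
  let ?z = "\<lambda>l. ?g (z l)"
  have g: "?g 1 = 1" "\<And>a b. ?g (a + b) = ?g a + ?g b" "\<And>a b. ?g (a * b) = ?g a * ?g b"
    by (simp_all add: One_fract_def)
  have g_inj: "?g a = ?g b \<longleftrightarrow> a = b" for a b by (simp add: eq_fract)
  have g0: "?g a = 0 \<longleftrightarrow> a = 0" for a using g_inj[of a 0] by (simp add: Zero_fract_def)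
  have kH: "kalg ?H" unfolding kalg_def using kalg_simps[OF H] g by simp
  have ev: "mpeval ?H ?z q = ?g (mpeval H z q)" for q
    by (rule sym, rule mpeval_hom[OF H kH]) (use g in auto)
  have 1: "ndet r (\<lambda>i j. mpeval ?H ?z (mpderiv (ci j) (f (ri i)))) \<noteq> 0"
    unfolding ev using ndet_hom[of ?g, OF g] det g0 by metis
  have 2: "mpeval ?H ?z p \<in> poly_values ?H ?z {..<n}" "mpeval ?H ?z p \<noteq> 0"
    using p by (auto simp: poly_values_def ev g0)
  have 3: "vars_in {..<n} (f (ri i))" if "i < r" for i
    using ri(2) that by (auto intro: f_vars)
  have 4: "mpeval ?H ?z (f (ri i)) = 0" if "i < r" for i
    using f0[OF that] by (simp add: ev g0)
  obtain w' where w': "w' \<in> poly_values ?H ?z {..<n}"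
    "mpeval ?H ?z p * w' \<in> poly_values ?H ?z ({..<n} - ci ` {..<r})" "mpeval ?H ?z p * w' \<noteq> 0"
    by (rule jacobian_algebraic[OF kH 3 4 ci 1 2])
  obtain w where w: "w' = mpeval ?H ?z w" "vars_in {..<n} w" using w'(1) unfolding poly_values_def by blast
  obtain s where s: "mpeval ?H ?z p * w' = mpeval ?H ?z s" "vars_in T s"
    using w'(2) unfolding poly_values_def T_def by blast
  have "?g (mpeval H z p * mpeval H z w) = ?g (mpeval H z s)"
    using s(1) unfolding w(1) ev g(3) .
  then have "mpeval H z p * mpeval H z w = mpeval H z s" by (simp only: g_inj)
  moreover have "mpeval H z s \<noteq> 0" using w'(3) s(1) ev g0 by metis
  ultimately show thesis using that w(2) s(2) by blast
qed

text \<open>If the value at \<xi> were nonzero, some multiple of it would be the nonzero value of a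
  polynomial \<open>s\<close> in the variables of \<open>T\<close>. Comparing constant coefficients
  shows that \<open>s\<close> vanishes at \<open>x\<close>, so \<open>s\<close> is zero by
  independence.\<close>

lemma lift_kills_kernel:
  assumes perfect: "perfect_field TYPE('k)"
    and \<xi>: "\<And>i. i < r \<Longrightarrow> mpeval hc \<xi> (f (ri i)) = 0" "\<And>l. fps_nth (\<xi> l) 0 = x l"
    and p: "vars_in {..<n} p" "mpeval h x p = 0"
  shows "mpeval hc \<xi> p = 0"
proof (rule ccontr)
  assume nz: "mpeval hc \<xi> p \<noteq> 0"
  have hc: "kalg hc" by (rule kalg_fps_const[OF alg])
  have ev0: "fps_nth (mpeval hc \<xi> q) 0 = mpeval h x q" for q
    using mpeval_hom[OF hc alg, of "\<lambda>a. fps_nth a 0"] by (simp add: \<xi>(2))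
  have "fps_nth (ndet r (\<lambda>i j. mpeval hc \<xi> (mpderiv (ci j) (f (ri i))))) 0 = \<Delta>"
    unfolding \<Delta>_def by (subst ndet_hom) (simp_all add: ev0)
  then have "ndet r (\<lambda>i j. mpeval hc \<xi> (mpderiv (ci j) (f (ri i)))) \<noteq> 0"
    using \<Delta>_nonzero by auto
  then obtain w s where ws: "vars_in T s" "mpeval hc \<xi> p * mpeval hc \<xi> w = mpeval hc \<xi> s" "mpeval hc \<xi> s \<noteq> 0"
    using chart_algebraic[OF hc \<xi>(1) _ p(1) nz] by metis
  have "mpeval h x s = mpeval h x p * mpeval h x w"
    using ev0 ws(2) by (metis fps_mult_nth_0)
  then have "s = 0" using independent[OF perfect ws(1)] p(2) by simp
  then show False using ws(3) by simp
qed

text \<open>Evaluation at \<xi> factors through the image of the polynomial ring in A because it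
  kills all relations. It extends to fractions because a denominator is a unit in A, so that its
  lift has an invertible constant coefficient and is itself invertible.\<close>

lemma higher_derivation:
  assumes perfect: "perfect_field TYPE('k)" and j: "j \<in> T"
  obtains \<tau> where "\<And>a b. \<tau> (a + b) = \<tau> a + \<tau> b" "\<And>a b. \<tau> (a * b) = \<tau> a * \<tau> b"
    "\<And>c. \<tau> (h c) = fps_const (h c)" "\<And>a. fps_nth (\<tau> a) 0 = a"
    "\<tau> (x j) = fps_const (x j) + fps_const (\<Delta>\<^sup>2) * fps_X" "\<And>l. l \<in> T \<Longrightarrow> l \<noteq> j \<Longrightarrow> \<tau> (x l) = fps_const (x l)"
proof -
  obtain \<xi> where \<xi>: "\<And>i. i < r \<Longrightarrow> mpeval hc \<xi> (f (ri i)) = 0" "\<And>l. fps_nth (\<xi> l) 0 = x l"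
    "\<xi> j = fps_const (x j) + fps_const (\<Delta>\<^sup>2) * fps_X" "\<And>l. l \<in> T \<Longrightarrow> l \<noteq> j \<Longrightarrow> \<xi> l = fps_const (x l)"
    using tougeron_lift[OF j] by metis
  have hc: "kalg hc" by (rule kalg_fps_const[OF alg])
  define \<psi> where "\<psi> = mpeval hc \<xi>"
  note \<psi>s = mpeval_simps[OF hc, of \<xi>, folded \<psi>_def]
  have \<psi>0: "fps_nth (\<psi> q) 0 = mpeval h x q" for q
    unfolding \<psi>_def using mpeval_hom[OF hc alg, of "\<lambda>a. fps_nth a 0"] by (simp add: \<xi>(2))
  define frac where "frac a p s \<longleftrightarrow> vars_in {..<n} p \<and> vars_in {..<n} s \<and> mpeval h x s dvd 1 \<and>
    a * mpeval h x s = mpeval h x p" for a p s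
  have frac_ex: "\<exists>p s. frac a p s" for a
    using fraction_form[of a] unfolding frac_def by metis
  have nz: "\<psi> s \<noteq> 0" if "frac a p s" for a p s
  proof
    assume "\<psi> s = 0"
    then have "mpeval h x s = 0" using \<psi>0[of s] by simp
    then show False using that by (auto simp: frac_def)
  qed
  have cross: "\<psi> p * \<psi> s' = \<psi> p' * \<psi> s" if "frac a p s" "frac a p' s'" for a p s p' s'
  proof -
    have "vars_in {..<n} (p * s' - p' * s)" using that by (auto simp: frac_def intro: vars_in_diff vars_in_mult)
    moreover have "mpeval h x (p * s' - p' * s) = 0"
    proof -
      have *: "mpeval h x p = a * mpeval h x s" "mpeval h x p' = a * mpeval h x s'"
        using that by (auto simp: frac_def)
      show ?thesis by (simp add: ev_simps *)
    qed
    ultimately have "\<psi> (p * s' - p' * s) = 0"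
      unfolding \<psi>_def by (intro lift_kills_kernel[OF perfect \<xi>(1,2)])
    then show ?thesis by (simp add: \<psi>s)
  qed
  define \<tau> where "\<tau> a = (SOME t. \<exists>p s. frac a p s \<and> t * \<psi> s = \<psi> p)" for a
  have \<tau>: "\<tau> a * \<psi> s = \<psi> p" if fr: "frac a p s" for a p s
  proof -
    have "\<psi> s dvd 1" using fr by (intro fps_dvd_1I) (simp add: \<psi>0 frac_def)
    then obtain y where y: "1 = \<psi> s * y" by (elim dvdE)
    have "\<psi> p * y * \<psi> s = \<psi> p" using y by (simp add: mult_ac)
    then have "\<exists>t p s. frac a p s \<and> t * \<psi> s = \<psi> p" using fr by blast
    from someI_ex[OF this] obtain p' s' where ps: "frac a p' s'" "\<tau> a * \<psi> s' = \<psi> p'"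
      unfolding \<tau>_def by blast
    have "\<tau> a * \<psi> s * \<psi> s' = \<psi> p * \<psi> s'"
      using ps(2) cross[OF fr ps(1)] by (simp add: mult_ac)
    then show ?thesis using nz[OF ps(1)] by simp
  qed
  have unit_mult: "u * v dvd 1" if "u dvd 1" "v dvd 1" for u v :: 'a
    using mult_dvd_mono[OF that] by simp
  have \<tau>_poly: "\<tau> (mpeval h x p) = \<psi> p" if "vars_in {..<n} p" for p
  proof -
    have "frac (mpeval h x p) p 1"
      using that vars_in_const[of "{..<n}" "1::'k"] by (simp add: frac_def ev_simps)
    from \<tau>[OF this] show ?thesis by (simp add: \<psi>s)
  qed
  show thesis
  proof
    fix a b
    obtain p s p' s' where fr: "frac a p s" "frac b p' s'" using frac_ex by meson
    note eq = \<tau>[OF fr(1)] \<tau>[OF fr(2)]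
    have e1: "mpeval h x p = a * mpeval h x s" "mpeval h x p' = b * mpeval h x s'" using fr by (auto simp: frac_def)
    have "frac (a + b) (p * s' + p' * s) (s * s')"
      using fr unit_mult by (auto simp: frac_def ev_simps e1 algebra_simps intro: vars_in_add vars_in_mult)
    from \<tau>[OF this] have "\<tau> (a + b) * (\<psi> s * \<psi> s') = (\<tau> a + \<tau> b) * (\<psi> s * \<psi> s')"
      by (simp add: \<psi>s eq[symmetric] algebra_simps)
    then show "\<tau> (a + b) = \<tau> a + \<tau> b" using nz[OF fr(1)] nz[OF fr(2)] by simp
    have "frac (a * b) (p * p') (s * s')"
      using fr unit_mult by (auto simp: frac_def ev_simps e1 algebra_simps intro: vars_in_mult)
    from \<tau>[OF this] have "\<tau> (a * b) * (\<psi> s * \<psi> s') = (\<tau> a * \<tau> b) * (\<psi> s * \<psi> s')"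
      by (simp add: \<psi>s eq[symmetric] algebra_simps)
    then show "\<tau> (a * b) = \<tau> a * \<tau> b" using nz[OF fr(1)] nz[OF fr(2)] by simp
  next
    show "\<tau> (h c) = fps_const (h c)" for c
      using \<tau>_poly[of "sing 0 c"] by (simp add: ev_simps \<psi>s)
    show "fps_nth (\<tau> a) 0 = a" for a
    proof -
      obtain p s where fr: "frac a p s" using frac_ex by meson
      from \<tau>[OF fr] have "fps_nth (\<tau> a) 0 * mpeval h x s = a * mpeval h x s"
        using \<psi>0 fr by (metis fps_mult_nth_0 frac_def)
      moreover have "mpeval h x s \<noteq> 0" using fr by (auto simp: frac_def)
      ultimately show ?thesis by simp
    qed
    have "\<tau> (x l) = \<xi> l" if "l < n" for l
      using \<tau>_poly[of "mvar l"] that by (simp add: ev_simps \<psi>s vars_in_mvar)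
    then show "\<tau> (x j) = fps_const (x j) + fps_const (\<Delta>\<^sup>2) * fps_X"
      "\<And>l. l \<in> T \<Longrightarrow> l \<noteq> j \<Longrightarrow> \<tau> (x l) = fps_const (x l)"
      using \<xi>(3,4) j by (auto simp: T_def)
  qed
qed

end

section \<open>Differential operators\<close>

text \<open>A common setting for operators on A, where the carrier is the whole type, and on a
  localization of A, where it is a subring of the fraction field. Operators vanish outside the
  carrier, so that equality of functions is equality of operators.\<close>

locale subalgebra_set =
  fixes C :: "'b::comm_ring_1 set" and h :: "'k::field \<Rightarrow> 'b"
  assumes one: "1 \<in> C" and zero: "0 \<in> C" and add: "\<And>a b. a \<in> C \<Longrightarrow> b \<in> C \<Longrightarrow> a + b \<in> C"
    and mult: "\<And>a b. a \<in> C \<Longrightarrow> b \<in> C \<Longrightarrow> a * b \<in> C" and uminus: "\<And>a. a \<in> C \<Longrightarrow> - a \<in> C"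
    and scalar: "\<And>c. h c \<in> C"
begin

lemma diff: "a \<in> C \<Longrightarrow> b \<in> C \<Longrightarrow> a - b \<in> C"
  using add[of a "- b"] uminus[of b] by simp

lemma klin_onD:
  assumes "klin_on C h u"
  shows "a \<in> C \<Longrightarrow> u a \<in> C" "a \<in> C \<Longrightarrow> b \<in> C \<Longrightarrow> u (a + b) = u a + u b"
    "a \<in> C \<Longrightarrow> u (h c * a) = h c * u a" "a \<notin> C \<Longrightarrow> u a = 0" "u 0 = 0"
    "a \<in> C \<Longrightarrow> u (- a) = - u a" "a \<in> C \<Longrightarrow> b \<in> C \<Longrightarrow> u (a - b) = u a - u b"
proof -
  show *: "a \<in> C \<Longrightarrow> u a \<in> C" "a \<in> C \<Longrightarrow> b \<in> C \<Longrightarrow> u (a + b) = u a + u b"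
    "a \<in> C \<Longrightarrow> u (h c * a) = h c * u a" "a \<notin> C \<Longrightarrow> u a = 0" for a b c
    using assms by (auto simp: klin_on_def)
  show 0: "u 0 = 0" using *(2)[of 0 0] zero by simp
  show neg: "u (- a) = - u a" if "a \<in> C" for a
    using *(2)[of a "- a"] uminus that 0 by (simp add: eq_neg_iff_add_eq_0 add.commute)
  show "u (a - b) = u a - u b" if "a \<in> C" "b \<in> C"
    using *(2)[of a "- b"] uminus that neg by simp
qed

lemma Dop_klin: "u \<in> Dop_on C h i \<Longrightarrow> klin_on C h u"
  by (cases i) auto

lemmas DopD = klin_onD[OF Dop_klin]

lemma Dop_commut: "u \<in> Dop_on C h (Suc i) \<Longrightarrow> r \<in> C \<Longrightarrow> commut_on C r u \<in> Dop_on C h i"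
  by simp

lemma Dop_0_commut: "u \<in> Dop_on C h 0 \<Longrightarrow> r \<in> C \<Longrightarrow> commut_on C r u = (\<lambda>_. 0)"
  by simp

lemma Dop_zero: "(\<lambda>_. 0) \<in> Dop_on C h i"
proof (induction i)
  case (Suc i)
  have "commut_on C r (\<lambda>_. 0) = (\<lambda>_. 0)" for r by (simp add: commut_on_def fun_eq_iff)
  with Suc show ?case by (simp add: klin_on_def zero)
qed (simp add: klin_on_def commut_on_def zero fun_eq_iff)

lemma Dop_add:
  "u \<in> Dop_on C h i \<Longrightarrow> v \<in> Dop_on C h i \<Longrightarrow> (\<lambda>y. u y + v y) \<in> Dop_on C h i"
proof (induction i arbitrary: u v)
  case 0
  have "klin_on C h (\<lambda>y. u y + v y)"
    using Dop_klin[OF 0(1)] Dop_klin[OF 0(2)] by (auto simp: klin_on_def algebra_simps add)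
  moreover have "commut_on C r (\<lambda>y. u y + v y) = (\<lambda>_. 0)" if "r \<in> C" for r
  proof
    fix a
    show "commut_on C r (\<lambda>y. u y + v y) a = 0"
      using fun_cong[OF Dop_0_commut[OF 0(1) that], of a] fun_cong[OF Dop_0_commut[OF 0(2) that], of a]
      by (auto simp: commut_on_def algebra_simps split: if_splits)
  qed
  ultimately show ?case by simp
next
  case (Suc i)
  have "klin_on C h (\<lambda>y. u y + v y)"
    using Dop_klin[OF Suc(2)] Dop_klin[OF Suc(3)] by (auto simp: klin_on_def algebra_simps add)
  moreover have "commut_on C r (\<lambda>y. u y + v y) \<in> Dop_on C h i" if "r \<in> C" for r
  proof -
    have "commut_on C r (\<lambda>y. u y + v y) = (\<lambda>y. commut_on C r u y + commut_on C r v y)"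
      by (auto simp: commut_on_def algebra_simps)
    then show ?thesis using Suc.IH Dop_commut[OF Suc(2) that] Dop_commut[OF Suc(3) that] by simp
  qed
  ultimately show ?case by simp
qed

lemma Dop_Suc: "u \<in> Dop_on C h i \<Longrightarrow> u \<in> Dop_on C h (Suc i)"
proof (induction i arbitrary: u)
  case 0
  then show ?case using Dop_zero[of 0] by auto
qed auto

lemma Dop_mono: "i \<le> j \<Longrightarrow> u \<in> Dop_on C h i \<Longrightarrow> u \<in> Dop_on C h j"
  by (induction j rule: dec_induct) (use Dop_Suc in auto)

lemma Dop_mult_op: "c \<in> C \<Longrightarrow> (\<lambda>y. if y \<in> C then c * y else 0) \<in> Dop_on C h 0"
  by (auto simp: klin_on_def commut_on_def algebra_simps mult add scalar)

text \<open>The commutator with \<open>r\<close> is a derivation for composition, so the commutator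
  of \<open>u \<circ> v\<close> is a sum of two compositions of smaller total order. A factor of
  order 0 contributes nothing, since its commutators vanish.\<close>

lemma Dop_comp:
  "u \<in> Dop_on C h i \<Longrightarrow> v \<in> Dop_on C h j \<Longrightarrow> u \<circ> v \<in> Dop_on C h (i + j)"
proof (induction "i + j" arbitrary: i j u v rule: less_induct)
  case less
  have klin: "klin_on C h (u \<circ> v)"
    using Dop_klin[OF less(2)] Dop_klin[OF less(3)] DopD(5)[OF less(2)] by (auto simp: klin_on_def)
  have comm: "commut_on C r (u \<circ> v) = (\<lambda>y. (commut_on C r u \<circ> v) y + (u \<circ> commut_on C r v) y)" if r: "r \<in> C" for r
  proof
    fix y
    show "commut_on C r (u \<circ> v) y = (commut_on C r u \<circ> v) y + (u \<circ> commut_on C r v) y"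
    proof (cases "y \<in> C")
      case True
      then have "v y \<in> C" "r * v y \<in> C" "v (r * y) \<in> C"
        using DopD(1)[OF less(3)] mult r by auto
      then show ?thesis using True DopD(7)[OF less(2)] by (simp add: commut_on_def)
    next
      case False
      then show ?thesis using DopD(4,5)[OF less(3)] DopD(5)[OF less(2)] r mult zero
        by (simp add: commut_on_def)
    qed
  qed
  show ?case
  proof (cases "i + j")
    case 0
    then have ij: "i = 0" "j = 0" by auto
    have "commut_on C r (u \<circ> v) = (\<lambda>_. 0)" if "r \<in> C" for r
      unfolding comm[OF that] Dop_0_commut[OF less(2)[unfolded ij] that] Dop_0_commut[OF less(3)[unfolded ij] that]
      using DopD(5)[OF less(2)] by simp
    then show ?thesis using klin ij by simp
  next
    case (Suc k)
    have "commut_on C r (u \<circ> v) \<in> Dop_on C h k" if r: "r \<in> C" for r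
      unfolding comm[OF r]
    proof (rule Dop_add)
      show "commut_on C r u \<circ> v \<in> Dop_on C h k"
      proof (cases i)
        case 0
        have "commut_on C r u = (\<lambda>_. 0)" by (rule Dop_0_commut[OF less(2)[unfolded 0] r])
        then have "commut_on C r u \<circ> v = (\<lambda>_. 0)" by (simp add: comp_def)
        then show ?thesis using Dop_zero by simp
      next
        case i: (Suc i')
        then have "commut_on C r u \<circ> v \<in> Dop_on C h (i' + j)"
          using Dop_commut[OF less(2)[unfolded i] r] less(3) by (intro less(1)) (simp_all add: i)
        then show ?thesis using Suc i by simp
      qed
      show "u \<circ> commut_on C r v \<in> Dop_on C h k"
      proof (cases j)
        case 0
        have "commut_on C r v = (\<lambda>_. 0)" by (rule Dop_0_commut[OF less(3)[unfolded 0] r])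
        then have "u \<circ> commut_on C r v = (\<lambda>_. 0)" using DopD(5)[OF less(2)] by (simp add: comp_def)
        then show ?thesis using Dop_zero by simp
      next
        case j: (Suc j')
        then have "u \<circ> commut_on C r v \<in> Dop_on C h (i + j')"
          using Dop_commut[OF less(3)[unfolded j] r] less(2) by (intro less(1)) (simp_all add: j)
        then show ?thesis using Suc j by simp
      qed
    qed
    then show ?thesis using klin Suc by simp
  qed
qed

lemma Dop_scale:
  assumes "c \<in> C" "u \<in> Dop_on C h i" shows "(\<lambda>y. c * u y) \<in> Dop_on C h i"
proof -
  have "(\<lambda>y. c * u y) = (\<lambda>y. if y \<in> C then c * y else 0) \<circ> u"
  proof
    fix y show "c * u y = ((\<lambda>y. if y \<in> C then c * y else 0) \<circ> u) y"
      using DopD(1,4)[OF assms(2), of y] zero by (cases "y \<in> C") auto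
  qed
  then show ?thesis using Dop_comp[OF Dop_mult_op[OF assms(1)] assms(2)] by simp
qed

lemma Dop_uminus: "u \<in> Dop_on C h i \<Longrightarrow> (\<lambda>y. - u y) \<in> Dop_on C h i"
  using Dop_scale[OF uminus[OF one]] by simp

lemma Dop_diff: "u \<in> Dop_on C h i \<Longrightarrow> v \<in> Dop_on C h i \<Longrightarrow> (\<lambda>y. u y - v y) \<in> Dop_on C h i"
  using Dop_add[OF _ Dop_uminus, of u i v] by simp

lemma Dop_sum: "(\<And>k. k \<in> S \<Longrightarrow> u k \<in> Dop_on C h i) \<Longrightarrow> (\<lambda>y. \<Sum>k\<in>S. u k y) \<in> Dop_on C h i"
  by (induction S rule: infinite_finite_induct) (auto simp: Dop_zero intro: Dop_add)

end

interpretation whole: subalgebra_set UNIV h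
  by unfold_locales auto

lemma mult_op_in_Dop: "mult_op a \<in> Dop h i"
  using whole.Dop_mono[OF _ whole.Dop_mult_op[of a], of i] by (simp add: mult_op_def)

lemma Dop_subset_DA: "u \<in> Dop h i \<Longrightarrow> u \<in> DA h"
  by (auto simp: D_on_def)

lemma DA_Dop: assumes "u \<in> DA h" obtains i where "u \<in> Dop h i"
  using assms by (auto simp: D_on_def)

lemma subalg_DA: "subalg_containing_A h (DA h)"
  unfolding subalg_containing_A_def
proof (intro conjI allI ballI)
  show "mult_op a \<in> DA h" for a by (rule Dop_subset_DA[OF mult_op_in_Dop[of a h 0]])
  fix u v assume "u \<in> DA h" "v \<in> DA h"
  then obtain i j where ij: "u \<in> Dop h i" "v \<in> Dop h j" by (meson DA_Dop)
  then have "u \<in> Dop h (max i j)" "v \<in> Dop h (max i j)"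
    by (meson whole.Dop_mono max.cobounded1 max.cobounded2)+
  then show "(\<lambda>y. u y + v y) \<in> DA h" by (intro Dop_subset_DA whole.Dop_add)
  show "u \<circ> v \<in> DA h" by (rule Dop_subset_DA[OF whole.Dop_comp[OF ij]])
qed simp

lemma mult_op_apply [simp]: "mult_op a y = a * y"
  by (simp add: mult_op_def)

lemma mult_op_comp: "mult_op a \<circ> mult_op b = mult_op (a * b)"
  by (simp add: fun_eq_iff mult.assoc)

lemma commut_UNIV: "commut_on UNIV a u = (\<lambda>y. a * u y - u (a * y))"
  by (simp add: commut_on_def)

lemma mult_op_eq_0_iff [simp]: "mult_op a = (\<lambda>_. 0) \<longleftrightarrow> a = 0"
proof
  assume "mult_op a = (\<lambda>_. 0)"
  then have "mult_op a 1 = 0" by (rule fun_cong)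
  then show "a = 0" by simp
qed (simp add: fun_eq_iff)

lemma mult_op_if_commut_0:
  assumes "\<And>a. commut_on UNIV a u = (\<lambda>_. 0)" shows "u = mult_op (u 1)"
proof
  fix y show "u y = mult_op (u 1) y"
    using fun_cong[OF assms[of y], of 1] by (simp add: commut_UNIV mult.commute)
qed

text \<open>What algebras containing A share with their two-sided ideals. Such a set is closed under
  commutators with functions, which suffices for the Ore conditions; the new numerators then remain
  in the same algebra or ideal.\<close>

definition bimodule_set :: "('a::comm_ring_1 \<Rightarrow> 'a) set \<Rightarrow> bool" where
  "bimodule_set X \<longleftrightarrow> (\<forall>u\<in>X. \<forall>v\<in>X. (\<lambda>y. u y + v y) \<in> X) \<and>
    (\<forall>a. \<forall>u\<in>X. mult_op a \<circ> u \<in> X \<and> u \<circ> mult_op a \<in> X)"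

lemma bimodule_setD:
  assumes "bimodule_set X"
  shows "u \<in> X \<Longrightarrow> v \<in> X \<Longrightarrow> (\<lambda>y. u y + v y) \<in> X" "u \<in> X \<Longrightarrow> mult_op a \<circ> u \<in> X"
    "u \<in> X \<Longrightarrow> u \<circ> mult_op a \<in> X" "u \<in> X \<Longrightarrow> commut_on UNIV a u \<in> X"
proof -
  show *: "u \<in> X \<Longrightarrow> v \<in> X \<Longrightarrow> (\<lambda>y. u y + v y) \<in> X" "u \<in> X \<Longrightarrow> mult_op a \<circ> u \<in> X"
    "u \<in> X \<Longrightarrow> u \<circ> mult_op a \<in> X" for u v a
    using assms by (auto simp: bimodule_set_def)
  assume u: "u \<in> X"
  have "commut_on UNIV a u = (\<lambda>y. (mult_op a \<circ> u) y + (mult_op (- 1) \<circ> (u \<circ> mult_op a)) y)"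
    by (simp add: commut_UNIV fun_eq_iff)
  then show "commut_on UNIV a u \<in> X" using * u by metis
qed

lemma bimodule_DA: "bimodule_set (DA h)"
  using subalg_DA[of h] by (auto simp: bimodule_set_def subalg_containing_A_def)

lemma bimodule_subalg: "subalg_containing_A h R \<Longrightarrow> bimodule_set R"
  by (auto simp: bimodule_set_def subalg_containing_A_def)

text \<open>One has t^(i+2) u = t^(i+1) u t + t^(i+1) [t, u], and the commutator has order
  \<open>i\<close>, so by induction a factor \<open>t\<close> also comes out on the right of the
  last term. Each order costs one more factor, and order 0 needs one already.\<close>

lemma ore_left:
  assumes X: "bimodule_set X"
  shows "u \<in> X \<Longrightarrow> u \<in> Dop h i \<Longrightarrow>
    \<exists>u'\<in>X. u' \<in> Dop h i \<and> mult_op (t ^ Suc i) \<circ> u = u' \<circ> mult_op t"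
proof (induction i arbitrary: u)
  case 0
  have "mult_op (t ^ Suc 0) \<circ> u = u \<circ> mult_op t"
    using fun_cong[OF whole.Dop_0_commut[OF 0(2), of t]] by (auto simp: fun_eq_iff commut_UNIV)
  then show ?case using 0 by blast
next
  case (Suc i)
  let ?w = "commut_on UNIV t u"
  have "?w \<in> X" "?w \<in> Dop h i" using Suc.prems bimodule_setD(4)[OF X] by auto
  from Suc.IH[OF this] obtain w' where w': "w' \<in> X" "w' \<in> Dop h i" "mult_op (t ^ Suc i) \<circ> ?w = w' \<circ> mult_op t"
    by blast
  let ?u = "\<lambda>y. (mult_op (t ^ Suc i) \<circ> u) y + w' y"
  have "mult_op (t ^ Suc (Suc i)) \<circ> u = ?u \<circ> mult_op t"
  proof
    fix y
    have "(mult_op (t ^ Suc i) \<circ> ?w) y = w' (t * y)" using w'(3) by simp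
    then show "(mult_op (t ^ Suc (Suc i)) \<circ> u) y = (?u \<circ> mult_op t) y"
      by (simp add: commut_UNIV algebra_simps)
  qed
  moreover have "?u \<in> X" using bimodule_setD[OF X] Suc.prems w' by blast
  moreover have "mult_op (t ^ Suc i) \<circ> u \<in> Dop h (Suc i)"
    using whole.Dop_comp[OF mult_op_in_Dop[of _ h 0] Suc.prems(2)] by simp
  then have "?u \<in> Dop h (Suc i)" using whole.Dop_Suc[OF w'(2)] whole.Dop_add by blast
  ultimately show ?case by blast
qed

lemma ore_right:
  assumes X: "bimodule_set X"
  shows "u \<in> X \<Longrightarrow> u \<in> Dop h i \<Longrightarrow>
    \<exists>u'\<in>X. u' \<in> Dop h i \<and> u \<circ> mult_op (t ^ Suc i) = mult_op t \<circ> u'"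
proof (induction i arbitrary: u)
  case 0
  have "u \<circ> mult_op (t ^ Suc 0) = mult_op t \<circ> u"
    using fun_cong[OF whole.Dop_0_commut[OF 0(2), of t]] by (auto simp: fun_eq_iff commut_UNIV)
  then show ?case using 0 by blast
next
  case (Suc i)
  let ?w = "commut_on UNIV t u"
  have "?w \<in> X" "?w \<in> Dop h i" using Suc.prems bimodule_setD(4)[OF X] by auto
  from Suc.IH[OF this] obtain w' where w': "w' \<in> X" "w' \<in> Dop h i" "?w \<circ> mult_op (t ^ Suc i) = mult_op t \<circ> w'"
    by blast
  let ?u = "\<lambda>y. (u \<circ> mult_op (t ^ Suc i)) y + (mult_op (- 1) \<circ> w') y"
  have "u \<circ> mult_op (t ^ Suc (Suc i)) = mult_op t \<circ> ?u"
  proof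
    fix y
    have "(?w \<circ> mult_op (t ^ Suc i)) y = t * w' y" using w'(3) by simp
    then show "(u \<circ> mult_op (t ^ Suc (Suc i))) y = (mult_op t \<circ> ?u) y"
      by (simp add: commut_UNIV algebra_simps)
  qed
  moreover have "?u \<in> X" using bimodule_setD[OF X] Suc.prems w' by blast
  moreover have "u \<circ> mult_op (t ^ Suc i) \<in> Dop h (Suc i)"
    using whole.Dop_comp[OF Suc.prems(2) mult_op_in_Dop[of _ h 0]] by simp
  moreover have "mult_op (- 1) \<circ> w' \<in> Dop h (Suc i)"
    using whole.Dop_Suc[OF whole.Dop_comp[OF mult_op_in_Dop[of _ h 0] w'(2)]] by simp
  ultimately show ?case using whole.Dop_add by blast
qed

section \<open>Ideals of operator algebras\<close>

lemma maximal_ideal_exists: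
  fixes I :: "'a::comm_ring_1 set"
  assumes "is_ideal I" "1 \<notin> I"
  obtains M where "maximal_ideal M" "I \<subseteq> M"
proof -
  obtain M where M: "is_ideal M" "I \<subseteq> M" "1 \<notin> M"
    and max: "\<And>U. is_ideal U \<Longrightarrow> M \<subseteq> U \<Longrightarrow> 1 \<notin> U \<Longrightarrow> U = M"
  proof (rule maximal_set_avoiding[of is_ideal, OF assms])
    fix \<C> :: "'a set set"
    assume \<C>: "\<C> \<noteq> {}" "\<And>U. U \<in> \<C> \<Longrightarrow> is_ideal U"
      "\<And>U V. U \<in> \<C> \<Longrightarrow> V \<in> \<C> \<Longrightarrow> U \<subseteq> V \<or> V \<subseteq> U"
    show "is_ideal (\<Union>\<C>)"
      unfolding is_ideal_def
    proof (intro conjI ballI allI)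
      show "0 \<in> \<Union>\<C>" using \<C>(1,2) by (fastforce simp: is_ideal_def)
      fix v w assume "v \<in> \<Union>\<C>" "w \<in> \<Union>\<C>"
      then obtain U U' where U: "v \<in> U" "w \<in> U'" "U \<in> \<C>" "U' \<in> \<C>" by blast
      then have "v + w \<in> U \<or> v + w \<in> U'"
        using \<C>(2,3) by (metis is_ideal_def subsetD)
      then show "v + w \<in> \<Union>\<C>" using U by blast
    next
      fix c v assume "v \<in> \<Union>\<C>"
      then show "c * v \<in> \<Union>\<C>" using \<C>(2) by (fastforce simp: is_ideal_def)
    qed
  qed blast
  have "U = UNIV" if "is_ideal U" "1 \<in> U" for U
    using that unfolding is_ideal_def by (metis UNIV_eq_I mult.right_neutral)
  then have "maximal_ideal M"
    unfolding maximal_ideal_def using M max by blast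
  then show thesis using M that by blast
qed

lemma maximal_idealD:
  fixes M :: "'a::comm_ring_1 set"
  assumes "maximal_ideal M"
  shows "0 \<in> M" "a \<in> M \<Longrightarrow> b \<in> M \<Longrightarrow> a + b \<in> M" "a \<in> M \<Longrightarrow> c * a \<in> M" "1 \<notin> M"
    "a * b \<in> M \<Longrightarrow> a \<in> M \<or> b \<in> M"
proof -
  have M: "is_ideal M" "M \<noteq> UNIV" and max: "\<And>J. is_ideal J \<Longrightarrow> M \<subseteq> J \<Longrightarrow> J = M \<or> J = UNIV"
    using assms by (auto simp: maximal_ideal_def)
  show *: "0 \<in> M" "a \<in> M \<Longrightarrow> b \<in> M \<Longrightarrow> a + b \<in> M" "a \<in> M \<Longrightarrow> c * a \<in> M" for a b c
    using M(1) by (auto simp: is_ideal_def)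
  show "1 \<notin> M"
  proof
    assume "1 \<in> M"
    then have "a \<in> M" for a using *(3)[of 1 a] by simp
    then show False using M(2) by blast
  qed
  assume ab: "a * b \<in> M"
  show "a \<in> M \<or> b \<in> M"
  proof (rule ccontr)
    assume "\<not> (a \<in> M \<or> b \<in> M)"
    let ?J = "{m + c * a | m c. m \<in> M}"
    have "is_ideal ?J"
      unfolding is_ideal_def
    proof (intro conjI ballI allI)
      have "0 = 0 + 0 * a" by simp
      then show "0 \<in> ?J" using *(1) by blast
      fix v w assume "v \<in> ?J" "w \<in> ?J"
      then obtain m c m' c' where "v = m + c * a" "w = m' + c' * a" "m \<in> M" "m' \<in> M" by blast
      then have "v + w = (m + m') + (c + c') * a" "m + m' \<in> M" using *(2) by (auto simp: algebra_simps)
      then show "v + w \<in> ?J" by blast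
    next
      fix d v assume "v \<in> ?J"
      then obtain m c where "v = m + c * a" "m \<in> M" by blast
      then have "d * v = d * m + (d * c) * a" by (simp add: algebra_simps)
      moreover have "d * m \<in> M" using *(3) \<open>m \<in> M\<close> .
      ultimately show "d * v \<in> ?J" by blast
    qed
    moreover have "M \<subseteq> ?J"
    proof
      fix m assume "m \<in> M"
      moreover have "m = m + 0 * a" by simp
      ultimately show "m \<in> ?J" by blast
    qed
    moreover have "a \<in> ?J"
    proof -
      have "a = 0 + 1 * a" by simp
      then show ?thesis using *(1) by blast
    qed
    ultimately have "1 \<in> ?J" using max \<open>\<not> (a \<in> M \<or> b \<in> M)\<close> by blast
    then obtain m c where mc: "1 = m + c * a" "m \<in> M" by blast
    have "b = b * (m + c * a)" using mc(1) by simp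
    also have "\<dots> = b * m + c * (a * b)" by (simp add: algebra_simps)
    also have "\<dots> \<in> M" using *(2,3) mc(2) ab by blast
    finally show False using \<open>\<not> (a \<in> M \<or> b \<in> M)\<close> by blast
  qed
qed

lemma maximal_ideal_power:
  assumes "maximal_ideal M" "a \<notin> M" shows "a ^ k \<notin> M"
  by (induction k) (use maximal_idealD(4,5)[OF assms(1)] assms(2) in auto)

lemma subalgD:
  assumes "subalg_containing_A h R"
  shows "u \<in> R \<Longrightarrow> v \<in> R \<Longrightarrow> (\<lambda>y. u y + v y) \<in> R" "u \<in> R \<Longrightarrow> v \<in> R \<Longrightarrow> u \<circ> v \<in> R" "mult_op a \<in> R"
    "u \<in> R \<Longrightarrow> u \<in> DA h" "u \<in> R \<Longrightarrow> v \<in> R \<Longrightarrow> (\<lambda>y. u y - v y) \<in> R" "(\<lambda>_. 0) \<in> R"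
proof -
  show *: "u \<in> R \<Longrightarrow> v \<in> R \<Longrightarrow> (\<lambda>y. u y + v y) \<in> R" "u \<in> R \<Longrightarrow> v \<in> R \<Longrightarrow> u \<circ> v \<in> R" "mult_op a \<in> R"
    "u \<in> R \<Longrightarrow> u \<in> DA h" for u v a
    using assms by (auto simp: subalg_containing_A_def)
  show "(\<lambda>y. u y - v y) \<in> R" if "u \<in> R" "v \<in> R"
    using *(1)[OF that(1) *(2)[OF *(3)[of "- 1"] that(2)]] by simp
  show "(\<lambda>_. 0) \<in> R" using *(3)[of 0] by (simp add: mult_op_def)
qed

lemma op_idealD:
  assumes "op_ideal R J"
  shows "u \<in> J \<Longrightarrow> u \<in> R" "(\<lambda>_. 0) \<in> J" "u \<in> J \<Longrightarrow> v \<in> J \<Longrightarrow> (\<lambda>y. u y - v y) \<in> J"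
    "r \<in> R \<Longrightarrow> u \<in> J \<Longrightarrow> r \<circ> u \<in> J" "r \<in> R \<Longrightarrow> u \<in> J \<Longrightarrow> u \<circ> r \<in> J"
    "u \<in> J \<Longrightarrow> v \<in> J \<Longrightarrow> (\<lambda>y. u y + v y) \<in> J"
proof -
  show *: "u \<in> J \<Longrightarrow> u \<in> R" "(\<lambda>_. 0) \<in> J" "u \<in> J \<Longrightarrow> v \<in> J \<Longrightarrow> (\<lambda>y. u y - v y) \<in> J"
    "r \<in> R \<Longrightarrow> u \<in> J \<Longrightarrow> r \<circ> u \<in> J" "r \<in> R \<Longrightarrow> u \<in> J \<Longrightarrow> u \<circ> r \<in> J" for u v r
    using assms by (auto simp: op_ideal_def)
  show "(\<lambda>y. u y + v y) \<in> J" if "u \<in> J" "v \<in> J"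
    using *(3)[OF that(1) *(3)[OF *(2) that(2)]] by simp
qed

lemma op_ideal_sum:
  assumes "op_ideal R J" "\<And>k. k \<in> S \<Longrightarrow> u k \<in> J"
  shows "(\<lambda>y. \<Sum>k\<in>S. u k y) \<in> J"
  using assms(2)
proof (induction S rule: infinite_finite_induct)
  case (insert k S)
  then show ?case using op_idealD(6)[OF assms(1), of "u k" "\<lambda>y. \<Sum>k\<in>S. u k y"] by simp
qed (simp_all add: op_idealD(2)[OF assms(1)])

lemma bimodule_op_ideal:
  assumes "subalg_containing_A h R" "op_ideal R J" shows "bimodule_set J"
  unfolding bimodule_set_def
  by (auto intro: op_idealD(4,5,6)[OF assms(2)] subalgD(3)[OF assms(1)])

lemma op_ideal_meets:
  assumes R: "subalg_containing_A h R" and J: "op_ideal R J" "J \<noteq> {\<lambda>_. 0}"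
  obtains a where "a \<noteq> 0" "mult_op a \<in> J"
proof -
  note X = bimodule_op_ideal[OF R J(1)]
  have "u \<in> J \<Longrightarrow> u \<noteq> (\<lambda>_. 0) \<Longrightarrow> u \<in> Dop h i \<Longrightarrow> \<exists>a. a \<noteq> 0 \<and> mult_op a \<in> J" for u i
  proof (induction i arbitrary: u)
    case (0 u)
    then have u: "u = mult_op (u 1)" by (intro mult_op_if_commut_0) simp
    have "mult_op (u 1) \<noteq> (\<lambda>_. 0)" "mult_op (u 1) \<in> J" using 0(1,2) u by auto
    then show ?case unfolding mult_op_eq_0_iff by blast
  next
    case (Suc i u)
    show ?case
    proof (cases "\<forall>a. commut_on UNIV a u = (\<lambda>_. 0)")
      case True
      then have u: "u = mult_op (u 1)" by (intro mult_op_if_commut_0) blast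
      have "mult_op (u 1) \<noteq> (\<lambda>_. 0)" "mult_op (u 1) \<in> J" using Suc(2,3) u by auto
      then show ?thesis unfolding mult_op_eq_0_iff by blast
    next
      case False
      then obtain a where "commut_on UNIV a u \<noteq> (\<lambda>_. 0)" by blast
      moreover have "commut_on UNIV a u \<in> J" using bimodule_setD(4)[OF X Suc(2)] .
      moreover have "commut_on UNIV a u \<in> Dop h i" using Suc(4) by simp
      ultimately show ?thesis using Suc.IH by blast
    qed
  qed
  moreover obtain u where "u \<in> J" "u \<noteq> (\<lambda>_. 0)" using J op_idealD(2)[OF J(1)] by blast
  moreover from this obtain i where "u \<in> Dop h i"
    using op_idealD(1)[OF J(1)] subalgD(4)[OF R] DA_Dop by metis
  ultimately show thesis using that by blast
qed

lemma simple_alg_iff: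
  fixes R :: "('a::comm_ring_1 \<Rightarrow> 'a) set"
  assumes R: "subalg_containing_A h R"
  shows "simple_alg R \<longleftrightarrow> (\<forall>J. op_ideal R J \<and> J \<noteq> {\<lambda>_. 0} \<longrightarrow> mult_op 1 \<in> J)"
proof
  assume "simple_alg R"
  then show "\<forall>J. op_ideal R J \<and> J \<noteq> {\<lambda>_. 0} \<longrightarrow> mult_op 1 \<in> J"
    using subalgD(3)[OF R] unfolding simple_alg_def by blast
next
  assume *: "\<forall>J. op_ideal R J \<and> J \<noteq> {\<lambda>_. 0} \<longrightarrow> mult_op 1 \<in> J"
  have "mult_op 1 \<noteq> (\<lambda>_::'a. 0)" by simp
  moreover have "J = R" if J: "op_ideal R J" "mult_op 1 \<in> J" for J
  proof
    show "J \<subseteq> R" using op_idealD(1)[OF J(1)] by blast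
    show "R \<subseteq> J"
    proof
      fix u assume "u \<in> R"
      then have "u \<circ> mult_op 1 \<in> J" using op_idealD(4)[OF J(1) _ J(2)] by blast
      moreover have "u \<circ> mult_op 1 = u" by (simp add: fun_eq_iff)
      ultimately show "u \<in> J" by simp
    qed
  qed
  ultimately show "simple_alg R"
    unfolding simple_alg_def using * subalgD(3)[OF R] by metis
qed

section \<open>Simplicity at a maximal ideal\<close>

definition locally_simple :: "('a::comm_ring_1 \<Rightarrow> 'a) set \<Rightarrow> 'a set \<Rightarrow> bool" where
  "locally_simple R M \<longleftrightarrow> (\<forall>J. op_ideal R J \<and> J \<noteq> {\<lambda>_. 0} \<longrightarrow> (\<exists>s. s \<notin> M \<and> mult_op s \<in> J))"

lemma is_ideal_functions:
  assumes R: "subalg_containing_A h R" and J: "op_ideal R J"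
  shows "is_ideal {a. mult_op a \<in> J}"
  unfolding is_ideal_def
proof (intro conjI ballI allI; clarify)
  show "mult_op 0 \<in> J" using op_idealD(2)[OF J] by (simp add: mult_op_def)
  show "mult_op (a + b) \<in> J" if "mult_op a \<in> J" "mult_op b \<in> J" for a b
  proof -
    have "mult_op (a + b) = (\<lambda>y. mult_op a y + mult_op b y)" by (simp add: fun_eq_iff algebra_simps)
    then show ?thesis using op_idealD(6)[OF J] that by metis
  qed
  show "mult_op (r * a) \<in> J" if "mult_op a \<in> J" for r a
    using op_idealD(4)[OF J subalgD(3)[OF R, of r] that] by (simp add: mult_op_comp)
qed

lemma simple_imp_locally_simple:
  assumes "subalg_containing_A h R" "simple_alg R" "maximal_ideal M"
  shows "locally_simple R M"
  using assms(2) simple_alg_iff[OF assms(1)] maximal_idealD(4)[OF assms(3)] unfolding locally_simple_def by blast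

text \<open>The functions in an ideal of \<open>R\<close> form an ideal of A; if it leaves every
  maximal ideal, it contains 1.\<close>

lemma simple_iff_locally_simple:
  assumes R: "subalg_containing_A h R"
  shows "simple_alg R \<longleftrightarrow> (\<forall>M. maximal_ideal M \<longrightarrow> locally_simple R M)"
proof
  assume *: "\<forall>M. maximal_ideal M \<longrightarrow> locally_simple R M"
  show "simple_alg R"
    unfolding simple_alg_iff[OF R]
  proof (intro allI impI, elim conjE, rule ccontr)
    fix J assume J: "op_ideal R J" "J \<noteq> {\<lambda>_. 0}" and "mult_op 1 \<notin> J"
    then obtain M where "maximal_ideal M" "{a. mult_op a \<in> J} \<subseteq> M"
      using maximal_ideal_exists[OF is_ideal_functions[OF R J(1)]] by auto
    then show False using * J unfolding locally_simple_def by blast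
  qed
qed (use simple_imp_locally_simple[OF R] in blast)

text \<open>A nonzero ideal of \<open>DA h\<close> contains a nonzero function, which belongs to
  \<open>R\<close>. Its trace on \<open>R\<close> is therefore a nonzero ideal and contains
  1.\<close>

lemma simple_DA_if_simple:
  assumes R: "subalg_containing_A h R" and simple: "simple_alg R"
  shows "simple_alg (DA h)"
  unfolding simple_alg_iff[OF subalg_DA]
proof (intro allI impI, elim conjE)
  fix J assume J: "op_ideal (DA h) J" "J \<noteq> {\<lambda>_. 0}"
  obtain a where a: "a \<noteq> 0" "mult_op a \<in> J" using op_ideal_meets[OF subalg_DA J] by blast
  have "op_ideal R (J \<inter> R)"
    unfolding op_ideal_def
    by (auto intro: op_idealD(2-5)[OF J(1)] subalgD(2,4,5,6)[OF R])
  moreover have "J \<inter> R \<noteq> {\<lambda>_. 0}"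
  proof -
    have "mult_op a \<in> J \<inter> R" using a subalgD(3)[OF R] by blast
    moreover have "mult_op a \<noteq> (\<lambda>_. 0)" using a(1) by simp
    ultimately show ?thesis by blast
  qed
  ultimately show "mult_op 1 \<in> J" using simple simple_alg_iff[OF R] by blast
qed

text \<open>By the Ore conditions the power of exponent \<open>Suc i\<close> of an element of either
  ideal lies in the other one, and \<open>M\<close> contains no power of an element outside
  it.\<close>

lemma b_ideal_subset_iff_c_ideal_subset:
  assumes R: "subalg_containing_A h R" and M: "maximal_ideal M"
  shows "b_ideal h R i \<subseteq> M \<longleftrightarrow> c_ideal h R i \<subseteq> M"
proof -
  have "c ^ Suc i \<in> b_ideal h R i" if c: "c \<in> c_ideal h R i" for c
    unfolding b_ideal_def
  proof (intro CollectI ballI)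
    fix u assume u: "u \<in> Dop h i"
    then obtain u' where "u' \<in> Dop h i" "mult_op (c ^ Suc i) \<circ> u = u' \<circ> mult_op c"
      using ore_left[OF bimodule_DA, of u h h i c] Dop_subset_DA by blast
    then show "mult_op (c ^ Suc i) \<circ> u \<in> R \<inter> Dop h i"
      using c by (simp add: c_ideal_def)
  qed
  moreover have "b ^ Suc i \<in> c_ideal h R i" if b: "b \<in> b_ideal h R i" for b
    unfolding c_ideal_def
  proof (intro CollectI ballI)
    fix u assume u: "u \<in> Dop h i"
    then obtain u' where "u' \<in> Dop h i" "u \<circ> mult_op (b ^ Suc i) = mult_op b \<circ> u'"
      using ore_right[OF bimodule_DA, of u h h i b] Dop_subset_DA by blast
    then show "u \<circ> mult_op (b ^ Suc i) \<in> R \<inter> Dop h i"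
      using b by (simp add: b_ideal_def)
  qed
  ultimately show ?thesis using maximal_ideal_power[OF M] by blast
qed

text \<open>The set \<open>I\<close> below is the contraction to \<open>DA h\<close> of the localization of \<open>J\<close>; where no
  \<open>b_ideal\<close> lies in \<open>M\<close>, the localizations of \<open>R\<close> and of \<open>DA h\<close> coincide.\<close>

lemma locally_simple_transfer:
  assumes R: "subalg_containing_A h R" and M: "maximal_ideal M"
    and nb: "\<And>i. i \<ge> 1 \<Longrightarrow> \<not> b_ideal h R i \<subseteq> M" and D: "locally_simple (DA h) M"
  shows "locally_simple R M"
  unfolding locally_simple_def
proof (intro allI impI, elim conjE)
  fix J assume J: "op_ideal R J" "J \<noteq> {\<lambda>_. 0}"
  note prime = maximal_idealD[OF M]
  \<comment> \<open>The hypothesis speaks of indices from 1 on, so an operator of order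
    \<open>i\<close> is regarded as one of order \<open>Suc i\<close>.\<close>
  have into_R: "\<exists>d. d \<notin> M \<and> mult_op d \<circ> u \<in> R" if u: "u \<in> Dop h i" for u i
  proof -
    obtain d where "d \<in> b_ideal h R (Suc i)" "d \<notin> M" using nb[of "Suc i"] by auto
    then show ?thesis using whole.Dop_Suc[OF u] unfolding b_ideal_def by blast
  qed
  have into_R': "\<exists>d. d \<notin> M \<and> u \<circ> mult_op d \<in> R" if u: "u \<in> Dop h i" for u i
  proof -
    obtain d where "d \<in> c_ideal h R (Suc i)" "d \<notin> M"
      using nb[of "Suc i"] b_ideal_subset_iff_c_ideal_subset[OF R M, of "Suc i"] by auto
    then show ?thesis using whole.Dop_Suc[OF u] unfolding c_ideal_def by blast
  qed
  \<comment> \<open>Denominators are allowed on both sides: \<open>b\<close> is moved past left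
    factors by \<open>ore_left\<close>, and \<open>c\<close> past right factors by
    \<open>ore_right\<close>.\<close>
  define I where "I = {w \<in> DA h. \<exists>b c. b \<notin> M \<and> c \<notin> M \<and> mult_op b \<circ> w \<circ> mult_op c \<in> J}"
  have II: "w \<in> I" if "w \<in> DA h" "b \<notin> M" "c \<notin> M" "mult_op b \<circ> w \<circ> mult_op c \<in> J" for w b c
    unfolding I_def using that by blast
  have "op_ideal (DA h) I"
    unfolding op_ideal_def
  proof (intro conjI ballI)
    show "I \<subseteq> DA h" by (auto simp: I_def)
    show "(\<lambda>_. 0) \<in> I"
    proof (rule II[OF subalgD(6)[OF subalg_DA] prime(4) prime(4)])
      have eq: "mult_op 1 \<circ> (\<lambda>_. 0) \<circ> mult_op 1 = (\<lambda>_. 0)" by (simp add: fun_eq_iff)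
      show "mult_op 1 \<circ> (\<lambda>_. 0) \<circ> mult_op 1 \<in> J" unfolding eq by (rule op_idealD(2)[OF J(1)])
    qed
  next
    fix u v assume "u \<in> I" "v \<in> I"
    then obtain b c b' c' where *: "u \<in> DA h" "v \<in> DA h" "b \<notin> M" "c \<notin> M" "b' \<notin> M" "c' \<notin> M"
      "mult_op b \<circ> u \<circ> mult_op c \<in> J" "mult_op b' \<circ> v \<circ> mult_op c' \<in> J" by (auto simp: I_def)
    have add: "w (a - a') = w a - w a'" if "w \<in> DA h" for w a a'
      using that by (meson DA_Dop whole.DopD(7) UNIV_I)
    have "(\<lambda>y. (mult_op b' \<circ> (mult_op b \<circ> u \<circ> mult_op c) \<circ> mult_op c') y -
        (mult_op b \<circ> (mult_op b' \<circ> v \<circ> mult_op c') \<circ> mult_op c) y) \<in> J"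
      by (intro op_idealD(3,4,5)[OF J(1)] subalgD(3)[OF R] *)
    also have "(\<lambda>y. (mult_op b' \<circ> (mult_op b \<circ> u \<circ> mult_op c) \<circ> mult_op c') y -
        (mult_op b \<circ> (mult_op b' \<circ> v \<circ> mult_op c') \<circ> mult_op c) y) =
        mult_op (b * b') \<circ> (\<lambda>y. u y - v y) \<circ> mult_op (c * c')"
      by (simp add: fun_eq_iff algebra_simps)
    finally show "(\<lambda>y. u y - v y) \<in> I"
      by (rule II[rotated 3]) (use * prime(5) subalgD(5)[OF subalg_DA] in blast)+
  next
    fix r u assume r: "r \<in> DA h" and "u \<in> I"
    then obtain b c where u: "u \<in> DA h" "b \<notin> M" "c \<notin> M" "mult_op b \<circ> u \<circ> mult_op c \<in> J"
      by (auto simp: I_def)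
    obtain i where i: "r \<in> Dop h i" using r by (rule DA_Dop)
    \<comment> \<open>Moving \<open>b\<close> past \<open>r\<close> replaces \<open>r\<close> by
      \<open>r'\<close>; the further factor \<open>d\<close> brings \<open>r'\<close> into
      \<open>R\<close>, where the ideal \<open>J\<close> absorbs it.\<close>
    obtain r' where r': "r' \<in> Dop h i" "mult_op (b ^ Suc i) \<circ> r = r' \<circ> mult_op b"
      using ore_left[OF bimodule_DA r i, of b] by blast
    obtain d where d: "d \<notin> M" "mult_op d \<circ> r' \<in> R" using into_R[OF r'(1)] by blast
    have "(mult_op d \<circ> r') \<circ> (mult_op b \<circ> u \<circ> mult_op c) \<in> J"
      by (rule op_idealD(4)[OF J(1) d(2) u(4)])
    also have "(mult_op d \<circ> r') \<circ> (mult_op b \<circ> u \<circ> mult_op c) = mult_op d \<circ> (r' \<circ> mult_op b) \<circ> u \<circ> mult_op c"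
      by (simp only: comp_assoc)
    also have "\<dots> = mult_op (d * b ^ Suc i) \<circ> (r \<circ> u) \<circ> mult_op c"
      by (simp only: r'(2)[symmetric] mult_op_comp[symmetric] comp_assoc)
    finally show "r \<circ> u \<in> I"
      by (rule II[rotated 3])
        (use d(1) u prime(5) maximal_ideal_power[OF M u(2), of "Suc i"] subalgD(2)[OF subalg_DA r u(1)] in blast)+
    obtain r'' where r'': "r'' \<in> Dop h i" "r \<circ> mult_op (c ^ Suc i) = mult_op c \<circ> r''"
      using ore_right[OF bimodule_DA r i, of c] by blast
    obtain e where e: "e \<notin> M" "r'' \<circ> mult_op e \<in> R" using into_R'[OF r''(1)] by blast
    have "(mult_op b \<circ> u \<circ> mult_op c) \<circ> (r'' \<circ> mult_op e) \<in> J"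
      by (rule op_idealD(5)[OF J(1) e(2) u(4)])
    also have "(mult_op b \<circ> u \<circ> mult_op c) \<circ> (r'' \<circ> mult_op e) = mult_op b \<circ> u \<circ> (mult_op c \<circ> r'') \<circ> mult_op e"
      by (simp only: comp_assoc)
    also have "\<dots> = mult_op b \<circ> (u \<circ> r) \<circ> mult_op (c ^ Suc i * e)"
      by (simp only: r''(2)[symmetric] mult_op_comp[symmetric] comp_assoc)
    finally show "u \<circ> r \<in> I"
      by (rule II[rotated 3])
        (use e(1) u prime(5) maximal_ideal_power[OF M u(3), of "Suc i"] subalgD(2)[OF subalg_DA u(1) r] in blast)+
  qed
  moreover have "I \<noteq> {\<lambda>_. 0}"
  proof -
    obtain a where a: "a \<noteq> 0" "mult_op a \<in> J" using op_ideal_meets[OF R J] by blast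
    have "mult_op 1 \<circ> mult_op a \<circ> mult_op 1 = mult_op a" by (simp add: fun_eq_iff)
    then have "mult_op a \<in> I"
      using a(2) by (intro II[OF subalgD(3)[OF subalg_DA] prime(4) prime(4)]) simp
    moreover have "mult_op a \<noteq> (\<lambda>_. 0)" using a(1) by simp
    ultimately show ?thesis by blast
  qed
  ultimately obtain s where "s \<notin> M" "mult_op s \<in> I" using D unfolding locally_simple_def by blast
  then obtain b c where "b \<notin> M" "c \<notin> M" "mult_op b \<circ> mult_op s \<circ> mult_op c \<in> J" by (auto simp: I_def)
  then show "\<exists>s. s \<notin> M \<and> mult_op s \<in> J"
    using \<open>s \<notin> M\<close> prime(5) by (metis mult_op_comp)
qed

section \<open>Localization\<close>

definition emb :: "'a::idom \<Rightarrow> 'a fract" where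
  "emb a = Fraction_Field.Fract a 1"

lemma emb_simps [simp]:
  "emb (a + b) = emb a + emb b" "emb (a - b) = emb a - emb b" "emb (a * b) = emb a * emb b"
  "emb (- a) = - emb a" "emb 1 = 1" "emb 0 = 0" "emb (a ^ k) = emb a ^ k"
proof -
  show *: "emb (a * b) = emb a * emb b" "emb 1 = 1" for a b :: 'a by (simp_all add: emb_def One_fract_def)
  show "emb (a ^ k) = emb a ^ k" by (induction k) (simp_all add: *)
qed (simp_all add: emb_def Zero_fract_def)

lemma emb_eq_iff [simp]: "emb a = emb b \<longleftrightarrow> a = b"
  by (simp add: emb_def eq_fract)

lemma emb_eq_0_iff [simp]: "emb a = 0 \<longleftrightarrow> a = 0"
  using emb_eq_iff[of a 0] by simp

lemma Fract_eq_emb: "Fraction_Field.Fract a s = emb a / emb s"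
  by (simp add: emb_def)

text \<open>The recursion comes from \<open>u (s * z) = s * u z + [u, s] z\<close> with \<open>z = a / s\<close>, where
  \<open>[u, s]\<close> has smaller order.\<close>

fun extension :: "nat \<Rightarrow> ('a::idom \<Rightarrow> 'a) \<Rightarrow> 'a \<Rightarrow> 'a \<Rightarrow> 'a fract" where
  "extension 0 u a s = emb (u a) / emb s"
| "extension (Suc i) u a s = (emb (u a) - extension i (\<lambda>y. u (s * y) - s * u y) a s) / emb s"

lemma extension_add: "extension i (\<lambda>y. u y + v y) a s = extension i u a s + extension i v a s"
proof (induction i arbitrary: u v)
  case (Suc i)
  have "(\<lambda>y. u (s * y) + v (s * y) - s * (u y + v y)) = (\<lambda>y. (u (s * y) - s * u y) + (v (s * y) - s * v y))"
    by (simp add: algebra_simps)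
  then show ?case
    using Suc[of "\<lambda>y. u (s * y) - s * u y" "\<lambda>y. v (s * y) - s * v y"]
    by (simp only: extension.simps emb_simps) (simp add: add_divide_distrib diff_divide_distrib)
qed (simp only: extension.simps emb_simps add_divide_distrib)

lemma extension_scale: "extension i (\<lambda>y. b * u y) a s = emb b * extension i u a s"
proof (induction i arbitrary: u)
  case (Suc i)
  have "(\<lambda>y. b * u (s * y) - s * (b * u y)) = (\<lambda>y. b * (u (s * y) - s * u y))"
    by (simp add: algebra_simps)
  then show ?case
    using Suc[of "\<lambda>y. u (s * y) - s * u y"]
    by (simp only: extension.simps emb_simps right_diff_distrib[symmetric] times_divide_eq_right)
qed (simp only: extension.simps emb_simps times_divide_eq_right)

lemma extension_zero: "extension i (\<lambda>_. 0) a s = 0"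
  using extension_scale[of i 0 "\<lambda>_. 0" a s] by (simp add: emb_simps)

lemma extension_comp_mult: "extension i (\<lambda>y. u (b * y)) a s = extension i u (b * a) s"
proof (induction i arbitrary: u)
  case (Suc i)
  have "(\<lambda>y. u (b * (s * y)) - s * u (b * y)) = (\<lambda>y. (\<lambda>z. u (s * z) - s * u z) (b * y))"
    by (simp add: mult.left_commute)
  then show ?case
    using Suc[of "\<lambda>y. u (s * y) - s * u y"] by (simp only: extension.simps)
qed simp

lemma extension_arg_add:
  "(\<And>y z. u (y + z) = u y + u z) \<Longrightarrow> extension i u (a + b) s = extension i u a s + extension i u b s"
proof (induction i arbitrary: u)
  case (Suc i)
  have "extension i (\<lambda>y. u (s * y) - s * u y) (a + b) s =
      extension i (\<lambda>y. u (s * y) - s * u y) a s + extension i (\<lambda>y. u (s * y) - s * u y) b s"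
    by (rule Suc.IH) (simp add: Suc.prems algebra_simps)
  then show ?case
    by (simp only: extension.simps Suc.prems emb_simps) (simp add: add_divide_distrib diff_divide_distrib)
qed (simp only: extension.simps emb_simps add_divide_distrib)

lemma bracket_in_Dop:
  assumes "u \<in> Dop h (Suc i)" shows "(\<lambda>y. u (s * y) - s * u y) \<in> Dop h i"
proof -
  have "commut_on UNIV s u \<in> Dop h i" using assms by simp
  from whole.Dop_uminus[OF this] show ?thesis by (simp add: commut_UNIV)
qed

lemma bracket_0:
  assumes "u \<in> Dop h 0" shows "u (s * y) = s * u y"
  using fun_cong[OF whole.Dop_0_commut[OF assms, of s], of y] by (simp add: commut_UNIV)

text \<open>The index is merely a bound for the order. Being able to raise it turns the recursion
  into an equation with the same index on both sides, namely \<open>extension_key\<close>.\<close>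

lemma extension_Suc:
  "u \<in> Dop h i \<Longrightarrow> extension (Suc i) u a s = extension i u a s"
proof (induction i arbitrary: u)
  case 0
  have "u (s * y) = s * u y" for y by (rule bracket_0[OF 0])
  then show ?case by simp
next
  case (Suc i)
  show ?case
    using Suc.IH[OF bracket_in_Dop[OF Suc.prems, of s]] by (simp only: extension.simps)
qed

lemma extension_key:
  assumes "u \<in> Dop h i" "s \<noteq> 0"
  shows "emb (u a) = emb s * extension i u a s + extension i (\<lambda>y. u (s * y) - s * u y) a s"
proof -
  have "emb s * extension (Suc i) u a s = emb (u a) - extension i (\<lambda>y. u (s * y) - s * u y) a s"
    using assms(2) by (simp only: extension.simps) simp
  then show ?thesis unfolding extension_Suc[OF assms(1)] by simp
qed

text \<open>This is the independence of the fraction. For v = [u, s] and w = [u, b] one has [u, b s]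
  = v b + s w and v b = b v + [w, s]. By induction the common factor cancels in the extension of
  [u, b s], and \<open>extension_key\<close> for \<open>w\<close> removes all terms with
  \<open>w\<close>.\<close>

lemma extension_cancel:
  "u \<in> Dop h i \<Longrightarrow> s \<noteq> 0 \<Longrightarrow> b \<noteq> 0 \<Longrightarrow> extension i u (b * a) (b * s) = extension i u a s"
proof (induction i arbitrary: u)
  case 0
  have "u (b * a) = b * u a" by (rule bracket_0[OF 0(1)])
  then show ?case using 0 by (simp add: field_simps)
next
  case (Suc i)
  define v where "v = (\<lambda>y. u (s * y) - s * u y)"
  define w where "w = (\<lambda>y. u (b * y) - b * u y)"
  have v: "v \<in> Dop h i" and w: "w \<in> Dop h i"
    unfolding v_def w_def by (rule bracket_in_Dop[OF Suc.prems(1)])+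
  have vb: "(\<lambda>y. v (b * y)) \<in> Dop h i"
    using whole.Dop_comp[OF v mult_op_in_Dop[of b h 0]] by (simp add: comp_def)
  have sw: "(\<lambda>y. s * w y) \<in> Dop h i" by (rule whole.Dop_scale[OF _ w]) simp
  have "(\<lambda>y. u (b * s * y) - b * s * u y) = (\<lambda>y. v (b * y) + s * w y)"
    by (simp add: v_def w_def algebra_simps)
  then have "extension i (\<lambda>y. u (b * s * y) - b * s * u y) (b * a) (b * s) =
      extension i (\<lambda>y. v (b * y) + s * w y) (b * a) (b * s)" by simp
  also have "\<dots> = extension i (\<lambda>y. v (b * y) + s * w y) a s"
    by (rule Suc.IH[OF whole.Dop_add[OF vb sw] Suc.prems(2,3)])
  also have "\<dots> = extension i v (b * a) s + emb s * extension i w a s"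
    by (simp only: extension_add extension_scale extension_comp_mult)
  finally have 1: "extension i (\<lambda>y. u (b * s * y) - b * s * u y) (b * a) (b * s) =
      extension i v (b * a) s + emb s * extension i w a s" .
  have "(\<lambda>y. v (b * y)) = (\<lambda>y. b * v y + (w (s * y) - s * w y))"
    by (simp add: v_def w_def algebra_simps)
  then have 2: "extension i v (b * a) s = emb b * extension i v a s + extension i (\<lambda>y. w (s * y) - s * w y) a s"
    by (simp only: extension_comp_mult[symmetric, of i v] extension_add extension_scale)
  have 3: "emb (w a) = emb s * extension i w a s + extension i (\<lambda>y. w (s * y) - s * w y) a s"
    by (rule extension_key[OF w Suc.prems(2)])
  have 4: "emb (u (b * a)) = emb b * emb (u a) + emb (w a)"
    by (simp only: emb_simps(1,3)[symmetric]) (simp add: w_def)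
  have nz: "emb s \<noteq> 0" "emb b \<noteq> 0" using Suc.prems by (simp_all only: emb_eq_0_iff not_False_eq_True)
  have "extension (Suc i) u (b * a) (b * s) =
      (emb b * emb (u a) - emb b * extension i v a s) / (emb b * emb s)"
    by (simp only: extension.simps 1 2 3 4 emb_simps) (simp add: algebra_simps)
  also have "\<dots> = (emb (u a) - extension i v a s) / emb s"
    using nz by (simp add: right_diff_distrib[symmetric] del: right_diff_distrib)
  also have "\<dots> = extension (Suc i) u a s"
    by (simp only: extension.simps v_def)
  finally show ?case .
qed

lemma extension_well_defined:
  assumes u: "u \<in> Dop h i" and "s \<noteq> 0" "t \<noteq> 0" "emb a / emb s = emb b / emb t"
  shows "extension i u a s = extension i u b t"
proof -
  have "emb (a * t) = emb (b * s)" using assms by (simp add: field_simps)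
  then have "a * t = b * s" by (simp only: emb_eq_iff)
  have "extension i u a s = extension i u (t * a) (t * s)" by (rule extension_cancel[OF u assms(2,3), symmetric])
  also have "\<dots> = extension i u (s * b) (s * t)" using \<open>a * t = b * s\<close> by (simp add: mult.commute)
  also have "\<dots> = extension i u b t" by (rule extension_cancel[OF u assms(3,2)])
  finally show ?thesis .
qed

lemma extension_base: "extension i u a 1 = emb (u a)"
  by (cases i) (simp_all add: extension_zero flip: Zero_fract_def)

lemma cross_diff:
  fixes s t x y :: "'q::field"
  shows "s \<noteq> 0 \<Longrightarrow> t \<noteq> 0 \<Longrightarrow> (t * x - s * y) / (s * t) = x / s - y / t"
  by (simp add: field_simps)

section \<open>The localized algebra of operators\<close>

locale localization =
  fixes h :: "'k::field \<Rightarrow> 'a::idom" and M :: "'a set"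
  assumes max: "maximal_ideal M"
begin

abbreviation C where "C \<equiv> loc_ring M"
abbreviation H where "H \<equiv> \<lambda>c. emb (h c)"

lemmas prime = maximal_idealD[OF max]

lemma nonzero: "s \<notin> M \<Longrightarrow> s \<noteq> 0"
  using prime(1) by blast

lemma nz_emb: "s \<notin> M \<Longrightarrow> emb s \<noteq> 0"
  using nonzero by (simp add: emb_eq_0_iff)

lemma mult_notin: "s \<notin> M \<Longrightarrow> t \<notin> M \<Longrightarrow> s * t \<notin> M"
  using prime(5) by blast

lemma in_C: "s \<notin> M \<Longrightarrow> emb a / emb s \<in> C"
  unfolding loc_ring_def Fract_eq_emb by blast

lemma in_C1: "emb a \<in> C"
  using in_C[OF prime(4), of a] by simp

lemma C_cases:
  assumes "y \<in> C" obtains a s where "y = emb a / emb s" "s \<notin> M"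
  using assms unfolding loc_ring_def Fract_eq_emb by blast

lemma common:
  assumes "y \<in> C" "z \<in> C" obtains a b s where "y = emb a / emb s" "z = emb b / emb s" "s \<notin> M"
proof -
  obtain a s b t where *: "y = emb a / emb s" "s \<notin> M" "z = emb b / emb t" "t \<notin> M"
    using C_cases assms by metis
  then have "y = emb (t * a) / emb (s * t)" "z = emb (s * b) / emb (s * t)"
    using nonzero by (auto simp: field_simps)
  then show thesis using that mult_notin *(2,4) by blast
qed

lemma subalgebra_C: "subalgebra_set C H"
proof
  show "1 \<in> C" "0 \<in> C" using in_C1[of 1] in_C1[of 0] by (simp_all only: emb_simps)
  show "H c \<in> C" for c by (rule in_C1)
  fix y z assume "y \<in> C" "z \<in> C"
  then obtain a b s where *: "y = emb a / emb s" "z = emb b / emb s" "s \<notin> M" by (rule common)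
  have "y + z = emb (a + b) / emb s" using * nonzero by (simp add: field_simps)
  then show "y + z \<in> C" using in_C * by metis
  have "y * z = emb (a * b) / emb (s * s)" using * by simp
  then show "y * z \<in> C" using in_C mult_notin * by metis
next
  fix y assume "y \<in> C"
  then obtain a s where "y = emb a / emb s" "s \<notin> M" by (rule C_cases)
  moreover from this have "- y = emb (- a) / emb s" by simp
  ultimately show "- y \<in> C" using in_C by metis
qed

sublocale loc: subalgebra_set C H
  by (rule subalgebra_C)

lemma C_divide: "y \<in> C \<Longrightarrow> s \<notin> M \<Longrightarrow> y / emb s \<in> C"
  using loc.mult[OF in_C[of s 1]] by (simp add: divide_inverse mult.commute)

lemma extension_in_C:
  assumes "s \<notin> M" shows "extension i u a s \<in> C"
  using assms by (induction i arbitrary: u) (auto intro: C_divide in_C1 loc.diff)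

definition lift :: "nat \<Rightarrow> ('a \<Rightarrow> 'a) \<Rightarrow> 'a fract \<Rightarrow> 'a fract" where
  "lift i u y = (if y \<in> C then let (a, s) = SOME (a, s). s \<notin> M \<and> y = emb a / emb s in extension i u a s else 0)"

lemma lift_quot:
  assumes u: "u \<in> Dop h i" and s: "s \<notin> M"
  shows "lift i u (emb a / emb s) = extension i u a s"
proof -
  have "\<exists>p. case p of (b, t) \<Rightarrow> t \<notin> M \<and> emb a / emb s = emb b / emb t" using s by auto
  from someI_ex[OF this] obtain b t where bt: "(SOME (b, t). t \<notin> M \<and> emb a / emb s = emb b / emb t) = (b, t)"
    "t \<notin> M" "emb a / emb s = emb b / emb t" by (cases "SOME (b, t). t \<notin> M \<and> emb a / emb s = emb b / emb t") auto
  have "lift i u (emb a / emb s) = extension i u b t"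
    using in_C[OF s] by (simp add: lift_def bt(1))
  also have "\<dots> = extension i u a s"
    by (rule extension_well_defined[OF u]) (use bt s nonzero in auto)
  finally show ?thesis .
qed

lemma lift_outside: "y \<notin> C \<Longrightarrow> lift i u y = 0"
  by (simp add: lift_def)

lemma lift_klin:
  assumes u: "u \<in> Dop h i" shows "klin_on C H (lift i u)"
  unfolding klin_on_def
proof (intro conjI ballI allI impI)
  show "lift i u y \<in> C" if y: "y \<in> C" for y
    by (rule C_cases[OF y]) (simp add: lift_quot[OF u] extension_in_C)
  show "lift i u (y + z) = lift i u y + lift i u z" if yz: "y \<in> C" "z \<in> C" for y z
  proof (rule common[OF yz])
    fix a b s assume *: "y = emb a / emb s" "z = emb b / emb s" "s \<notin> M"
    have "y + z = emb (a + b) / emb s" using * nonzero by (simp add: field_simps)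
    then show ?thesis
      using * lift_quot[OF u *(3)] lift_quot[OF u *(3), of "a + b"] extension_arg_add[of u i a b s] whole.DopD(2)[OF u] by simp
  qed
  show "lift i u (H c * y) = H c * lift i u y" if y: "y \<in> C" for c y
  proof (rule C_cases[OF y])
    fix a s assume *: "y = emb a / emb s" "s \<notin> M"
    have "H c * y = emb (h c * a) / emb s" using * by simp
    moreover have "extension i u (h c * a) s = H c * extension i u a s"
      unfolding extension_comp_mult[symmetric] extension_scale[symmetric]
      using whole.DopD(3)[OF u] by simp
    ultimately show ?thesis using * lift_quot[OF u *(2)] by metis
  qed
qed (simp add: lift_outside)

text \<open>For r = b / t the identity t [r, w] = [b, w] - [t, w] r holds, so commutators with
  elements of A control those with all fractions.\<close>

lemma commut_quotient:
  assumes w: "klin_on C H w" and t: "t \<notin> M" and comm: "\<And>b. commut_on C (emb b) w \<in> Dop_on C H i"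
  shows "commut_on C (emb b / emb t) w \<in> Dop_on C H i"
proof -
  let ?r = "emb b / emb t"
  have r: "?r \<in> C" by (rule in_C[OF t])
  have tr: "emb t * ?r = emb b" using nonzero[OF t] by (simp add: field_simps)
  let ?q = "\<lambda>y. (1 / emb t) * (commut_on C (emb b) w y - (commut_on C (emb t) w \<circ> (\<lambda>y. if y \<in> C then ?r * y else 0)) y)"
  have "?q \<in> Dop_on C H i"
    by (rule loc.Dop_scale[OF _ loc.Dop_diff[OF comm loc.Dop_comp[OF comm loc.Dop_mult_op[OF r], unfolded add_0_right]]])
      (use in_C[OF t, of 1] in simp)
  moreover have "commut_on C ?r w = ?q"
  proof
    fix y
    show "commut_on C ?r w y = ?q y"
    proof (cases "y \<in> C")
      case True
      have ry: "?r * y \<in> C" using True r loc.mult by blast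
      have "emb t * commut_on C ?r w y = emb b * w y - emb t * w (?r * y)"
        using True by (simp only: commut_on_def if_True right_diff_distrib mult.assoc[symmetric] tr)
      also have "\<dots> = commut_on C (emb b) w y - commut_on C (emb t) w (?r * y)"
        using True ry by (simp only: commut_on_def if_True mult.assoc[symmetric] tr) simp
      finally have "(1 / emb t) * (emb t * commut_on C ?r w y) =
        (1 / emb t) * (commut_on C (emb b) w y - commut_on C (emb t) w (?r * y))" by (simp only:)
      moreover have "(1 / emb t) * emb t = 1"
        using nonzero[OF t] by simp
      ultimately show ?thesis using True by (simp only: mult.assoc[symmetric] mult_1_left comp_apply if_True)
    next
      case False
      then show ?thesis using loc.klin_onD(5)[OF w] by (simp add: commut_on_def)
    qed
  qed
  ultimately show ?thesis by (simp only:)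
qed

lemma commut_lift:
  assumes u: "u \<in> Dop h (Suc i)"
  shows "commut_on C (emb b) (lift (Suc i) u) = (\<lambda>y. - lift i (\<lambda>y. u (b * y) - b * u y) y)"
proof
  fix y
  let ?v = "\<lambda>y. u (b * y) - b * u y"
  have v: "?v \<in> Dop h i" by (rule bracket_in_Dop[OF u])
  show "commut_on C (emb b) (lift (Suc i) u) y = - lift i ?v y"
  proof (cases "y \<in> C")
    case True
    then obtain a s where *: "y = emb a / emb s" "s \<notin> M" by (rule C_cases)
    have "emb b * y = emb (b * a) / emb s" using * by simp
    then have "commut_on C (emb b) (lift (Suc i) u) y =
        emb b * extension (Suc i) u a s - extension (Suc i) u (b * a) s"
      using True lift_quot[OF u *(2)] by (simp only: commut_on_def if_True *(1))
    also have "extension (Suc i) u (b * a) s = extension (Suc i) (\<lambda>y. b * u y + ?v y) a s"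
      by (simp only: extension_comp_mult[symmetric]) simp
    also have "\<dots> = emb b * extension (Suc i) u a s + extension i ?v a s"
      by (simp only: extension_add extension_scale extension_Suc[OF v])
    finally show ?thesis using lift_quot[OF v *(2)] *(1) by simp
  next
    case False
    then show ?thesis by (simp add: commut_on_def lift_outside)
  qed
qed

lemma lift_in_Dop: "u \<in> Dop h i \<Longrightarrow> lift i u \<in> Dop_on C H i"
proof (induction i arbitrary: u)
  case (0 u)
  have "commut_on C r (lift 0 u) y = 0" if r: "r \<in> C" for r y
  proof (cases "y \<in> C")
    case True
    obtain b t where r': "r = emb b / emb t" "t \<notin> M" using r by (rule C_cases)
    obtain a s where y': "y = emb a / emb s" "s \<notin> M" using True by (rule C_cases)
    have "r * y = emb (b * a) / emb (t * s)" using r' y' by simp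
    then have "commut_on C r (lift 0 u) y = r * extension 0 u a s - extension 0 u (b * a) (t * s)"
      using True lift_quot[OF 0 mult_notin[OF r'(2) y'(2)], of "b * a"] lift_quot[OF 0 y'(2), of a] y'(1)
      by (simp add: commut_on_def)
    then show ?thesis using bracket_0[OF 0, of b a] r' by simp
  qed (simp add: commut_on_def)
  then show ?case using lift_klin[OF 0] by (simp add: fun_eq_iff)
next
  case (Suc i u)
  have "commut_on C r (lift (Suc i) u) \<in> Dop_on C H i" if r: "r \<in> C" for r
  proof (rule C_cases[OF r])
    fix b t assume "r = emb b / emb t" "t \<notin> M"
    then show ?thesis
      using commut_quotient[OF lift_klin[OF Suc.prems] \<open>t \<notin> M\<close>, of i b] commut_lift[OF Suc.prems]
        loc.Dop_uminus[OF Suc.IH[OF bracket_in_Dop[OF Suc.prems]]] by simp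
  qed
  then show ?case using lift_klin[OF Suc.prems] by simp
qed

text \<open>If y = a / s, then s w(y) = w(a) + [s, w](y). The commutator also vanishes on A and has
  smaller order, so both terms on the right are 0.\<close>

lemma Dop_unique:
  "w \<in> Dop_on C H i \<Longrightarrow> (\<And>a. w (emb a) = 0) \<Longrightarrow> w = (\<lambda>_. 0)"
proof (induction i arbitrary: w)
  case (0 w)
  show ?case
  proof
    fix y show "w y = 0"
    proof (cases "y \<in> C")
      case True
      then obtain a s where y: "y = emb a / emb s" "s \<notin> M" by (rule C_cases)
      have "emb s * y = emb a" using y nonzero by (simp add: field_simps)
      then have "emb s * w y = 0"
        using fun_cong[OF loc.Dop_0_commut[OF 0(1) in_C1[of s]], of y] True 0(2) by (simp add: commut_on_def)
      then show ?thesis using nz_emb[OF y(2)] by simp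
    qed (rule loc.DopD(4)[OF 0(1)])
  qed
next
  case (Suc i w)
  show ?case
  proof
    fix y show "w y = 0"
    proof (cases "y \<in> C")
      case True
      then obtain a s where y: "y = emb a / emb s" "s \<notin> M" by (rule C_cases)
      have sy: "emb s * y = emb a" using y nonzero by (simp add: field_simps)
      have "commut_on C (emb s) w = (\<lambda>_. 0)"
      proof (rule Suc.IH[OF loc.Dop_commut[OF Suc.prems(1) in_C1]])
        fix b
        have "emb s * emb b = emb (s * b)" by simp
        then show "commut_on C (emb s) w (emb b) = 0"
          by (simp only: commut_on_def in_C1 if_True Suc.prems(2)) simp
      qed
      from fun_cong[OF this, of y] have "emb s * w y = 0"
        using sy True Suc.prems(2) by (simp add: commut_on_def)
      then show ?thesis using nz_emb[OF y(2)] by simp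
    qed (rule loc.DopD(4)[OF Suc.prems(1)])
  qed
qed

definition extends :: "('a \<Rightarrow> 'a) \<Rightarrow> ('a fract \<Rightarrow> 'a fract) \<Rightarrow> bool" where
  "extends u w \<longleftrightarrow> w \<in> D_on C H \<and> (\<forall>a. w (emb a) = emb (u a))"

lemma extends_unique: assumes "extends u w" "extends u w'" shows "w = w'"
proof -
  obtain i j where "w \<in> Dop_on C H i" "w' \<in> Dop_on C H j"
    using assms by (auto simp: extends_def D_on_def)
  then have "w \<in> Dop_on C H (max i j)" "w' \<in> Dop_on C H (max i j)"
    using loc.Dop_mono[of i "max i j"] loc.Dop_mono[of j "max i j"] by auto
  from loc.Dop_diff[OF this] have "(\<lambda>y. w y - w' y) = (\<lambda>_. 0)"
    by (rule Dop_unique) (use assms in \<open>simp add: extends_def\<close>)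
  then show ?thesis by (simp add: fun_eq_iff)
qed

lemma extends_exists: assumes "u \<in> DA h" obtains w where "extends u w"
proof -
  obtain i where i: "u \<in> Dop h i" using assms by (rule DA_Dop)
  have "lift i u (emb a) = emb (u a)" for a
    using lift_quot[OF i prime(4), of a] by (simp add: extension_base)
  then have "extends u (lift i u)"
    using lift_in_Dop[OF i] by (auto simp: extends_def D_on_def)
  then show thesis by (rule that)
qed

text \<open>Extensions are unique, so an identity for \<open>E\<close> is proved by
  \<open>E_eqI\<close>: the other side is an operator with the right restriction to A. The recursion
  of \<open>extension\<close> does not appear again.\<close>

definition E :: "('a \<Rightarrow> 'a) \<Rightarrow> 'a fract \<Rightarrow> 'a fract" where
  "E u = (SOME w. extends u w)"

lemma E_extends: "u \<in> DA h \<Longrightarrow> extends u (E u)"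
  unfolding E_def using extends_exists by (metis someI_ex)

lemma E_eqI: "extends u w \<Longrightarrow> E u = w"
  using extends_unique someI[of "extends u" w] unfolding E_def by blast

lemma E_emb: "u \<in> DA h \<Longrightarrow> E u (emb a) = emb (u a)"
  using E_extends by (auto simp: extends_def)

lemma E_D: assumes "u \<in> DA h" obtains i where "E u \<in> Dop_on C H i"
  using E_extends[OF assms] by (auto simp: extends_def D_on_def)

lemma E_C: "u \<in> DA h \<Longrightarrow> y \<in> C \<Longrightarrow> E u y \<in> C" "u \<in> DA h \<Longrightarrow> y \<notin> C \<Longrightarrow> E u y = 0"
  by (meson E_D loc.DopD(1,4))+

lemma E_0: "u \<in> DA h \<Longrightarrow> E u 0 = 0"
  by (meson E_D loc.DopD(5))

lemma E_comp: assumes u: "u \<in> DA h" and v: "v \<in> DA h" shows "E (u \<circ> v) = E u \<circ> E v"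
proof (rule E_eqI)
  obtain i j where "E u \<in> Dop_on C H i" "E v \<in> Dop_on C H j" using E_D u v by metis
  from loc.Dop_comp[OF this] show "extends (u \<circ> v) (E u \<circ> E v)"
    unfolding extends_def D_on_def using E_emb[OF u] E_emb[OF v] by auto
qed

lemma E_diff: assumes u: "u \<in> DA h" and v: "v \<in> DA h" shows "E (\<lambda>y. u y - v y) = (\<lambda>y. E u y - E v y)"
proof (rule E_eqI)
  obtain i j where "E u \<in> Dop_on C H i" "E v \<in> Dop_on C H j" using E_D u v by metis
  then have "E u \<in> Dop_on C H (max i j)" "E v \<in> Dop_on C H (max i j)"
    using loc.Dop_mono[of i "max i j"] loc.Dop_mono[of j "max i j"] by auto
  from loc.Dop_diff[OF this] show "extends (\<lambda>y. u y - v y) (\<lambda>y. E u y - E v y)"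
    unfolding extends_def D_on_def using E_emb[OF u] E_emb[OF v] by auto
qed

lemma E_mult_op: "E (mult_op a) = (\<lambda>y. if y \<in> C then emb a * y else 0)"
proof (rule E_eqI)
  show "extends (mult_op a) (\<lambda>y. if y \<in> C then emb a * y else 0)"
    unfolding extends_def D_on_def by (intro conjI UN_I[of 0] UNIV_I loc.Dop_mult_op in_C1) (simp add: in_C1)
qed

lemma E_zero: "E (\<lambda>_. 0) = (\<lambda>_. 0)"
proof -
  have "mult_op (0::'a) = (\<lambda>_. 0)" by simp
  then have "E (\<lambda>_. 0) = E (mult_op 0)" by (simp only:)
  also have "\<dots> = (\<lambda>_. 0)" unfolding E_mult_op by (auto simp: fun_eq_iff)
  finally show ?thesis .
qed

lemma E_inj: assumes "u \<in> DA h" "E u = E v" "v \<in> DA h" shows "u = v"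
proof
  fix a
  have "emb (u a) = emb (v a)" using E_emb[OF assms(1)] E_emb[OF assms(3)] assms(2) by metis
  then show "u a = v a" by (simp add: field_simps)
qed

definition Q :: "'a \<Rightarrow> ('a \<Rightarrow> 'a) \<Rightarrow> 'a fract \<Rightarrow> 'a fract" where
  "Q s u = (\<lambda>y. E u y / emb s)"

lemma loc_alg_eq:
  assumes R: "R \<subseteq> DA h"
  shows "loc_alg h R M = {Q s u | s u. s \<notin> M \<and> u \<in> R}"
proof -
  have Q: "Q s u = (\<lambda>y. if y \<in> C then E u y / emb s else 0)" if "u \<in> R" for s u
    using E_C(2) R that by (auto simp: Q_def fun_eq_iff)
  have "loc_alg h R M = {w. \<exists>s u ut. s \<notin> M \<and> u \<in> R \<and> extends u ut \<and>
      w = (\<lambda>y. if y \<in> C then ut y / emb s else 0)}"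
    unfolding loc_alg_def extends_def emb_def conj_assoc ..
  also have "\<dots> = {Q s u | s u. s \<notin> M \<and> u \<in> R}"
  proof (intro equalityI subsetI; clarify)
    fix s u ut assume "s \<notin> M" "u \<in> R" "extends u ut"
    then show "\<exists>s' u'. (\<lambda>y. if y \<in> C then ut y / emb s else 0) = Q s' u' \<and> s' \<notin> M \<and> u' \<in> R"
      by (intro exI[of _ s] exI[of _ u]) (simp only: Q E_eqI simp_thms)
  next
    fix s u assume "s \<notin> M" "u \<in> R"
    then show "\<exists>s' u' ut. s' \<notin> M \<and> u' \<in> R \<and> extends u' ut \<and>
        Q s u = (\<lambda>y. if y \<in> C then ut y / emb s' else 0)"
      using Q[of u s] E_extends[of u] R by (intro exI[of _ s] exI[of _ u] exI[of _ "E u"]) auto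
  qed
  finally show ?thesis .
qed

text \<open>From t^(i+1) v = v' t follows v t^(-1) = t^(-(i+1)) v', which brings the product of two
  left fractions into the form of one. The set \<open>X\<close> records that the new numerator stays
  in the algebra or ideal of the old one.\<close>

lemma Q_comp:
  assumes u: "u \<in> DA h" and v: "v \<in> DA h" "v \<in> Dop h i" "v \<in> X" and X: "bimodule_set X" and t: "t \<notin> M"
  obtains v' where "v' \<in> X" "v' \<in> Dop h i" "\<And>s u. u \<in> DA h \<Longrightarrow> Q s v \<circ> Q t u = Q (s * t ^ Suc i) (v' \<circ> u)"
proof -
  obtain v' where v': "v' \<in> X" "v' \<in> Dop h i" "mult_op (t ^ Suc i) \<circ> v = v' \<circ> mult_op t"
    using ore_left[OF X v(3,2), of t] by blast
  have D: "v' \<in> DA h" "mult_op a \<in> DA h" for a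
    using v'(2) Dop_subset_DA subalgD(3)[OF subalg_DA] by auto
  have nz: "emb t \<noteq> 0" "emb (t ^ Suc i) \<noteq> 0"
    using nz_emb[OF t] nz_emb[OF maximal_ideal_power[OF max t, of "Suc i"]] by auto
  have Ev: "E v (y / emb t) = E v' y / emb (t ^ Suc i)" if y: "y \<in> C" for y
  proof -
    let ?z = "y / emb t"
    have z: "?z \<in> C" by (rule C_divide[OF y t])
    have "E (mult_op (t ^ Suc i) \<circ> v) ?z = E (v' \<circ> mult_op t) ?z" by (simp only: v'(3))
    then have "emb (t ^ Suc i) * E v ?z = E v' (emb t * ?z)"
      using z E_C(1)[OF v(1) z] by (simp only: E_comp[OF D(2) v(1)] E_comp[OF D(1,2)] comp_apply E_mult_op if_True)
    also have "emb t * ?z = y" using nz(1) by simp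
    finally show ?thesis using nz(2) by (metis nonzero_mult_div_cancel_left)
  qed
  have "Q s v \<circ> Q t u = Q (s * t ^ Suc i) (v' \<circ> u)" if u: "u \<in> DA h" for s u
  proof
    fix y
    show "(Q s v \<circ> Q t u) y = Q (s * t ^ Suc i) (v' \<circ> u) y"
    proof (cases "y \<in> C")
      case True
      have "(Q s v \<circ> Q t u) y = E v (E u y / emb t) / emb s" by (simp only: Q_def comp_apply)
      also have "\<dots> = E v' (E u y) / emb (t ^ Suc i) / emb s" by (simp only: Ev[OF E_C(1)[OF u True]])
      also have "\<dots> = E v' (E u y) / emb (s * t ^ Suc i)"
        by (simp only: emb_simps(3) divide_divide_eq_left mult.commute)
      finally show ?thesis by (simp only: Q_def E_comp[OF D(1) u] comp_apply)
    next
      case False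
      then show ?thesis
        using E_C(2)[OF u False] E_0[OF v(1)] E_0[OF D(1)] by (simp only: Q_def comp_apply E_comp[OF D(1) u]) simp
    qed
  qed
  then show thesis using that v' by blast
qed

text \<open>The fractions with numerator in \<open>J\<close> form a two-sided ideal by the Ore
  condition, nonzero because extension is injective. If they are everything, 1 is such a fraction
  with denominator \<open>s\<close>, and its numerator must be multiplication by
  \<open>s\<close>.\<close>

lemma locally_simple_if_simple_loc_alg:
  assumes R: "subalg_containing_A h R" and simple: "simple_alg (loc_alg h R M)"
  shows "locally_simple R M"
proof -
  note RD = subalgD(4)[OF R]
  have RDA: "R \<subseteq> DA h" using RD by blast
  note L = loc_alg_eq[OF RDA]
  have Q1: "Q 1 (mult_op 1) = (\<lambda>y. if y \<in> C then y else 0)"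
    by (simp add: Q_def E_mult_op fun_eq_iff)
  show ?thesis
    unfolding locally_simple_def
  proof (intro allI impI, elim conjE)
    fix J assume J: "op_ideal R J" "J \<noteq> {\<lambda>_. 0}"
    have JD: "u \<in> DA h" if "u \<in> J" for u using op_idealD(1)[OF J(1) that] RD by blast
    define K where "K = {Q s u | s u. s \<notin> M \<and> u \<in> J}"
    have KI: "Q s u \<in> K" if "s \<notin> M" "u \<in> J" for s u using that unfolding K_def by blast
    have "op_ideal (loc_alg h R M) K"
      unfolding op_ideal_def
    proof (intro conjI ballI)
      show "K \<subseteq> loc_alg h R M" unfolding L K_def using op_idealD(1)[OF J(1)] by blast
      show "(\<lambda>_. 0) \<in> K"
        using KI[OF prime(4) op_idealD(2)[OF J(1)]] by (simp add: Q_def E_zero)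
    next
      fix w w' assume "w \<in> K" "w' \<in> K"
      then obtain s u t v where *: "w = Q s u" "w' = Q t v" "s \<notin> M" "t \<notin> M" "u \<in> J" "v \<in> J"
        unfolding K_def by blast
      let ?d = "\<lambda>y. (mult_op t \<circ> u) y - (mult_op s \<circ> v) y"
      have d: "?d \<in> J" by (intro op_idealD(3,4)[OF J(1)] subalgD(3)[OF R] *)
      have D: "mult_op a \<in> DA h" "mult_op a \<circ> u \<in> DA h" "mult_op a \<circ> v \<in> DA h" for a
        using subalgD(2,3)[OF subalg_DA] JD *(5,6) by blast+
      have "w y - w' y = Q (s * t) ?d y" for y
      proof (cases "y \<in> C")
        case True
        have "Q (s * t) ?d y = (emb t * E u y - emb s * E v y) / (emb s * emb t)"
          unfolding Q_def E_diff[OF D(2,3)] unfolding E_comp[OF D(1) JD[OF *(5)]] E_comp[OF D(1) JD[OF *(6)]] unfolding E_mult_op comp_apply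
          using True E_C(1)[OF JD[OF *(5)] True] E_C(1)[OF JD[OF *(6)] True] by (simp only: if_True emb_simps)
        also have "\<dots> = E u y / emb s - E v y / emb t"
          by (rule cross_diff[OF nz_emb[OF *(3)] nz_emb[OF *(4)]])
        finally show ?thesis by (simp only: *(1,2) Q_def)
      next
        case False
        then show ?thesis
          unfolding *(1,2) Q_def using E_C(2)[OF _ False] JD *(5,6) JD[OF d] by simp
      qed
      then have "(\<lambda>y. w y - w' y) = Q (s * t) ?d" by (rule ext)
      then show "(\<lambda>y. w y - w' y) \<in> K" using KI[OF mult_notin[OF *(3,4)] d] by (simp only:)
    next
      fix r w assume "r \<in> loc_alg h R M" "w \<in> K"
      then obtain t v s u where *: "r = Q t v" "w = Q s u" "t \<notin> M" "s \<notin> M" "v \<in> R" "u \<in> J"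
        unfolding K_def L by blast
      obtain i j where ij: "v \<in> Dop h i" "u \<in> Dop h j" using DA_Dop RD JD *(5,6) by metis
      obtain v' where v': "v' \<in> R" "\<And>s' u'. u' \<in> DA h \<Longrightarrow> Q s' v \<circ> Q s u' = Q (s' * s ^ Suc i) (v' \<circ> u')"
        using Q_comp[OF JD[OF *(6)] RD[OF *(5)] ij(1) *(5) bimodule_subalg[OF R] *(4)] by metis
      have "r \<circ> w = Q (t * s ^ Suc i) (v' \<circ> u)" unfolding *(1,2) by (rule v'(2)[OF JD[OF *(6)]])
      moreover have "v' \<circ> u \<in> J" by (rule op_idealD(4)[OF J(1) v'(1) *(6)])
      ultimately show "r \<circ> w \<in> K"
        using KI[OF mult_notin[OF *(3) maximal_ideal_power[OF max *(4)]]] by metis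
      \<comment> \<open>The element of \<open>J\<close> is now the left factor, whose numerator
        changes; applying \<open>Q_comp\<close> to \<open>J\<close> instead of \<open>R\<close>
        keeps the new numerator in \<open>J\<close>.\<close>
      obtain u' where u': "u' \<in> J" "\<And>s' u''. u'' \<in> DA h \<Longrightarrow> Q s' u \<circ> Q t u'' = Q (s' * t ^ Suc j) (u' \<circ> u'')"
        using Q_comp[OF JD[OF *(6)] JD[OF *(6)] ij(2) *(6) bimodule_op_ideal[OF R J(1)] *(3)] by metis
      have "w \<circ> r = Q (s * t ^ Suc j) (u' \<circ> v)" unfolding *(1,2) by (rule u'(2)[OF RD[OF *(5)]])
      moreover have "u' \<circ> v \<in> J" by (rule op_idealD(5)[OF J(1) *(5) u'(1)])
      ultimately show "w \<circ> r \<in> K"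
        using KI[OF mult_notin[OF *(4) maximal_ideal_power[OF max *(3)]]] by metis
    qed
    moreover have "K \<noteq> {\<lambda>_. 0}"
    proof
      assume K0: "K = {\<lambda>_. 0}"
      obtain u where u: "u \<in> J" "u \<noteq> (\<lambda>_. 0)" using J op_idealD(2)[OF J(1)] by blast
      have "Q 1 u = (\<lambda>_. 0)" using KI[OF prime(4) u(1)] K0 by blast
      then have "E u = (\<lambda>_. 0)" by (simp add: Q_def fun_eq_iff emb_simps)
      then have "u = (\<lambda>_. 0)" using E_inj[OF JD[OF u(1)], of "\<lambda>_. 0"] E_zero subalgD(6)[OF subalg_DA] by metis
      then show False using u(2) by blast
    qed
    ultimately have "K = loc_alg h R M" using simple unfolding simple_alg_def by blast
    then have "Q 1 (mult_op 1) \<in> K" unfolding L using prime(4) subalgD(3)[OF R] by blast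
    then obtain s u where su: "Q 1 (mult_op 1) = Q s u" "s \<notin> M" "u \<in> J" unfolding K_def by blast
    have "u = mult_op s"
    proof (rule E_inj[OF JD[OF su(3)] _ subalgD(3)[OF subalg_DA]])
      show "E u = E (mult_op s)"
      proof
        fix y
        have "E u y / emb s = (if y \<in> C then y else 0)" using fun_cong[OF su(1)[unfolded Q1], of y] by (simp only: Q_def)
        then have "E u y = (if y \<in> C then y else 0) * emb s"
          unfolding nonzero_divide_eq_eq[OF nz_emb[OF su(2)]] .
        then show "E u y = E (mult_op s) y" unfolding E_mult_op by simp
      qed
    qed
    then show "\<exists>s. s \<notin> M \<and> mult_op s \<in> J" using su by blast
  qed
qed

text \<open>Clearing denominators shows that a nonzero ideal of the localization has nonzero
  contraction to \<open>R\<close>. The contraction contains a function outside \<open>M\<close>,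
  which is invertible in the localization.\<close>

lemma simple_loc_alg_if_locally_simple:
  assumes R: "subalg_containing_A h R" and ls: "locally_simple R M"
  shows "simple_alg (loc_alg h R M)"
proof -
  note RD = subalgD(4)[OF R]
  have RDA: "R \<subseteq> DA h" using RD by blast
  note L = loc_alg_eq[OF RDA]
  have Q1: "Q 1 (mult_op 1) = (\<lambda>y. if y \<in> C then y else 0)"
    by (simp add: Q_def E_mult_op fun_eq_iff)
  have QL: "Q s u \<in> loc_alg h R M" if "s \<notin> M" "u \<in> R" for s u unfolding L using that by blast
  have Q1E: "Q 1 u = E u" for u by (simp add: Q_def fun_eq_iff emb_simps)
  have EL: "E u \<in> loc_alg h R M" if "u \<in> R" for u using QL[OF prime(4) that] by (simp only: Q1E)
  have mult_Q: "E (mult_op s) \<circ> Q s u = E u" if "s \<notin> M" "u \<in> R" for s u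
  proof
    fix y show "(E (mult_op s) \<circ> Q s u) y = E u y"
    proof (cases "y \<in> C")
      case True
      then show ?thesis using C_divide[OF E_C(1)[OF RD[OF that(2)] True] that(1)] nz_emb[OF that(1)]
        by (simp only: comp_apply E_mult_op Q_def if_True) simp
    next
      case False
      then show ?thesis using E_C(2)[OF RD[OF that(2)] False] E_0[OF subalgD(3)[OF subalg_DA]] by (simp add: Q_def)
    qed
  qed
  show ?thesis
    unfolding simple_alg_def
  proof (intro conjI allI impI)
    have "Q 1 (mult_op 1) 1 = 1" using loc.one by (simp only: Q1 if_True)
    then have "Q 1 (mult_op 1) \<noteq> (\<lambda>_. 0)" using zero_neq_one by metis
    then show "\<exists>u\<in>loc_alg h R M. u \<noteq> (\<lambda>_. 0)" using QL[OF prime(4) subalgD(3)[OF R]] by blast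
    fix K assume K: "op_ideal (loc_alg h R M) K"
    show "K = {\<lambda>_. 0} \<or> K = loc_alg h R M"
    proof (rule disjCI)
      assume "K \<noteq> loc_alg h R M"
      show "K = {\<lambda>_. 0}"
      proof (rule ccontr)
        assume K0: "K \<noteq> {\<lambda>_. 0}"
        define J where "J = {u \<in> R. E u \<in> K}"
        have "op_ideal R J"
          unfolding op_ideal_def
        proof (intro conjI ballI)
          show "J \<subseteq> R" by (auto simp: J_def)
          show "(\<lambda>_. 0) \<in> J" using op_idealD(2)[OF K] subalgD(6)[OF R] by (simp add: J_def E_zero)
        next
          fix u v assume "u \<in> J" "v \<in> J"
          then show "(\<lambda>y. u y - v y) \<in> J"
            using subalgD(5)[OF R] op_idealD(3)[OF K, of "E u" "E v"] by (simp add: J_def E_diff RD)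
        next
          fix r u assume "r \<in> R" "u \<in> J"
          then show "r \<circ> u \<in> J" "u \<circ> r \<in> J"
            using subalgD(2)[OF R] op_idealD(4,5)[OF K EL, of r "E u"] by (simp_all add: J_def E_comp RD)
        qed
        moreover have "J \<noteq> {\<lambda>_. 0}"
        proof -
          obtain w where w: "w \<in> K" "w \<noteq> (\<lambda>_. 0)" using K0 op_idealD(2)[OF K] by blast
          then obtain s u where su: "w = Q s u" "s \<notin> M" "u \<in> R" using op_idealD(1)[OF K] unfolding L by blast
          have "E u \<in> K"
            using op_idealD(4)[OF K EL[OF subalgD(3)[OF R, of s]] w(1)] mult_Q[OF su(2,3)] su(1) by simp
          moreover have "u \<noteq> (\<lambda>_. 0)"
          proof
            assume "u = (\<lambda>_. 0)"
            then have "w = (\<lambda>_. 0)" unfolding su(1) Q_def by (simp add: E_zero)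
            then show False using w(2) by blast
          qed
          ultimately show ?thesis using su(3) unfolding J_def by blast
        qed
        ultimately obtain s where s: "s \<notin> M" "mult_op s \<in> J" using ls unfolding locally_simple_def by blast
        have "Q s (mult_op 1) \<circ> E (mult_op s) \<in> K"
          using s by (intro op_idealD(4)[OF K QL[OF s(1) subalgD(3)[OF R]]]) (simp add: J_def)
        moreover have "Q s (mult_op 1) \<circ> E (mult_op s) = (\<lambda>y. if y \<in> C then y else 0)"
        proof
          fix y
          show "(Q s (mult_op 1) \<circ> E (mult_op s)) y = (if y \<in> C then y else 0)"
          proof (cases "y \<in> C")
            case True
            then show ?thesis using loc.mult[OF in_C1 True, of s] nz_emb[OF s(1)]
              by (simp only: comp_apply Q_def E_mult_op if_True) simp
          next
            case False
            then show ?thesis using loc.zero by (simp add: Q_def E_mult_op)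
          qed
        qed
        ultimately have idK: "(\<lambda>y. if y \<in> C then y else 0) \<in> K" by simp
        have "loc_alg h R M \<subseteq> K"
        proof
          fix w assume wL: "w \<in> loc_alg h R M"
          then obtain t u where tu: "w = Q t u" "t \<notin> M" "u \<in> R" unfolding L by blast
          have "w \<circ> (\<lambda>y. if y \<in> C then y else 0) = w"
            using E_C(2)[OF RD[OF tu(3)]] E_0[OF RD[OF tu(3)]] by (auto simp: tu(1) Q_def fun_eq_iff)
          then show "w \<in> K" using op_idealD(4)[OF K wL idK] by simp
        qed
        then show False using \<open>K \<noteq> loc_alg h R M\<close> op_idealD(1)[OF K] by blast
      qed
    qed
  qed
qed

lemma simple_loc_alg_iff:
  assumes "subalg_containing_A h R"
  shows "simple_alg (loc_alg h R M) \<longleftrightarrow> locally_simple R M"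
  using locally_simple_if_simple_loc_alg[OF assms] simple_loc_alg_if_locally_simple[OF assms] by blast

end

section \<open>Simplicity away from the Jacobian ideal\<close>

lemma poly_values_insert:
  assumes h: "kalg h" and e: "e \<in> poly_values h x (insert j V)"
  obtains q where "\<And>k. coeff q k \<in> poly_values h x V" "e = poly q (x j)"
proof -
  note closed = poly_values_closed[OF h, where z = x and V = V]
  obtain p where p: "vars_in (insert j V) p" "e = mpeval h x p" using e unfolding poly_values_def by blast
  have "\<exists>q. (\<forall>k. coeff q k \<in> poly_values h x V) \<and> mpeval h x p = poly q (x j)"
    using p(1)
  proof (induction p rule: vars_in_induct)
    case (const c)
    then show ?case
      using closed(4,5) by (intro exI[of _ "[:h c:]"]) (auto simp: mpeval_simps[OF h] coeff_pCons split: nat.split)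
  next
    case (var i)
    show ?case
    proof (cases "i = j")
      case True
      then show ?thesis using closed(5,6)
        by (intro exI[of _ "[:0, 1:]"]) (auto simp: mpeval_simps[OF h] coeff_pCons split: nat.split)
    next
      case False
      then have "x i \<in> poly_values h x V" using var closed(7) by blast
      then show ?thesis using closed(5)
        by (intro exI[of _ "[:x i:]"]) (auto simp: mpeval_simps[OF h] coeff_pCons split: nat.split)
    qed
  next
    case (add a b)
    then obtain q q' where "\<forall>k. coeff q k \<in> poly_values h x V" "mpeval h x a = poly q (x j)"
      "\<forall>k. coeff q' k \<in> poly_values h x V" "mpeval h x b = poly q' (x j)" by blast
    then show ?case using closed(1) by (intro exI[of _ "q + q'"]) (simp add: mpeval_simps[OF h])
  next
    case (mult a b)
    then obtain q q' where "\<forall>k. coeff q k \<in> poly_values h x V" "mpeval h x a = poly q (x j)"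
      "\<forall>k. coeff q' k \<in> poly_values h x V" "mpeval h x b = poly q' (x j)" by blast
    then show ?case using closed(2)
      by (intro exI[of _ "q * q'"]) (simp add: mpeval_simps[OF h] coeff_mult poly_values_sum[OF h])
  qed
  then show thesis using that p(2) by blast
qed

lemma fps_linear_power_nth:
  "fps_nth ((fps_const a + fps_const b * fps_X) ^ k) m = (if m = k then b ^ k else 0)" if "k \<le> m"
  for a b :: "'a::comm_ring_1"
  using that
proof (induction k arbitrary: m)
  case (Suc k)
  then obtain m' where m: "m = Suc m'" by (cases m) auto
  have "(fps_const a + fps_const b * fps_X) ^ Suc k =
    fps_const a * (fps_const a + fps_const b * fps_X) ^ k + fps_const b * (fps_X * (fps_const a + fps_const b * fps_X) ^ k)"
    by (simp add: algebra_simps)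
  then have "fps_nth ((fps_const a + fps_const b * fps_X) ^ Suc k) m =
    a * fps_nth ((fps_const a + fps_const b * fps_X) ^ k) m + b * fps_nth ((fps_const a + fps_const b * fps_X) ^ k) m'"
    by (simp add: m)
  then show ?case using Suc.IH[of m] Suc.IH[of m'] Suc.prems m by simp
qed (simp add: fps_one_nth)

context jacobi_chart
begin

text \<open>The coefficients D_k of a homomorphism into power series satisfy D_k(r a) = sum of
  D_i(r) D_(k-i)(a). The term with i = 0 cancels in the commutator with \<open>r\<close>, which
  leaves a combination of operators of order below \<open>k\<close>.\<close>

lemma higher_derivation_in_Dop:
  assumes add: "\<And>a b. \<tau> (a + b) = \<tau> a + \<tau> b" and mult: "\<And>a b. \<tau> (a * b) = \<tau> a * \<tau> b"
    and const: "\<And>c. \<tau> (h c) = fps_const (h c)" and id: "\<And>a. fps_nth (\<tau> a) 0 = a"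
  shows "(\<lambda>a. fps_nth (\<tau> a) k) \<in> Dop h k"
proof (induction k rule: less_induct)
  case (less k)
  have klin: "klin_on UNIV h (\<lambda>a. fps_nth (\<tau> a) k)"
    by (simp add: klin_on_def add mult const)
  show ?case
  proof (cases k)
    case 0
    then show ?thesis using klin by (simp add: id commut_UNIV)
  next
    case (Suc l)
    have "commut_on UNIV r (\<lambda>a. fps_nth (\<tau> a) k) \<in> Dop h l" for r
    proof -
      have "commut_on UNIV r (\<lambda>a. fps_nth (\<tau> a) k) =
        (\<lambda>a. - (\<Sum>i\<in>{1..k}. fps_nth (\<tau> r) i * fps_nth (\<tau> a) (k - i)))"
      proof
        fix a
        have "fps_nth (\<tau> (r * a)) k = (\<Sum>i\<in>{0..k}. fps_nth (\<tau> r) i * fps_nth (\<tau> a) (k - i))"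
          by (simp add: mult fps_mult_nth)
        also have "\<dots> = r * fps_nth (\<tau> a) k + (\<Sum>i\<in>{1..k}. fps_nth (\<tau> r) i * fps_nth (\<tau> a) (k - i))"
          by (simp add: sum.atLeast_Suc_atMost id)
        finally show "commut_on UNIV r (\<lambda>a. fps_nth (\<tau> a) k) a =
          - (\<Sum>i\<in>{1..k}. fps_nth (\<tau> r) i * fps_nth (\<tau> a) (k - i))"
          by (simp add: commut_UNIV)
      qed
      also have "\<dots> \<in> Dop h l"
      proof (intro whole.Dop_uminus whole.Dop_sum whole.Dop_scale UNIV_I)
        fix i assume "i \<in> {1..k}"
        then show "(\<lambda>a. fps_nth (\<tau> a) (k - i)) \<in> Dop h l"
          using less[of "k - i"] Suc by (intro whole.Dop_mono[of "k - i" l]) auto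
      qed
      finally show ?thesis .
    qed
    then show ?thesis using klin Suc by simp
  qed
qed

text \<open>The same product rule, solved for the term in which the coefficient of order
  \<open>k\<close> is applied to \<open>a\<close>: this function is D_k after multiplication by
  \<open>a\<close>, minus terms that contain the functions D_i(a) with i < k.\<close>

lemma higher_derivation_stable:
  assumes J: "op_ideal (DA h) K"
    and add: "\<And>a b. \<tau> (a + b) = \<tau> a + \<tau> b" and mult: "\<And>a b. \<tau> (a * b) = \<tau> a * \<tau> b"
    and const: "\<And>c. \<tau> (h c) = fps_const (h c)" and id: "\<And>a. fps_nth (\<tau> a) 0 = a"
    and a: "mult_op a \<in> K"
  shows "mult_op (fps_nth (\<tau> a) k) \<in> K"
proof (induction k rule: less_induct)
  case (less k)
  have D: "(\<lambda>a. fps_nth (\<tau> a) l) \<in> DA h" for l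
    by (rule Dop_subset_DA[OF higher_derivation_in_Dop[OF add mult const id]])
  let ?u = "\<lambda>y. ((\<lambda>a. fps_nth (\<tau> a) k) \<circ> mult_op a) y -
    (\<Sum>i<k. (mult_op (fps_nth (\<tau> a) i) \<circ> (\<lambda>a. fps_nth (\<tau> a) (k - i))) y)"
  have "?u \<in> K"
    by (intro op_idealD(3)[OF J] op_ideal_sum[OF J] op_idealD(4)[OF J D a] op_idealD(5)[OF J D])
      (use less in blast)
  moreover have "?u = mult_op (fps_nth (\<tau> a) k)"
  proof
    fix y
    have "fps_nth (\<tau> (a * y)) k = (\<Sum>i\<le>k. fps_nth (\<tau> a) i * fps_nth (\<tau> y) (k - i))"
      by (simp add: mult fps_mult_nth atLeast0AtMost)
    also have "\<dots> = (\<Sum>i<k. fps_nth (\<tau> a) i * fps_nth (\<tau> y) (k - i)) + fps_nth (\<tau> a) k * y"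
      by (simp add: lessThan_Suc_atMost[symmetric] id)
    finally show "?u y = mult_op (fps_nth (\<tau> a) k) y" by simp
  qed
  ultimately show ?case by (simp only:)
qed

text \<open>Applying the coefficient of order \<open>d\<close> of the lift to a polynomial of degree \<open>d\<close> in
  \<open>x j\<close> extracts its leading coefficient, up to powers of \<open>\<Delta>\<close>.\<close>

lemma eliminate:
  assumes perfect: "perfect_field TYPE('k)" and J: "op_ideal (DA h) K"
    and V: "finite V" "V \<subseteq> T"
  shows "e \<in> poly_values h x V \<Longrightarrow> e \<noteq> 0 \<Longrightarrow> mult_op (\<Delta> ^ N * e) \<in> K \<Longrightarrow> \<exists>N. mult_op (\<Delta> ^ N) \<in> K"
  using V
proof (induction V arbitrary: e N)
  case empty
  obtain p where p: "vars_in {} p" "e = mpeval h x p" using empty.prems(1) unfolding poly_values_def by blast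
  have "\<exists>c. mpeval h x p = h c"
    using p(1)
  proof (induction p rule: vars_in_induct)
    case (add a b)
    then obtain c d where "mpeval h x a = h c" "mpeval h x b = h d" by blast
    then show ?case by (intro exI[of _ "c + d"]) (simp add: ev_simps alg_simps)
  next
    case (mult a b)
    then obtain c d where "mpeval h x a = h c" "mpeval h x b = h d" by blast
    then show ?case by (intro exI[of _ "c * d"]) (simp add: ev_simps alg_simps)
  qed (auto simp: ev_simps)
  then obtain c where c: "e = h c" using p(2) by blast
  have "c \<noteq> 0" using empty.prems(2) alg_simps(4) c by metis
  then have "h c * h (inverse c) = 1" by (simp flip: alg_simps(1,3))
  have "mult_op (h (inverse c)) \<circ> mult_op (\<Delta> ^ N * e) \<in> K"
    by (rule op_idealD(4)[OF J subalgD(3)[OF subalg_DA] empty.prems(3)])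
  moreover have "h (inverse c) * (\<Delta> ^ N * e) = \<Delta> ^ N"
    using \<open>h c * h (inverse c) = 1\<close> by (simp add: c mult_ac)
  ultimately show ?case by (auto simp only: mult_op_comp)
next
  case (insert j V)
  have j: "j \<in> T" and VT: "V \<subseteq> T" using insert.prems(4) by auto
  obtain q where q: "\<And>k. coeff q k \<in> poly_values h x V" "e = poly q (x j)"
    using poly_values_insert[OF alg insert.prems(1)] by blast
  define d where "d = degree q"
  have lead: "coeff q d \<noteq> 0" unfolding d_def using q(2) insert.prems(2) by auto
  obtain \<tau> where \<tau>: "\<And>a b. \<tau> (a + b) = \<tau> a + \<tau> b" "\<And>a b. \<tau> (a * b) = \<tau> a * \<tau> b"
    "\<And>c. \<tau> (h c) = fps_const (h c)" "\<And>a. fps_nth (\<tau> a) 0 = a"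
    "\<tau> (x j) = fps_const (x j) + fps_const (\<Delta>\<^sup>2) * fps_X" "\<And>l. l \<in> T \<Longrightarrow> l \<noteq> j \<Longrightarrow> \<tau> (x l) = fps_const (x l)"
    using higher_derivation[OF perfect j] by blast
  have \<tau>1: "\<tau> 1 = 1" and \<tau>0: "\<tau> 0 = 0"
    using \<tau>(3)[of 1] \<tau>(3)[of 0] by (simp_all add: alg_simps)
  have \<tau>_pow: "\<tau> (a ^ k) = \<tau> a ^ k" for a k by (induction k) (simp_all add: \<tau>(2) \<tau>1)
  have \<tau>_sum: "\<tau> (sum g S) = (\<Sum>i\<in>S. \<tau> (g i))" for g :: "nat \<Rightarrow> 'a" and S
    by (induction S rule: infinite_finite_induct) (simp_all add: \<tau>(1) \<tau>0)
  have hc: "kalg hc" by (rule kalg_fps_const[OF alg])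
  \<comment> \<open>The shift moves \<open>x j\<close> only, so the coefficients of
    \<open>q\<close>, being polynomials in the other variables, are fixed.\<close>
  have \<tau>_V: "\<tau> a = fps_const a" if a: "a \<in> poly_values h x V" for a
  proof -
    obtain p where p: "vars_in V p" "a = mpeval h x p" using a unfolding poly_values_def by blast
    have "\<tau> a = mpeval hc (\<lambda>i. \<tau> (x i)) p"
      unfolding p(2) by (rule mpeval_hom[OF alg hc \<tau>(1,2,3)])
    also have "\<dots> = mpeval hc (\<lambda>i. fps_const (x i)) p"
      using VT insert.hyps(2) \<tau>(6) by (intro mpeval_cong[OF hc p(1)]) auto
    also have "\<dots> = fps_const a"
      unfolding p(2) by (rule mpeval_hom[OF alg hc, symmetric]) simp_all
    finally show ?thesis .
  qed
  define v where "v = \<tau> e"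
  define u where "u = \<tau> (\<Delta> ^ N)"
  \<comment> \<open>Powers of the shifted variable with exponent below \<open>d\<close> have no
    coefficient of order \<open>d\<close>, so only the leading term contributes.\<close>
  have vd: "fps_nth v d = coeff q d * (\<Delta>\<^sup>2) ^ d"
  proof -
    have "v = (\<Sum>k\<le>d. fps_const (coeff q k) * (fps_const (x j) + fps_const (\<Delta>\<^sup>2) * fps_X) ^ k)"
      unfolding v_def q(2) poly_altdef d_def by (simp add: \<tau>_sum \<tau>(2) \<tau>_pow \<tau>_V[OF q(1)] \<tau>(5))
    then have "fps_nth v d = (\<Sum>k\<le>d. coeff q k * fps_nth ((fps_const (x j) + fps_const (\<Delta>\<^sup>2) * fps_X) ^ k) d)"
      by (simp add: fps_sum_nth)
    also have "\<dots> = (\<Sum>k\<le>d. if k = d then coeff q d * (\<Delta>\<^sup>2) ^ d else 0)"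
      by (intro sum.cong refl) (simp add: fps_linear_power_nth)
    finally show ?thesis by simp
  qed
  have scale: "mult_op (b * a) \<in> K" if "mult_op a \<in> K" for a b
    using op_idealD(4)[OF J subalgD(3)[OF subalg_DA, of b] that] by (simp only: mult_op_comp)
  have uv: "mult_op (fps_nth (u * v) k) \<in> K" for k
    using higher_derivation_stable[OF J \<tau>(1-4) insert.prems(3), of k] by (simp only: u_def v_def \<tau>(2))
  \<comment> \<open>The ideal contains the coefficients of \<open>u * v\<close>, whereas those of
    \<open>v\<close> are wanted. As \<open>u\<close> has constant coefficient
    \<open>\<Delta> ^ N\<close>, the system is triangular, and each order costs one more factor
    \<open>\<Delta> ^ N\<close>.\<close>
  have vk: "mult_op (\<Delta> ^ (N * Suc k) * fps_nth v k) \<in> K" for k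
  proof (induction k rule: less_induct)
    case (less k)
    have "fps_nth (u * v) k = \<Delta> ^ N * fps_nth v k + (\<Sum>i\<in>{1..k}. fps_nth u i * fps_nth v (k - i))"
      by (simp add: fps_mult_nth sum.atLeast_Suc_atMost u_def \<tau>(4))
    then have "\<Delta> ^ (N * Suc k) * fps_nth v k = \<Delta> ^ (N * k) * fps_nth (u * v) k
        - (\<Sum>i\<in>{1..k}. fps_nth u i * (\<Delta> ^ (N * k) * fps_nth v (k - i)))"
      by (simp add: algebra_simps power_add sum_distrib_left)
    then have eq: "mult_op (\<Delta> ^ (N * Suc k) * fps_nth v k) =
        (\<lambda>y. mult_op (\<Delta> ^ (N * k) * fps_nth (u * v) k) y
        - (\<Sum>i\<in>{1..k}. mult_op (fps_nth u i * (\<Delta> ^ (N * k) * fps_nth v (k - i))) y))"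
      by (simp add: fun_eq_iff left_diff_distrib sum_distrib_right)
    have "mult_op (fps_nth u i * (\<Delta> ^ (N * k) * fps_nth v (k - i))) \<in> K" if i: "i \<in> {1..k}" for i
    proof -
      have "Suc (k - i) \<le> k" using i by auto
      then have "N * k = N * (k - Suc (k - i)) + N * Suc (k - i)"
        by (metis add_mult_distrib2 le_add_diff_inverse2)
      then have "fps_nth u i * (\<Delta> ^ (N * k) * fps_nth v (k - i)) =
          (fps_nth u i * \<Delta> ^ (N * (k - Suc (k - i)))) * (\<Delta> ^ (N * Suc (k - i)) * fps_nth v (k - i))"
        by (simp only: power_add mult_ac)
      moreover have "mult_op (\<Delta> ^ (N * Suc (k - i)) * fps_nth v (k - i)) \<in> K"
        using i by (intro less.IH) auto
      ultimately show ?thesis using scale by metis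
    qed
    then show ?case
      unfolding eq by (intro op_idealD(3)[OF J scale[OF uv]] op_ideal_sum[OF J]) blast
  qed
  have "\<Delta> ^ (N * Suc d) * fps_nth v d = \<Delta> ^ (N * Suc d + 2 * d) * coeff q d"
    unfolding vd power_add power_mult[symmetric] by (simp only: mult_ac)
  then have "mult_op (\<Delta> ^ (N * Suc d + 2 * d) * coeff q d) \<in> K" using vk[of d] by (simp only:)
  then show ?case using insert.IH[OF q(1) lead _ VT] by blast
qed

proposition power_in_ideal:
  assumes perfect: "perfect_field TYPE('k)" and J: "op_ideal (DA h) K" "K \<noteq> {\<lambda>_. 0}"
  obtains N where "mult_op (\<Delta> ^ N) \<in> K"
proof -
  have scale: "mult_op (b * a) \<in> K" if "mult_op a \<in> K" for a b
    using op_idealD(4)[OF J(1) subalgD(3)[OF subalg_DA, of b] that] by (simp only: mult_op_comp)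
  obtain a where a: "a \<noteq> 0" "mult_op a \<in> K" using op_ideal_meets[OF subalg_DA J] by blast
  obtain p s where ps: "vars_in {..<n} p" "mpeval h x s dvd 1" "a * mpeval h x s = mpeval h x p"
    using fraction_form[of a] by metis
  have "mpeval h x s \<noteq> 0" using ps(2) by auto
  then have pnz: "mpeval h x p \<noteq> 0" using a(1) ps(3) by (metis mult_eq_0_iff)
  \<comment> \<open>Here algebraicity is used over A itself: a nonzero multiple of the numerator is
    a polynomial in the variables of \<open>T\<close>, from which the elimination starts with
    exponent 0.\<close>
  obtain w g where wg: "vars_in T g" "mpeval h x p * mpeval h x w = mpeval h x g" "mpeval h x g \<noteq> 0"
    using chart_algebraic[OF alg _ chart_nonzero ps(1) pnz] f_zero ri(2) by (metis image_subset_iff lessThan_iff)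
  have "mpeval h x g = (mpeval h x s * mpeval h x w) * a"
    using wg(2) ps(3) by (metis mult.commute mult.left_commute)
  then have "mult_op (\<Delta> ^ 0 * mpeval h x g) \<in> K" using scale[OF a(2)] by simp
  moreover have "mpeval h x g \<in> poly_values h x T" using wg(1) unfolding poly_values_def by blast
  moreover have "finite T" unfolding T_def by simp
  ultimately have "\<exists>N. mult_op (\<Delta> ^ N) \<in> K"
    using eliminate[OF perfect J(1) _ order_refl _ wg(3), of 0] by blast
  then show thesis using that by blast
qed

end

lemma (in presentation) locally_simple_off_jacobian:
  assumes perfect: "perfect_field TYPE('k)" and M: "maximal_ideal M"
    and off: "\<not> jacobian_ideal h n x m f \<subseteq> M"
  shows "locally_simple (DA h) M"
  unfolding locally_simple_def
proof (intro allI impI, elim conjE)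
  fix K assume K: "op_ideal (DA h) K" "K \<noteq> {\<lambda>_. 0}"
  define r where "r = mat_rank (jacobi_matrix h x f) m n"
  let ?G = "minors (jacobi_matrix h x f) m n r"
  have "is_ideal M" using M by (simp add: maximal_ideal_def)
  then have "\<not> ?G \<subseteq> M"
    using off unfolding jacobian_ideal_def ideal_gen_def r_def[symmetric] by blast
  then obtain ri ci where d: "minor (jacobi_matrix h x f) r ri ci \<notin> M"
    and rc: "inj_on ri {..<r}" "ri ` {..<r} \<subseteq> {..<m}" "inj_on ci {..<r}" "ci ` {..<r} \<subseteq> {..<n}"
    unfolding minors_def by blast
  have eq: "minor (jacobi_matrix h x f) r ri ci = ndet r (\<lambda>i j. mpeval h x (mpderiv (ci j) (f (ri i))))"
    by (simp add: minor_eq_ndet jacobi_matrix_eq)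
  have nz: "ndet r (\<lambda>i j. mpeval h x (mpderiv (ci j) (f (ri i)))) \<noteq> 0"
    using d maximal_idealD(1)[OF M] unfolding eq by metis
  interpret jacobi_chart h n x m f r ri ci
    by unfold_locales (rule r_def rc nz)+
  obtain N where N: "mult_op (\<Delta> ^ N) \<in> K" using power_in_ideal[OF perfect K] by blast
  moreover have "\<Delta> ^ N \<notin> M"
    using d by (intro maximal_ideal_power[OF M]) (simp add: eq \<Delta>_def)
  ultimately show "\<exists>s. s \<notin> M \<and> mult_op s \<in> K" by blast
qed

theorem theorem1p12:
  fixes h :: "'k::field \<Rightarrow> 'a::idom"
    and n m :: nat and x :: "nat \<Rightarrow> 'a" and f :: "nat \<Rightarrow> 'k mpoly"
    and R :: "('a \<Rightarrow> 'a) set"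
  assumes perfect: "perfect_field TYPE('k)"
    and alg: "kalg h"
    and pres: "ess_fin_pres h n x m f"
    and subalg: "subalg_containing_A h R"
    and ess: "essential_in (DA h) R"
  defines "cond1 \<equiv> simple_alg R"
    and "condb \<equiv> \<forall>M. maximal_ideal M \<and> (\<exists>i\<ge>1. b_ideal h R i \<subseteq> M) \<longrightarrow> simple_alg (loc_alg h R M)"
    and "condc \<equiv> \<forall>M. maximal_ideal M \<and> (\<exists>i\<ge>1. c_ideal h R i \<subseteq> M) \<longrightarrow> simple_alg (loc_alg h R M)"
    and "condJ \<equiv> \<forall>N. maximal_ideal N \<and> jacobian_ideal h n x m f \<subseteq> N \<longrightarrow> simple_alg (loc_alg h (DA h) N)"
  shows "(cond1 \<longleftrightarrow> simple_alg (DA h) \<and> condb)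
       \<and> (cond1 \<longleftrightarrow> condJ \<and> condb)
       \<and> (cond1 \<longleftrightarrow> simple_alg (DA h) \<and> condc)
       \<and> (cond1 \<longleftrightarrow> condJ \<and> condc)"
proof -
  interpret presentation h n x m f by unfold_locales (fact alg pres)+
  have loc_R: "simple_alg (loc_alg h R M) \<longleftrightarrow> locally_simple R M" if "maximal_ideal M" for M
    using localization.simple_loc_alg_iff[OF localization.intro[OF that] subalg] .
  have loc_D: "simple_alg (loc_alg h (DA h) M) \<longleftrightarrow> locally_simple (DA h) M" if "maximal_ideal M" for M
    using localization.simple_loc_alg_iff[OF localization.intro[OF that] subalg_DA] .
  have bc: "condb \<longleftrightarrow> condc"
    unfolding condb_def condc_def using b_ideal_subset_iff_c_ideal_subset[OF subalg] by blast
  \<comment> \<open>At maximal ideals that do not contain the Jacobian ideal local simplicity holds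
    anyway, so only the others remain as a condition.\<close>
  have DJ: "simple_alg (DA h) \<longleftrightarrow> condJ"
    unfolding condJ_def simple_iff_locally_simple[OF subalg_DA]
    using loc_D locally_simple_off_jacobian[OF perfect] by blast
  have Rb: "cond1 \<longleftrightarrow> simple_alg (DA h) \<and> condb"
  proof
    assume "cond1"
    then show "simple_alg (DA h) \<and> condb"
      unfolding cond1_def condb_def
      using simple_DA_if_simple[OF subalg] simple_imp_locally_simple[OF subalg] loc_R by blast
  next
    assume *: "simple_alg (DA h) \<and> condb"
    have "locally_simple R M" if M: "maximal_ideal M" for M
    \<comment> \<open>Where some \<open>b_ideal\<close> lies in \<open>M\<close>, the condition
      gives local simplicity directly; elsewhere it is transferred from \<open>DA h\<close>.\<close>
    proof (cases "\<exists>i\<ge>1. b_ideal h R i \<subseteq> M")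
      case True
      then show ?thesis using * M loc_R unfolding condb_def by blast
    next
      case False
      then show ?thesis
        using locally_simple_transfer[OF subalg M] simple_imp_locally_simple[OF subalg_DA _ M] * by blast
    qed
    then show cond1
      unfolding cond1_def simple_iff_locally_simple[OF subalg] by blast
  qed
  show ?thesis using Rb bc DJ by blast
qed

end
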